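(* Let $M$ be a 2-manifold and let $x:M\to\mathbb{R}^3_1$ or $x:M\to\mathbb{R}^3_0$ be a space-like oriented surface with non-zero principal curvatures. If $x$ is a minimal surface, then the Laguerre surface $(x',\xi'):M\to U\mathbb{R}^3$ that it induces through the Laguerre embedding $\sigma:U\mathbb{R}^3_1\to U\mathbb{R}^3$, respectively $\tau:U\mathbb{R}^3_0\to U\mathbb{R}^3$, is Laguerre minimal.
   Context: All maps are smooth. Laguerre surfaces in $U\mathbb{R}^3=\mathbb{R}^3\times S^2$: a map $f=(x',\xi'):M\to U\mathbb{R}^3$ from a 2-manifold is a Laguerre surface if $\xi':M\to\mathbb{R}^3$ is an immersion and $dx'\cdot\xi'=0$. Then $dx'=-d\xi'\circ R$ for an endomorphism $R$ of $TM$, self-adjoint with respect to $III'=d\xi'\cdot d\xi'$; its eigenvalues $r_1',r_2'$ are the curvature radii, $r'=\frac12(r_1'+r_2')$. The surface is umbilical free if $r_1'\ne r_2'$ everywhere. The Laguerre metric of an umbilical free Laguerre surface is $g=\big(\sum_i(r_i'-r')^2\big)III'$ and the Laguerre functional is its total area $L(f)=\mathrm{Vol}_g(M)$. The Laguerre surface is Laguerre minimal if it is a critical point of $L$, i.e. the derivative at $t=0$ of the $g$-area is zero for all compactly supported smooth variations through umbilical free Laguerre surfaces. The space $\mathbb{R}^3_1$: $\mathbb{R}^3$ with $\langle X,Y\rangle=X_1Y_1+X_2Y_2-X_3Y_3$, and $U\mathbb{R}^3_1=\{(x,\xi): x\in\mathbb{R}^3_1,\ \langle\xi,\xi\rangle=-1\}$.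 Writing $x=(x_0,x_1)$, $\xi=(\xi_0,\xi_1)\in\mathbb{R}^2\times\mathbb{R}$, the embedding $\sigma(x,\xi)=(x',\xi')$ is $x'=\big(-\frac{x_1}{\xi_1},\,x_0-\frac{x_1}{\xi_1}\xi_0\big)$, $\xi'=\big(\frac1{\xi_1},\frac{\xi_0}{\xi_1}\big)$. For a space-like oriented surface $x:M\to\mathbb{R}^3_1$, $\xi$ is its unit normal field with $\langle\xi,\xi\rangle=-1$. The space $\mathbb{R}^3_0$: let $\mathbb{R}^4_1$ be $\mathbb{R}^4$ with $\langle X,Y\rangle=X_1Y_1+X_2Y_2+X_3Y_3-X_4Y_4$, $\nu=(1,0,0,1)$, $\mathbb{R}^3_0=\{X\in\mathbb{R}^4_1:\langle X,\nu\rangle=0\}$, and $U\mathbb{R}^3_0=\{(x,\xi)\in\mathbb{R}^4_1\times\mathbb{R}^4_1:\langle x,\nu\rangle=0,\ \langle\xi,\xi\rangle=0,\ \langle\xi,\nu\rangle=1\}$. Writing $x=(x_1,x_0,x_1)$, $\xi=(\xi_1+1,\xi_0,\xi_1)\in\mathbb{R}\times\mathbb{R}^2\times\mathbb{R}$, the embedding $\tau(x,\xi)=(x',\xi')$ is $x'=\big(-\frac{x_1}{\xi_1},\,x_0-\frac{x_1}{\xi_1}\xi_0\big)$, $\xi'=\big(1+\frac1{\xi_1},\frac{\xi_0}{\xi_1}\big)$. For a space-like oriented surface $x:M\to\mathbb{R}^3_0$ (immersion with positive definite induced metric), $\xi:M\to\mathbb{R}^4_1$ is the unique map with $\langle\xi,dx\rangle=0$,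 $\langle\xi,\xi\rangle=0$, $\langle\xi,\nu\rangle=1$. In both cases the shape operator $S:TM\to TM$ is defined by $d\xi=-dx\circ S$; it is self-adjoint for the induced metric, its eigenvalues $k_1,k_2$ are the principal curvatures, and $x$ is minimal if $k_1+k_2=0$. The induced Laguerre surface is $(x',\xi')=\sigma\circ(x,\xi)$, respectively $\tau\circ(x,\xi)$. *)

theory Defs
  imports "HOL-Analysis.Analysis"
begin

section \<open>Smooth maps and smooth surfaces\<close>

fun C_k_on :: "nat \<Rightarrow> 'e::real_normed_vector set \<Rightarrow> ('e \<Rightarrow> 'f::real_normed_vector) \<Rightarrow> bool" where
  "C_k_on 0 S f \<longleftrightarrow> continuous_on S f"
| "C_k_on (Suc k) S f \<longleftrightarrow>
     (\<forall>y\<in>S. f differentiable (at y)) \<and>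
     (\<forall>v. C_k_on k S (\<lambda>y. frechet_derivative f (at y) v))"

text \<open>Meant for open \<open>S\<close> in a finite-dimensional space, where it says \<open>C\<^sup>\<infinity>\<close>.\<close>

definition smooth_on :: "'e::real_normed_vector set \<Rightarrow> ('e \<Rightarrow> 'f::real_normed_vector) \<Rightarrow> bool" where
  "smooth_on S f \<longleftrightarrow> (\<forall>k. C_k_on k S f)"

type_synonym 'a chart = "'a set \<times> ('a \<Rightarrow> real^2)"

definition chart_inv :: "'a chart \<Rightarrow> real^2 \<Rightarrow> 'a" where
  "chart_inv c = inv_into (fst c) (snd c)"

text \<open>The underlying set of the 2-manifold is the whole type \<open>'a\<close>, a second countable Hausdorff
  space; its smooth structure is given by an atlas, which need not be maximal.\<close>

definition smooth_2_atlas :: "'a::{t2_space,second_countable_topology} chart set \<Rightarrow> bool" where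
  "smooth_2_atlas A \<longleftrightarrow>
     (\<Union>c\<in>A. fst c) = UNIV \<and>
     (\<forall>c\<in>A. open (fst c) \<and> open (snd c ` fst c) \<and>
        homeomorphism (fst c) (snd c ` fst c) (snd c) (chart_inv c)) \<and>
     (\<forall>c\<in>A. \<forall>d\<in>A. smooth_on (snd c ` (fst c \<inter> fst d)) (snd d \<circ> chart_inv c))"

definition smooth_map :: "'a chart set \<Rightarrow> ('a \<Rightarrow> 'f::real_normed_vector) \<Rightarrow> bool" where
  "smooth_map A f \<longleftrightarrow> (\<forall>c\<in>A. smooth_on (snd c ` fst c) (f \<circ> chart_inv c))"

text \<open>\<open>dmap c f p\<close> is the differential of \<open>f\<close> at \<open>p\<close>, the tangent space at \<open>p\<close> being identified
  with \<open>\<real>\<^sup>2\<close> by the coordinate frame of the chart \<open>c\<close> (whose domain must contain \<open>p\<close>).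
  Endomorphisms of the tangent space are likewise linear maps of \<open>\<real>\<^sup>2\<close>; in another chart they
  become conjugate maps, so that their eigenvalues are intrinsic.\<close>

definition dmap :: "'a chart \<Rightarrow> ('a \<Rightarrow> 'f::real_normed_vector) \<Rightarrow> 'a \<Rightarrow> real^2 \<Rightarrow> 'f" where
  "dmap c f p = frechet_derivative (f \<circ> chart_inv c) (at (snd c p))"

definition immersion :: "'a chart set \<Rightarrow> ('a \<Rightarrow> 'f::real_normed_vector) \<Rightarrow> bool" where
  "immersion A f \<longleftrightarrow> smooth_map A f \<and> (\<forall>c\<in>A. \<forall>p\<in>fst c. inj (dmap c f p))"

text \<open>The endomorphism \<open>T\<close> of the tangent space with \<open>d\<eta> = - d\<zeta> \<circ> T\<close>.\<close>

definition neg_quotient ::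
    "'a chart \<Rightarrow> ('a \<Rightarrow> 'f::real_normed_vector) \<Rightarrow> ('a \<Rightarrow> 'f) \<Rightarrow> 'a \<Rightarrow> real^2 \<Rightarrow> real^2" where
  "neg_quotient c \<eta> \<zeta> p =
     (THE T. linear T \<and> (\<forall>v. dmap c \<eta> p v = - dmap c \<zeta> p (T v)))"

text \<open>The two eigenvalues, in increasing order and repeated according to multiplicity, of an
  endomorphism of \<open>\<real>\<^sup>2\<close> that has an eigenbasis. It is used for maps that are self-adjoint with
  respect to some inner product, which always have one.\<close>

definition eigenvalues :: "(real^2 \<Rightarrow> real^2) \<Rightarrow> real \<times> real" where
  "eigenvalues T = (THE (a, b). a \<le> b \<and>
     (\<exists>v w. v \<noteq> w \<and> independent {v, w} \<and> T v = a *\<^sub>R v \<and> T w = b *\<^sub>R w))"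

text \<open>The Riemannian measure of a metric \<open>g\<close>, where \<open>g c p\<close> is the metric at \<open>p\<close> in the frame of
  the chart \<open>c\<close>: in every chart it has the density \<open>sqrt (det g)\<close>.\<close>

definition volume_density :: "(real^2 \<Rightarrow> real^2 \<Rightarrow> real) \<Rightarrow> real" where
  "volume_density h = sqrt (det (\<chi> i j. h (axis i 1) (axis j 1) :: real^2^2))"

definition riemannian_measure ::
    "'a::{t2_space,second_countable_topology} chart set \<Rightarrow>
     ('a chart \<Rightarrow> 'a \<Rightarrow> real^2 \<Rightarrow> real^2 \<Rightarrow> real) \<Rightarrow> 'a measure" where
  "riemannian_measure A g = (THE \<mu>. sets \<mu> = sets borel \<and>
     (\<forall>c\<in>A. \<forall>B\<in>sets borel. B \<subseteq> fst c \<longrightarrow>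
        emeasure \<mu> B =
          (\<integral>\<^sup>+ y\<in>snd c ` B. ennreal (volume_density (g c (chart_inv c y))) \<partial>lborel)))"


section \<open>Laguerre surfaces\<close>

type_synonym 'a contact_map = "'a \<Rightarrow> (real^3) \<times> (real^3)"

definition laguerre_surface :: "'a chart set \<Rightarrow> 'a contact_map \<Rightarrow> bool" where
  "laguerre_surface A f \<longleftrightarrow>
     smooth_map A (fst \<circ> f) \<and> immersion A (snd \<circ> f) \<and>
     (\<forall>p. norm (snd (f p)) = 1) \<and>
     (\<forall>c\<in>A. \<forall>p\<in>fst c. \<forall>v. dmap c (fst \<circ> f) p v \<bullet> snd (f p) = 0)"

definition curvature_radii :: "'a chart \<Rightarrow> 'a contact_map \<Rightarrow> 'a \<Rightarrow> real \<times> real" where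
  "curvature_radii c f p = eigenvalues (neg_quotient c (fst \<circ> f) (snd \<circ> f) p)"

definition umbilical_free :: "'a chart set \<Rightarrow> 'a contact_map \<Rightarrow> bool" where
  "umbilical_free A f \<longleftrightarrow>
     (\<forall>c\<in>A. \<forall>p\<in>fst c. fst (curvature_radii c f p) \<noteq> snd (curvature_radii c f p))"

definition laguerre_metric ::
    "'a contact_map \<Rightarrow> 'a chart \<Rightarrow> 'a \<Rightarrow> real^2 \<Rightarrow> real^2 \<Rightarrow> real" where
  "laguerre_metric f c p v w =
     (let (r1, r2) = curvature_radii c f p; r = (r1 + r2) / 2
      in ((r1 - r)\<^sup>2 + (r2 - r)\<^sup>2) * (dmap c (snd \<circ> f) p v \<bullet> dmap c (snd \<circ> f) p w))"

text \<open>The contribution of \<open>K\<close> to the Laguerre functional; the whole functional is the case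
  \<open>K = UNIV\<close>.\<close>

definition laguerre_area ::
    "'a::{t2_space,second_countable_topology} chart set \<Rightarrow> 'a contact_map \<Rightarrow> 'a set \<Rightarrow> real" where
  "laguerre_area A f K = measure (riemannian_measure A (laguerre_metric f)) K"

text \<open>Smooth variations, through umbilical free Laguerre surfaces, that are constant off \<open>K\<close>.\<close>

definition laguerre_variation ::
    "'a::{t2_space,second_countable_topology} chart set \<Rightarrow> 'a contact_map \<Rightarrow>
     real \<Rightarrow> 'a set \<Rightarrow> (real \<Rightarrow> 'a contact_map) \<Rightarrow> bool" where
  "laguerre_variation A f \<epsilon> K F \<longleftrightarrow>
     \<epsilon> > 0 \<and> compact K \<and> F 0 = f \<and>
     (\<forall>c\<in>A. smooth_on ({-\<epsilon><..<\<epsilon>} \<times> snd c ` fst c) (\<lambda>(t, y). F t (chart_inv c y))) \<and>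
     (\<forall>t\<in>{-\<epsilon><..<\<epsilon>}. laguerre_surface A (F t) \<and> umbilical_free A (F t) \<and>
        (\<forall>p. p \<notin> K \<longrightarrow> F t p = f p))"

text \<open>The total area of a noncompact surface may be infinite. As usual, the derivative of the area
  is that of the area of a compact set containing the support of the variation.\<close>

definition laguerre_minimal ::
    "'a::{t2_space,second_countable_topology} chart set \<Rightarrow> 'a contact_map \<Rightarrow> bool" where
  "laguerre_minimal A f \<longleftrightarrow>
     laguerre_surface A f \<and> umbilical_free A f \<and>
     (\<forall>\<epsilon> K F. laguerre_variation A f \<epsilon> K F \<longrightarrow>
        ((\<lambda>t. laguerre_area A (F t) K) has_real_derivative 0) (at 0))"


section \<open>Space-like surfaces and their Laguerre embeddings\<close>

definition lorentz3 :: "real^3 \<Rightarrow> real^3 \<Rightarrow> real" where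
  "lorentz3 X Y = X$1 * Y$1 + X$2 * Y$2 - X$3 * Y$3"

definition lorentz4 :: "real^4 \<Rightarrow> real^4 \<Rightarrow> real" where
  "lorentz4 X Y = X$1 * Y$1 + X$2 * Y$2 + X$3 * Y$3 - X$4 * Y$4"

definition null_vec :: "real^4" where
  "null_vec = vector [1, 0, 0, 1]"

definition spacelike :: "('f \<Rightarrow> 'f \<Rightarrow> real) \<Rightarrow> 'a chart set \<Rightarrow> ('a \<Rightarrow> 'f::real_normed_vector) \<Rightarrow> bool" where
  "spacelike B A x \<longleftrightarrow>
     immersion A x \<and>
     (\<forall>c\<in>A. \<forall>p\<in>fst c. \<forall>v. v \<noteq> 0 \<longrightarrow> B (dmap c x p v) (dmap c x p v) > 0)"

text \<open>A space-like surface together with its normal field \<open>\<xi>\<close>. In \<open>\<real>\<^sup>3\<^sub>1\<close> the choice of \<open>\<xi>\<close> is the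
  orientation; in \<open>\<real>\<^sup>3\<^sub>0\<close> the conditions determine \<open>\<xi>\<close>.\<close>

definition oriented_spacelike_31 ::
    "'a chart set \<Rightarrow> ('a \<Rightarrow> real^3) \<Rightarrow> ('a \<Rightarrow> real^3) \<Rightarrow> bool" where
  "oriented_spacelike_31 A x \<xi> \<longleftrightarrow>
     spacelike lorentz3 A x \<and> smooth_map A \<xi> \<and>
     (\<forall>p. lorentz3 (\<xi> p) (\<xi> p) = -1) \<and>
     (\<forall>c\<in>A. \<forall>p\<in>fst c. \<forall>v. lorentz3 (\<xi> p) (dmap c x p v) = 0)"

definition oriented_spacelike_30 ::
    "'a chart set \<Rightarrow> ('a \<Rightarrow> real^4) \<Rightarrow> ('a \<Rightarrow> real^4) \<Rightarrow> bool" where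
  "oriented_spacelike_30 A x \<xi> \<longleftrightarrow>
     (\<forall>p. lorentz4 (x p) null_vec = 0) \<and>
     spacelike lorentz4 A x \<and> smooth_map A \<xi> \<and>
     (\<forall>p. lorentz4 (\<xi> p) (\<xi> p) = 0 \<and> lorentz4 (\<xi> p) null_vec = 1) \<and>
     (\<forall>c\<in>A. \<forall>p\<in>fst c. \<forall>v. lorentz4 (\<xi> p) (dmap c x p v) = 0)"

definition principal_curvatures ::
    "'a chart \<Rightarrow> ('a \<Rightarrow> 'f::real_normed_vector) \<Rightarrow> ('a \<Rightarrow> 'f) \<Rightarrow> 'a \<Rightarrow> real \<times> real" where
  "principal_curvatures c x \<xi> p = eigenvalues (neg_quotient c \<xi> x p)"

definition nonzero_principal_curvatures ::
    "'a chart set \<Rightarrow> ('a \<Rightarrow> 'f::real_normed_vector) \<Rightarrow> ('a \<Rightarrow> 'f) \<Rightarrow> bool" where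
  "nonzero_principal_curvatures A x \<xi> \<longleftrightarrow>
     (\<forall>c\<in>A. \<forall>p\<in>fst c. fst (principal_curvatures c x \<xi> p) \<noteq> 0 \<and>
                        snd (principal_curvatures c x \<xi> p) \<noteq> 0)"

definition minimal_surface ::
    "'a chart set \<Rightarrow> ('a \<Rightarrow> 'f::real_normed_vector) \<Rightarrow> ('a \<Rightarrow> 'f) \<Rightarrow> bool" where
  "minimal_surface A x \<xi> \<longleftrightarrow>
     (\<forall>c\<in>A. \<forall>p\<in>fst c. fst (principal_curvatures c x \<xi> p) + snd (principal_curvatures c x \<xi> p) = 0)"

text \<open>\<open>\<sigma>\<close> and \<open>\<tau>\<close>. The splitting \<open>x = (x\<^sub>0, x\<^sub>1) \<in> \<real>\<^sup>2 \<times> \<real>\<close> makes \<open>x\<^sub>1\<close> the third component in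
  \<open>\<real>\<^sup>3\<^sub>1\<close>; the splitting \<open>(x\<^sub>1, x\<^sub>0, x\<^sub>1)\<close>, \<open>(\<xi>\<^sub>1 + 1, \<xi>\<^sub>0, \<xi>\<^sub>1)\<close> makes \<open>x\<^sub>1\<close>, \<open>\<xi>\<^sub>1\<close> the fourth
  components in \<open>\<real>\<^sup>4\<^sub>1\<close>.\<close>

definition laguerre_sigma :: "(real^3) \<times> (real^3) \<Rightarrow> (real^3) \<times> (real^3)" where
  "laguerre_sigma = (\<lambda>(x, \<xi>).
     (vector [- (x$3 / \<xi>$3), x$1 - x$3 / \<xi>$3 * \<xi>$1, x$2 - x$3 / \<xi>$3 * \<xi>$2],
      vector [1 / \<xi>$3, \<xi>$1 / \<xi>$3, \<xi>$2 / \<xi>$3]))"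

definition laguerre_tau :: "(real^4) \<times> (real^4) \<Rightarrow> (real^3) \<times> (real^3)" where
  "laguerre_tau = (\<lambda>(x, \<xi>).
     (vector [- (x$4 / \<xi>$4), x$2 - x$4 / \<xi>$4 * \<xi>$2, x$3 - x$4 / \<xi>$4 * \<xi>$3],
      vector [1 + 1 / \<xi>$4, \<xi>$2 / \<xi>$4, \<xi>$3 / \<xi>$4]))"

end

theory Submission
  imports Defs
begin

text \<open>Write \<open>n = \<xi>'\<close>. Since \<open>dx' = - dn \<circ> R\<close>, the Laguerre density \<open>((tr R)\<^sup>2 / 2 - 2 det R) dA\<close> is a
  rational function of triple products of \<open>n\<close> with first derivatives of \<open>x'\<close> and \<open>n\<close>. For a variation
  \<open>(V, W)\<close> of \<open>(x', n)\<close> its derivative is \<open>-2 det (n, d(V + r W), dx' + r dn)\<close> with the mean radius \<open>r\<close>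
  held fixed, and this two-form is \<open>-2 d\<omega>\<close>, where
  \<open>\<omega> = det (n, V + r W, dx' + r dn) + (V \<bullet> n) \<eta>\<close>, provided \<open>\<eta> = * dr\<close> is closed. So a Laguerre surface
  with harmonic mean radius is Laguerre minimal, by Stokes' theorem.

  For the surface induced by a minimal \<open>x\<close>, \<open>R = \<xi>\<^sub>1 S\<^sup>-\<^sup>1 + x\<^sub>1\<close>, so \<open>r = x\<^sub>1\<close>; and the conjugate form is
  \<open>\<eta> = \<xi>\<^sub>0\<^sub>1 dx\<^sub>0\<^sub>2 - \<xi>\<^sub>0\<^sub>2 dx\<^sub>0\<^sub>1\<close>, closed because \<open>d\<xi> = - dx \<circ> S\<close> with \<open>tr S = 0\<close>.\<close>

text \<open>The mean radius may be frozen by an envelope argument. In terms of the first derivatives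
  of x' and n, the quadratic C + \<rho> B + \<rho>^2 D is det (n, x_1 + \<rho> n_1, x_2 + \<rho>
  n_2), and the Laguerre density B^2 / (2 D) - 2 C is -2 times its critical value, attained at
  \<rho> = - B / (2 D) = r. So the variation of r does not contribute to first order. In d\<omega>,
  however, r is a function again; the additional terms with dr add up to minus the wedge product of
  d(V \<bullet> n) with \<eta>, and the summand (V \<bullet> n) \<eta> is there to cancel them.
  Signs are the second point: the density is a two-form in every chart, while the Riemannian measure
  takes its absolute value. The ratio to the density at time 0 is a positive function on the
  surface, so all areas become integrals against one fixed measure. That measure is given by a
  definite description; its existence and uniqueness come from a countable partition into pieces of
  charts. Stokes' theorem is then used one chart at a time, as the vanishing of the integral of a
  coordinate derivative of a compactly supported function.\<close>

abbreviation dd :: "('e::real_normed_vector \<Rightarrow> 'f::real_normed_vector) \<Rightarrow> 'e \<Rightarrow> 'e \<Rightarrow> 'f" where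
  "dd f y \<equiv> frechet_derivative f (at y)"

lemma differentiable_has_derivative:
  "f differentiable (at y) \<Longrightarrow> (f has_derivative dd f y) (at y)"
  using frechet_derivative_works by blast

section \<open>Closure properties of C^k maps on open sets\<close>

lemma C_k_on_cong:
  assumes "open S" "\<And>y. y \<in> S \<Longrightarrow> f y = g y" "C_k_on k S f"
  shows "C_k_on k S g"
  using assms(2,3)
proof (induction k arbitrary: f g)
  case 0
  then show ?case by (simp cong: continuous_on_cong)
next
  case (Suc k)
  have d: "g differentiable (at y)" "dd g y = dd f y"
    if "y \<in> S" for y
  proof -
    have f: "f differentiable (at y)" using Suc.prems that by simp
    show "g differentiable (at y)"
      using f assms(1) that Suc.prems(1)
      by (meson differentiable_def has_derivative_transform_within_open)
    show "dd g y = dd f y"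
      using frechet_derivative_transform_within_open[OF f assms(1) that Suc.prems(1)] by simp
  qed
  have "C_k_on k S (\<lambda>y. dd g y v)" for v
    by (rule Suc.IH[of "\<lambda>y. dd f y v"]) (use d Suc.prems in auto)
  with d show ?case by simp
qed

lemma C_k_on_SucD: "C_k_on (Suc k) S f \<Longrightarrow> C_k_on k S f"
proof (induction k arbitrary: f)
  case 0
  then show ?case
    by (auto intro!: continuous_at_imp_continuous_on differentiable_imp_continuous_within)
next
  case (Suc k)
  then show ?case using C_k_on.simps(2) by blast
qed

lemma C_k_on_imp_continuous_on: "C_k_on k S f \<Longrightarrow> continuous_on S f"
  by (induction k) (use C_k_on_SucD in auto)

lemma C_k_on_const [simp]: "C_k_on k S (\<lambda>y. c)"
  by (induction k arbitrary: c) auto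

text \<open>On an open set any pointwise formula for the derivative agrees with
  \<open>frechet_derivative\<close>, so the inductions below can work with the usual differentiation
  rules.\<close>

lemma C_k_on_SucI:
  assumes "open S" "\<And>y. y \<in> S \<Longrightarrow> (f has_derivative f' y) (at y)" "\<And>v. C_k_on k S (\<lambda>y. f' y v)"
  shows "C_k_on (Suc k) S f"
proof -
  have "C_k_on k S (\<lambda>y. dd f y v)" for v
    by (rule C_k_on_cong[OF assms(1) _ assms(3)[of v]]) (use assms(2) frechet_derivative_at in metis)
  with assms(2) show ?thesis by (auto simp: differentiable_def)
qed

lemma C_k_on_has_derivative:
  "C_k_on (Suc k) S f \<Longrightarrow> y \<in> S \<Longrightarrow> (f has_derivative dd f y) (at y)"
  by (simp add: differentiable_has_derivative)

lemma C_k_on_linear: "open S \<Longrightarrow> bounded_linear L \<Longrightarrow> C_k_on k S L"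
  by (cases k) (auto intro!: C_k_on_SucI[where f'="\<lambda>_. L"] bounded_linear_imp_has_derivative
      simp: linear_continuous_on simp del: C_k_on.simps(2))

lemma C_k_on_compose_linear:
  assumes "open S" "bounded_linear L" "C_k_on k S f"
  shows "C_k_on k S (\<lambda>y. L (f y))"
  using assms(3)
proof (induction k arbitrary: f)
  case 0
  then show ?case using assms(2) by (simp add: bounded_linear.continuous_on)
next
  case (Suc k)
  show ?case
  proof (rule C_k_on_SucI[OF assms(1)])
    show "((\<lambda>y. L (f y)) has_derivative (\<lambda>v. L (dd f y v))) (at y)" if "y \<in> S" for y
      by (rule bounded_linear.has_derivative[OF assms(2) C_k_on_has_derivative[OF Suc.prems that]])
  qed (use Suc in simp)
qed

lemma C_k_on_add:
  assumes "open S" "C_k_on k S f" "C_k_on k S g"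
  shows "C_k_on k S (\<lambda>y. f y + g y)"
  using assms(2,3)
proof (induction k arbitrary: f g)
  case 0
  then show ?case by (auto intro: continuous_intros)
next
  case (Suc k)
  show ?case
    by (rule C_k_on_SucI[OF assms(1)
          has_derivative_add[OF C_k_on_has_derivative[OF Suc.prems(1)] C_k_on_has_derivative[OF Suc.prems(2)]]])
       (use Suc in simp_all)
qed

lemma C_k_on_bilinear:
  assumes "open S" "bounded_bilinear pr" "C_k_on k S f" "C_k_on k S g"
  shows "C_k_on k S (\<lambda>y. pr (f y) (g y))"
  using assms(3,4)
proof (induction k arbitrary: f g)
  case 0
  then show ?case using bounded_bilinear.continuous_on[OF assms(2)] by simp
next
  case (Suc k)
  show ?case
  proof (rule C_k_on_SucI[OF assms(1)
          bounded_bilinear.FDERIV[OF assms(2) C_k_on_has_derivative[OF Suc.prems(1)] C_k_on_has_derivative[OF Suc.prems(2)]]])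
    show "C_k_on k S (\<lambda>y. pr (f y) (dd g y v) + pr (dd f y v) (g y))" for v
      using Suc C_k_on_SucD[OF Suc.prems(1)] C_k_on_SucD[OF Suc.prems(2)] by (intro C_k_on_add assms(1)) auto
  qed
qed

lemma C_k_on_inverse:
  fixes f :: "'e::real_normed_vector \<Rightarrow> real"
  assumes "open S" "\<And>y. y \<in> S \<Longrightarrow> f y \<noteq> 0" "C_k_on k S f"
  shows "C_k_on k S (\<lambda>y. inverse (f y))"
  using assms(3)
proof (induction k)
  case 0
  then show ?case using assms(2) by (auto intro: continuous_intros)
next
  case (Suc k)
  have c: "C_k_on k S (\<lambda>y. inverse (f y))" using Suc C_k_on_SucD by blast
  show ?case
  proof (rule C_k_on_SucI[OF assms(1)])
    show "((\<lambda>y. inverse (f y)) has_derivative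
       (\<lambda>v. - 1 *\<^sub>R (inverse (f y) * (dd f y v) * inverse (f y)))) (at y)" if "y \<in> S" for y
      using Deriv.has_derivative_inverse[OF assms(2)[OF that] C_k_on_has_derivative[OF Suc.prems that]] by simp
  next
    fix v
    show "C_k_on k S (\<lambda>y. - 1 *\<^sub>R (inverse (f y) * (dd f y v) * inverse (f y)))"
      by (intro C_k_on_compose_linear[OF _ bounded_linear_scaleR_right] C_k_on_bilinear[OF _ bounded_bilinear_mult] c assms(1)) (use Suc in simp)
  qed
qed

text \<open>The derivative of \<open>f (a + L y)\<close> along \<open>v\<close> is a derivative of
  \<open>f\<close> composed with the same affine map, so the induction on \<open>k\<close> closes.
  Its use is to freeze the time variable of a variation.\<close>

lemma C_k_on_affine:
  assumes "open S" "open T" "bounded_linear L" "\<And>y. y \<in> T \<Longrightarrow> a + L y \<in> S" "C_k_on k S f"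
  shows "C_k_on k T (\<lambda>y. f (a + L y))"
  using assms(5)
proof (induction k arbitrary: f)
  case 0
  have "continuous_on T (\<lambda>y. a + L y)"
    by (intro continuous_intros bounded_linear.continuous_on[OF assms(3)])
  with 0 show ?case using assms(4) by (auto intro: continuous_on_compose2)
next
  case (Suc k)
  have L: "((\<lambda>y. a + L y) has_derivative L) (at y)" for y
    using has_derivative_add[OF has_derivative_const[of a] bounded_linear_imp_has_derivative[OF assms(3)]] by simp
  show ?case
  proof (rule C_k_on_SucI[OF assms(2)])
    show "((\<lambda>y. f (a + L y)) has_derivative (\<lambda>v. dd f (a + L y) (L v))) (at y)" if "y \<in> T" for y
      using diff_chain_at[OF L C_k_on_has_derivative[OF Suc.prems assms(4)[OF that]]] by (simp add: o_def)
  next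
    show "C_k_on k T (\<lambda>y. dd f (a + L y) (L v))" for v
      by (rule Suc.IH) (use Suc.prems in simp)
  qed
qed

lemma C_k_on_Union:
  assumes "\<And>i. i \<in> I \<Longrightarrow> open (S i)" "\<And>i. i \<in> I \<Longrightarrow> C_k_on k (S i) f"
  shows "C_k_on k (\<Union>i\<in>I. S i) f"
  using assms(2)
  by (induction k arbitrary: f) (use assms(1) in \<open>auto intro: continuous_on_open_UN\<close>)

lemma has_derivative_compose_real:
  assumes "(f has_derivative f') (at y)" "(\<phi> has_derivative L) (at (f y))"
  shows "((\<lambda>y. \<phi> (f y)) has_derivative (\<lambda>v. L (f' v))) (at y)"
  using diff_chain_at[OF assms] by (simp add: o_def)

subsection \<open>Symmetry of second derivatives\<close>

lemma has_real_derivative_along_line: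
  fixes h :: "'e::real_normed_vector \<Rightarrow> real"
  assumes "(h has_derivative h') (at (a + s *\<^sub>R b))"
  shows "((\<lambda>s. h (a + s *\<^sub>R b)) has_real_derivative h' b) (at s)"
proof -
  have "((\<lambda>s. a + s *\<^sub>R b) has_derivative (\<lambda>s. s *\<^sub>R b)) (at s)"
    by (auto intro!: derivative_eq_intros)
  from has_derivative_compose_real[OF this assms] have
    "((\<lambda>s. h (a + s *\<^sub>R b)) has_derivative (\<lambda>x. h' (x *\<^sub>R b))) (at s)" .
  moreover have "h' (x *\<^sub>R b) = h' b * x" for x
    using assms by (simp add: has_derivative_bounded_linear linear_simps)
  ultimately show ?thesis by (simp add: has_field_derivative_def)
qed

text \<open>Two mean value steps: first along \<open>v\<close>, for the difference of
  \<open>f\<close> across \<open>r *\<^sub>R w\<close>, then along \<open>w\<close>, for the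
  resulting difference of first derivatives. The left-hand side is unchanged when \<open>v\<close>
  and \<open>w\<close> are exchanged.\<close>

lemma second_difference_mean_value:
  fixes f :: "'e::real_normed_vector \<Rightarrow> real"
  assumes "C_k_on 2 S f" "r > 0" "\<And>s t. \<lbrakk>0 \<le> s; s \<le> r; 0 \<le> t; t \<le> r\<rbrakk> \<Longrightarrow> y + s *\<^sub>R v + t *\<^sub>R w \<in> S"
  shows "\<exists>s t. 0 < s \<and> s < r \<and> 0 < t \<and> t < r \<and>
     f (y + r *\<^sub>R v + r *\<^sub>R w) - f (y + r *\<^sub>R v) - f (y + r *\<^sub>R w) + f y =
     r * r * dd (\<lambda>z. dd f z v) (y + s *\<^sub>R v + t *\<^sub>R w) w"
proof -
  let ?Dv = "\<lambda>z. dd f z v"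
  have C: "C_k_on (Suc (Suc 0)) S f" using assms(1) by (simp add: numeral_2_eq_2)
  have D1: "(f has_derivative dd f z) (at z)" if "z \<in> S" for z
    using C_k_on_has_derivative[OF C that] .
  have C1: "C_k_on (Suc 0) S ?Dv" using C by simp
  have D2: "(?Dv has_derivative dd ?Dv z) (at z)" if "z \<in> S" for z
    using C_k_on_has_derivative[OF C1 that] .
  note line = has_real_derivative_along_line
  let ?g = "\<lambda>s. f (y + r *\<^sub>R w + s *\<^sub>R v) - f (y + s *\<^sub>R v)"
  have "\<exists>s>0. s < r \<and> ?g r - ?g 0 = (r - 0) * (?Dv (y + r *\<^sub>R w + s *\<^sub>R v) - ?Dv (y + s *\<^sub>R v))"
  proof (rule MVT2)
    fix s assume s: "0 \<le> s" "s \<le> r"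
    have "y + r *\<^sub>R w + s *\<^sub>R v \<in> S" "y + s *\<^sub>R v \<in> S"
      using assms(3)[of s r] assms(3)[of s 0] s assms(2) by (auto simp: add_ac)
    then show "(?g has_real_derivative ?Dv (y + r *\<^sub>R w + s *\<^sub>R v) - ?Dv (y + s *\<^sub>R v)) (at s)"
      by (intro DERIV_diff line D1)
  qed (use assms in auto)
  then obtain s where s: "0 < s" "s < r"
    and e1: "?g r - ?g 0 = r * (?Dv (y + r *\<^sub>R w + s *\<^sub>R v) - ?Dv (y + s *\<^sub>R v))" by auto
  let ?k = "\<lambda>t. ?Dv (y + s *\<^sub>R v + t *\<^sub>R w)"
  have "\<exists>t>0. t < r \<and> ?k r - ?k 0 = (r - 0) * dd ?Dv (y + s *\<^sub>R v + t *\<^sub>R w) w"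
  proof (rule MVT2)
    fix t assume t: "0 \<le> t" "t \<le> r"
    have "y + s *\<^sub>R v + t *\<^sub>R w \<in> S"
      using assms(3)[of s t] s t by auto
    then show "(?k has_real_derivative dd ?Dv (y + s *\<^sub>R v + t *\<^sub>R w) w) (at t)"
      by (intro line D2)
  qed (use assms in auto)
  then obtain t where t: "0 < t" "t < r"
    and e2: "?k r - ?k 0 = r * dd ?Dv (y + s *\<^sub>R v + t *\<^sub>R w) w" by auto
  show ?thesis
    using s t e1 e2 by (intro exI[of _ s] exI[of _ t]) (simp add: algebra_simps)
qed

text \<open>The second difference is symmetric in \<open>v\<close> and \<open>w\<close>, so the two
  mixed derivatives agree at two intermediate points of a parallelogram; these points approach
  \<open>y\<close> as it shrinks, and both derivatives are continuous there.\<close>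

lemma symmetric_second_derivative_real:
  fixes f :: "'e::real_normed_vector \<Rightarrow> real"
  assumes "open S" "C_k_on 2 S f" "y \<in> S"
  shows "dd (\<lambda>z. dd f z v) y w =
         dd (\<lambda>z. dd f z w) y v"
proof -
  let ?H = "\<lambda>v w z. dd (\<lambda>z. dd f z v) z w"
  have H: "isCont (?H v w) y" for v w
    using assms by (auto simp: numeral_2_eq_2 continuous_on_eq_continuous_at)
  obtain e where e: "e > 0" "ball y e \<subseteq> S" using assms openE by blast
  \<comment> \<open>A parallelogram with corner \<open>y\<close> and edge factors at most
    \<open>r\<close> lies in the ball of radius \<open>r * N\<close>; the summand 1 keeps
    \<open>N\<close> positive when both vectors vanish.\<close>
  define N where "N = norm v + norm w + 1"
  have N: "N > 0" unfolding N_def by (smt (verit) norm_ge_zero)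
  have small: "dist y (y + s *\<^sub>R v + t *\<^sub>R w) < r * N" if "0 \<le> s" "s \<le> r" "0 \<le> t" "t \<le> r" "r > 0" for s t r
  proof -
    have "dist y (y + s *\<^sub>R v + t *\<^sub>R w) \<le> s * norm v + t * norm w"
      using that norm_triangle_ineq[of "s *\<^sub>R v" "t *\<^sub>R w"]
      by (subst dist_commute) (simp add: dist_norm add.assoc)
    also have "\<dots> \<le> r * norm v + r * norm w" using that by (intro add_mono mult_right_mono) auto
    also have "\<dots> < r * N" using that by (simp add: N_def algebra_simps)
    finally show ?thesis .
  qed
  have "\<bar>?H v w y - ?H w v y\<bar> \<le> \<delta>" if \<delta>: "\<delta> > 0" for \<delta>
  proof -
    obtain d1 where d1: "d1 > 0" "\<And>z. dist z y < d1 \<Longrightarrow> dist (?H v w z) (?H v w y) < \<delta>/2"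
      using H[of v w] \<delta> unfolding continuous_at_eps_delta by (metis half_gt_zero dist_commute)
    obtain d2 where d2: "d2 > 0" "\<And>z. dist z y < d2 \<Longrightarrow> dist (?H w v z) (?H w v y) < \<delta>/2"
      using H[of w v] \<delta> unfolding continuous_at_eps_delta by (metis half_gt_zero dist_commute)
    \<comment> \<open>Small enough for the parallelogram to stay inside \<open>S\<close> and inside
      both continuity neighbourhoods.\<close>
    define r where "r = min e (min d1 d2) / N"
    have r: "r > 0" "r * N \<le> e" "r * N \<le> d1" "r * N \<le> d2" using N e d1 d2 by (auto simp: r_def)
    have S1: "y + s *\<^sub>R v + t *\<^sub>R w \<in> S" if "0 \<le> s" "s \<le> r" "0 \<le> t" "t \<le> r" for s t
      using small[of s r t] that r e by (auto simp: subset_eq)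
    have S2: "y + s *\<^sub>R w + t *\<^sub>R v \<in> S" if "0 \<le> s" "s \<le> r" "0 \<le> t" "t \<le> r" for s t
      using S1[OF that(3,4,1,2)] by (simp add: add.assoc add.commute[of "t *\<^sub>R v"])
    obtain s t where st: "0 < s" "s < r" "0 < t" "t < r" and
      E1: "f (y + r *\<^sub>R v + r *\<^sub>R w) - f (y + r *\<^sub>R v) - f (y + r *\<^sub>R w) + f y = r * r * ?H v w (y + s *\<^sub>R v + t *\<^sub>R w)"
      using second_difference_mean_value[OF assms(2) r(1) S1] by blast
    obtain s' t' where st': "0 < s'" "s' < r" "0 < t'" "t' < r" and
      E2: "f (y + r *\<^sub>R w + r *\<^sub>R v) - f (y + r *\<^sub>R w) - f (y + r *\<^sub>R v) + f y = r * r * ?H w v (y + s' *\<^sub>R w + t' *\<^sub>R v)"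
      using second_difference_mean_value[OF assms(2) r(1) S2] by blast
    have "r * r * ?H v w (y + s *\<^sub>R v + t *\<^sub>R w) = r * r * ?H w v (y + s' *\<^sub>R w + t' *\<^sub>R v)"
      using E1[symmetric] E2[symmetric] by (simp add: add.assoc add.commute[of "r *\<^sub>R v"])
    then have eq: "?H v w (y + s *\<^sub>R v + t *\<^sub>R w) = ?H w v (y + t' *\<^sub>R v + s' *\<^sub>R w)" using r by (simp add: add.assoc add.commute[of "t' *\<^sub>R v"])
    have "dist (?H v w (y + s *\<^sub>R v + t *\<^sub>R w)) (?H v w y) < \<delta>/2"
      by (rule d1) (use small[of s r t] st r in \<open>auto simp: dist_commute\<close>)
    moreover have "dist (?H w v (y + t' *\<^sub>R v + s' *\<^sub>R w)) (?H w v y) < \<delta>/2"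
      by (rule d2) (use small[of t' r s'] st' r in \<open>auto simp: dist_commute\<close>)
    ultimately show ?thesis using eq unfolding dist_real_def by linarith
  qed
  then show ?thesis by (metis abs_le_zero_iff dense_ge eq_iff_diff_eq_0)
qed

text \<open>Reduces to real functions: a vector is determined by its inner products, and taking the
  inner product with \<open>b\<close> commutes with both derivatives.\<close>

lemma symmetric_second_derivative:
  fixes f :: "'e::real_normed_vector \<Rightarrow> 'f::real_inner"
  assumes "open S" "C_k_on 2 S f" "y \<in> S"
  shows "dd (\<lambda>z. dd f z v) y w =
         dd (\<lambda>z. dd f z w) y v"
proof -
  have D1: "f differentiable (at z)" if "z \<in> S" for z
    using assms(2) that by (auto simp: numeral_2_eq_2)
  have D2: "(\<lambda>z. dd f z v) differentiable (at z)" if "z \<in> S" for z v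
    using assms(2) that by (auto simp: numeral_2_eq_2)
  have "dd (\<lambda>z. dd (\<lambda>z. f z \<bullet> b) z v) y w =
     dd (\<lambda>z. dd f z v) y w \<bullet> b" for v w b
  proof -
    have 1: "dd (\<lambda>z. f z \<bullet> b) z v = dd f z v \<bullet> b" if "z \<in> S" for z
      using has_derivative_inner_left[OF differentiable_has_derivative[OF D1[OF that]], of b] frechet_derivative_at by metis
    have 2: "((\<lambda>z. dd f z v \<bullet> b) has_derivative
       (\<lambda>w. dd (\<lambda>z. dd f z v) y w \<bullet> b)) (at y)"
      by (rule has_derivative_inner_left[OF differentiable_has_derivative[OF D2[OF assms(3)]]])
    have "((\<lambda>z. dd (\<lambda>z. f z \<bullet> b) z v) has_derivative
       (\<lambda>w. dd (\<lambda>z. dd f z v) y w \<bullet> b)) (at y)"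
      by (rule has_derivative_transform_within_open[OF 2 assms(1,3)]) (simp add: 1)
    then show ?thesis using frechet_derivative_at by metis
  qed
  moreover have "C_k_on 2 S (\<lambda>z. f z \<bullet> b)" for b
    by (rule C_k_on_compose_linear[OF assms(1) bounded_linear_inner_left assms(2)])
  ultimately have "dd (\<lambda>z. dd f z v) y w \<bullet> b =
         dd (\<lambda>z. dd f z w) y v \<bullet> b" for b
    using symmetric_second_derivative_real[OF assms(1) _ assms(3)] by metis
  then show ?thesis by (metis vector_eq_rdot)
qed

subsection \<open>Smooth functions\<close>

lemma smooth_on_imp_C_k: "smooth_on S f \<Longrightarrow> C_k_on k S f" by (simp add: smooth_on_def)

lemma smooth_on_has_derivative:
  "smooth_on S f \<Longrightarrow> y \<in> S \<Longrightarrow> (f has_derivative dd f y) (at y)"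
  using C_k_on_has_derivative[of 0] smooth_on_imp_C_k by blast

lemma smooth_on_continuous_on: "smooth_on S f \<Longrightarrow> continuous_on S f"
  using C_k_on_imp_continuous_on smooth_on_imp_C_k by blast

lemma smooth_on_derivative: "smooth_on S f \<Longrightarrow> smooth_on S (\<lambda>y. dd f y v)"
  unfolding smooth_on_def using C_k_on.simps(2) by blast

lemma smooth_on_cong: "open S \<Longrightarrow> (\<And>y. y \<in> S \<Longrightarrow> f y = g y) \<Longrightarrow> smooth_on S f \<Longrightarrow> smooth_on S g"
  unfolding smooth_on_def using C_k_on_cong by blast

lemma smooth_on_const: "smooth_on S (\<lambda>y. c)" by (simp add: smooth_on_def)

lemma smooth_on_compose_linear:
  "open S \<Longrightarrow> bounded_linear L \<Longrightarrow> smooth_on S f \<Longrightarrow> smooth_on S (\<lambda>y. L (f y))"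
  unfolding smooth_on_def using C_k_on_compose_linear by blast

lemma smooth_on_add:
  "open S \<Longrightarrow> smooth_on S f \<Longrightarrow> smooth_on S g \<Longrightarrow> smooth_on S (\<lambda>y. f y + g y)"
  unfolding smooth_on_def using C_k_on_add by blast

lemma smooth_on_minus: "open S \<Longrightarrow> smooth_on S f \<Longrightarrow> smooth_on S (\<lambda>y. - f y)"
  by (rule smooth_on_compose_linear[OF _ bounded_linear_minus[OF bounded_linear_ident]])

lemma smooth_on_diff:
  "open S \<Longrightarrow> smooth_on S f \<Longrightarrow> smooth_on S g \<Longrightarrow> smooth_on S (\<lambda>y. f y - g y)"
  using smooth_on_add[of S f "\<lambda>y. - g y"] smooth_on_minus by auto

lemma smooth_on_bilinear:
  "open S \<Longrightarrow> bounded_bilinear pr \<Longrightarrow> smooth_on S f \<Longrightarrow> smooth_on S g \<Longrightarrow> smooth_on S (\<lambda>y. pr (f y) (g y))"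
  unfolding smooth_on_def using C_k_on_bilinear by blast

lemmas smooth_on_mult = smooth_on_bilinear[OF _ bounded_bilinear_mult]
lemmas smooth_on_scaleR = smooth_on_bilinear[OF _ bounded_bilinear_scaleR]
lemmas smooth_on_inner = smooth_on_bilinear[OF _ bounded_bilinear_inner]

lemma smooth_on_divide:
  fixes f g :: "'e::real_normed_vector \<Rightarrow> real"
  shows "open S \<Longrightarrow> (\<And>y. y \<in> S \<Longrightarrow> g y \<noteq> 0) \<Longrightarrow> smooth_on S f \<Longrightarrow> smooth_on S g \<Longrightarrow>
     smooth_on S (\<lambda>y. f y / g y)"
  unfolding divide_inverse
  by (rule smooth_on_mult) (auto simp: smooth_on_def intro: C_k_on_inverse)

lemma smooth_on_vec_nth: "open S \<Longrightarrow> smooth_on S f \<Longrightarrow> smooth_on S (\<lambda>y. f y$i)"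
  by (rule smooth_on_compose_linear[OF _ bounded_linear_vec_nth])

lemma vector_3_eq: "(vector [a, b, c] :: real^3) = a *\<^sub>R axis 1 1 + b *\<^sub>R axis 2 1 + c *\<^sub>R axis 3 1"
  by (simp add: vec_eq_iff forall_3 axis_def vector_3)

lemma smooth_on_vector_3:
  "open S \<Longrightarrow> smooth_on S a \<Longrightarrow> smooth_on S b \<Longrightarrow> smooth_on S c \<Longrightarrow>
   smooth_on S (\<lambda>y. vector [a y, b y, c y] :: real^3)"
  unfolding vector_3_eq by (intro smooth_on_add smooth_on_scaleR smooth_on_const)

lemma smooth_on_affine:
  "open S \<Longrightarrow> open T \<Longrightarrow> bounded_linear L \<Longrightarrow> (\<And>y. y \<in> T \<Longrightarrow> a + L y \<in> S) \<Longrightarrow> smooth_on S f \<Longrightarrow>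
   smooth_on T (\<lambda>y. f (a + L y))"
  unfolding smooth_on_def using C_k_on_affine by blast

lemmas smooth_intros = smooth_on_add smooth_on_minus smooth_on_diff smooth_on_mult smooth_on_scaleR
  smooth_on_inner smooth_on_divide smooth_on_const smooth_on_vec_nth smooth_on_vector_3 smooth_on_derivative

lemma smooth_on_symmetric_derivative:
  fixes f :: "'e::real_normed_vector \<Rightarrow> 'f::real_inner"
  assumes "open S" "smooth_on S f" "y \<in> S"
  shows "dd (\<lambda>z. dd f z v) y w =
         dd (\<lambda>z. dd f z w) y v"
  using symmetric_second_derivative[OF assms(1) _ assms(3)] assms(2) smooth_on_imp_C_k by blast

subsection \<open>Linear maps of the plane\<close>

abbreviation ex1 :: "real^2" where "ex1 \<equiv> axis 1 1"
abbreviation ex2 :: "real^2" where "ex2 \<equiv> axis 2 1"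

definition tr2 :: "(real^2 \<Rightarrow> real^2) \<Rightarrow> real" where
  "tr2 T = T ex1$1 + T ex2$2"

definition det2 :: "(real^2 \<Rightarrow> real^2) \<Rightarrow> real" where
  "det2 T = T ex1$1 * T ex2$2 - T ex1$2 * T ex2$1"

lemma real2_decomp: "(v::real^2) = v$1 *\<^sub>R ex1 + v$2 *\<^sub>R ex2"
  by (simp add: vec_eq_iff forall_2 axis_def)

lemma linear_real2: "linear L \<Longrightarrow> L v = v$1 *\<^sub>R L ex1 + v$2 *\<^sub>R L ex2"
  by (subst real2_decomp) (simp add: linear_add linear_scale)

lemma linear_real2_nth:
  fixes T :: "real^2 \<Rightarrow> real^2"
  shows "linear T \<Longrightarrow> T v$i = v$1 * T ex1$i + v$2 * T ex2$i"
  using arg_cong[OF linear_real2[of T v], of "\<lambda>u. u$i"] by simp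

lemma independent_real2_iff:
  fixes v w :: "real^2"
  shows "v \<noteq> w \<and> independent {v, w} \<longleftrightarrow> v$1 * w$2 - v$2 * w$1 \<noteq> 0"
proof
  assume l: "v \<noteq> w \<and> independent {v, w}"
  then have w: "w \<noteq> 0" and v: "v \<notin> span {w}"
    by (auto simp: independent_insert)
  show "v$1 * w$2 - v$2 * w$1 \<noteq> 0"
  proof
    assume d: "v$1 * w$2 - v$2 * w$1 = 0"
    consider "w$1 \<noteq> 0" | "w$2 \<noteq> 0" using w by (auto simp: vec_eq_iff forall_2)
    then have "\<exists>k. v = k *\<^sub>R w"
    proof cases
      case 1
      then show ?thesis using d
        by (intro exI[of _ "v$1 / w$1"]) (simp add: vec_eq_iff forall_2 field_simps)
    next
      case 2
      then show ?thesis using d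
        by (intro exI[of _ "v$2 / w$2"]) (simp add: vec_eq_iff forall_2 field_simps)
    qed
    with v show False by (auto simp: span_singleton)
  qed
next
  assume d: "v$1 * w$2 - v$2 * w$1 \<noteq> 0"
  then have "v \<noteq> w" "w \<noteq> 0" by (auto simp: algebra_simps)
  moreover have "v \<notin> span {w}" using d by (auto simp: span_singleton algebra_simps)
  ultimately show "v \<noteq> w \<and> independent {v, w}" by (simp add: independent_insert)
qed

text \<open>Multiplied by the determinant of the eigenbasis, both identities are expansions in which
  \<open>a * v$i\<close> and \<open>b * w$i\<close> are replaced by the components of
  \<open>T v\<close> and \<open>T w\<close>. This ties the eigenvalues to \<open>T\<close> whichever
  eigenbasis is taken.\<close>

lemma eigenbasis_trace_det:
  fixes T :: "real^2 \<Rightarrow> real^2"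
  assumes "linear T" "T v = a *\<^sub>R v" "T w = b *\<^sub>R w" "v$1 * w$2 - v$2 * w$1 \<noteq> 0"
  shows "a + b = tr2 T" "a * b = det2 T"
proof -
  have e: "a * v$i = v$1 * T ex1$i + v$2 * T ex2$i" "b * w$i = w$1 * T ex1$i + w$2 * T ex2$i" for i
    using linear_real2_nth[OF assms(1), of v i] linear_real2_nth[OF assms(1), of w i] assms(2,3) by auto
  have "(a + b) * (v$1 * w$2 - v$2 * w$1) = (a * v$1) * w$2 - (a * v$2) * w$1 + v$1 * (b * w$2) - v$2 * (b * w$1)"
    by (simp add: algebra_simps)
  also have "\<dots> = tr2 T * (v$1 * w$2 - v$2 * w$1)"
    unfolding e tr2_def by (simp add: algebra_simps)
  finally show "a + b = tr2 T" using assms(4) by simp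
  have "(a * b) * (v$1 * w$2 - v$2 * w$1) = (a * v$1) * (b * w$2) - (a * v$2) * (b * w$1)"
    by (simp add: algebra_simps)
  also have "\<dots> = det2 T * (v$1 * w$2 - v$2 * w$1)"
    unfolding e det2_def by (simp add: algebra_simps)
  finally show "a * b = det2 T" using assms(4) by simp
qed

text \<open>\<open>E\<close>, \<open>F\<close>, \<open>G\<close> form a Gram matrix, and the
  equation is self-adjointness of the matrix with columns (\<alpha>, \<gamma>) and (\<beta>,
  \<delta>). The discriminant is at risk only if \<open>\<beta> * \<gamma> < 0\<close>; then the
  square of \<open>\<beta> * E + \<gamma> * G\<close>, together with F^2 < E G, bounds it from
  below.\<close>

lemma symmetric_discriminant:
  fixes E F G \<alpha> \<beta> \<gamma> \<delta> :: real
  assumes "E > 0" "E * G - F\<^sup>2 > 0" "\<alpha> * F + \<gamma> * G = \<beta> * E + \<delta> * F"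
  shows "(\<alpha> - \<delta>)\<^sup>2 + 4 * \<beta> * \<gamma> \<ge> 0" "(\<alpha> - \<delta>)\<^sup>2 + 4 * \<beta> * \<gamma> = 0 \<Longrightarrow> \<beta> = 0 \<and> \<gamma> = 0 \<and> \<alpha> = \<delta>"
proof -
  let ?d = "\<alpha> - \<delta>"
  have EG: "E * G > F\<^sup>2" using assms by simp
  then have G: "G > 0" using assms(1) by (metis le_less_trans zero_le_power2 zero_less_mult_pos)
  have dF: "?d * F = \<beta> * E - \<gamma> * G" using assms(3) by (simp add: algebra_simps)
  have pos: "?d\<^sup>2 + 4 * \<beta> * \<gamma> > 0" if n: "\<beta> * \<gamma> < 0"
  proof -
    have "(\<beta> * E + \<gamma> * G)\<^sup>2 = (?d * F)\<^sup>2 + 4 * (\<beta> * \<gamma>) * (E * G)"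
      unfolding dF by (simp add: power2_eq_square algebra_simps)
    then have 1: "?d\<^sup>2 * F\<^sup>2 + 4 * (\<beta> * \<gamma>) * (E * G) \<ge> 0"
      by (metis power_mult_distrib zero_le_power2)
    have "4 * (\<beta> * \<gamma>) * (E * G) < 4 * (\<beta> * \<gamma>) * F\<^sup>2" using n EG by (intro mult_strict_left_mono_neg) auto
    then have "0 < (?d\<^sup>2 + 4 * (\<beta> * \<gamma>)) * F\<^sup>2" using 1 by (simp add: algebra_simps)
    then show ?thesis by (metis mult.assoc zero_le_power2 zero_less_mult_pos2 less_eq_real_def mult_zero_right)
  qed
  show "?d\<^sup>2 + 4 * \<beta> * \<gamma> \<ge> 0"
  proof (cases "\<beta> * \<gamma> < 0")
    case False
    then have "4 * (\<beta> * \<gamma>) \<ge> 0" by simp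
    then show ?thesis by (simp add: mult.assoc)
  qed (use pos in simp)
  assume z: "?d\<^sup>2 + 4 * \<beta> * \<gamma> = 0"
  then have nn: "\<beta> * \<gamma> \<ge> 0" using pos by force
  moreover have z': "?d\<^sup>2 + 4 * (\<beta> * \<gamma>) = 0" using z by (simp add: mult.assoc)
  ultimately have "?d\<^sup>2 = 0" using zero_le_power2[of ?d] by linarith
  then have d: "?d = 0" "\<beta> * \<gamma> = 0" using z' by auto
  then have "\<beta> * E = \<gamma> * G" using dF by simp
  then show "\<beta> = 0 \<and> \<gamma> = 0 \<and> \<alpha> = \<delta>" using d G assms(1) by auto
qed

text \<open>Supplies what the definite description in \<open>eigenvalues\<close> asks for: the
  quadratic formula gives roots \<open>a \<le> b\<close>, \<open>symmetric_discriminant\<close>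
  makes them real with an eigenbasis, and an ordered pair is determined by its sum and
  product.\<close>

lemma eigenvalues_self_adjoint:
  fixes T :: "real^2 \<Rightarrow> real^2"
  assumes lin: "linear T" and pos: "E > 0" "E * G - F\<^sup>2 > 0"
    and sym: "T ex1$1 * F + T ex1$2 * G = T ex2$1 * E + T ex2$2 * F"
  shows "fst (eigenvalues T) \<le> snd (eigenvalues T)"
    "fst (eigenvalues T) + snd (eigenvalues T) = tr2 T"
    "fst (eigenvalues T) * snd (eigenvalues T) = det2 T"
proof -
  define \<alpha> \<gamma> \<beta> \<delta> where "\<alpha> = T ex1$1" and "\<gamma> = T ex1$2" and "\<beta> = T ex2$1" and "\<delta> = T ex2$2"
  note defs = \<alpha>_def \<beta>_def \<gamma>_def \<delta>_def
  define disc where "disc = (\<alpha> - \<delta>)\<^sup>2 + 4 * \<beta> * \<gamma>"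
  have disc: "disc \<ge> 0" "disc = 0 \<Longrightarrow> \<beta> = 0 \<and> \<gamma> = 0 \<and> \<alpha> = \<delta>"
    using symmetric_discriminant[OF pos, of \<alpha> \<gamma> \<beta> \<delta>] sym by (simp_all add: disc_def defs)
  define s where "s = sqrt disc"
  have s: "s \<ge> 0" "s * s = disc" using disc by (auto simp: s_def)
  define a b where "a = (\<alpha> + \<delta> - s) / 2" and "b = (\<alpha> + \<delta> + s) / 2"
  have ab: "a \<le> b" using s by (simp add: a_def b_def)
  have char: "a + b = \<alpha> + \<delta>" "a * b = \<alpha> * \<delta> - \<beta> * \<gamma>"
    using s(2) by (simp_all add: a_def b_def disc_def field_simps power2_eq_square)
  have T1: "T v$1 = v$1 * \<alpha> + v$2 * \<beta>" "T v$2 = v$1 * \<gamma> + v$2 * \<delta>" for v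
    unfolding defs by (rule linear_real2_nth[OF lin])+
  have root: "a * a - (\<alpha> + \<delta>) * a + (\<alpha> * \<delta> - \<beta> * \<gamma>) = 0" "b * b - (\<alpha> + \<delta>) * b + (\<alpha> * \<delta> - \<beta> * \<gamma>) = 0"
    unfolding char[symmetric] by (simp_all add: algebra_simps)
  have "\<exists>v w. v$1 * w$2 - v$2 * w$1 \<noteq> 0 \<and> T v = a *\<^sub>R v \<and> T w = b *\<^sub>R w"
  proof (cases "\<beta> \<noteq> 0 \<or> \<gamma> \<noteq> 0")
    case True
    then have "disc > 0" using disc by fastforce
    then have "s > 0" by (simp add: s_def)
    then have ne: "a \<noteq> b" by (simp add: a_def b_def)
    show ?thesis
    proof (cases "\<beta> \<noteq> 0")
      case True
      \<comment> \<open>The eigenvectors solve the first row of (T - a) v = 0, namely (\<alpha> - a)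
        v_1 + \<beta> v_2 = 0; the second row is then the characteristic equation.\<close>
      show ?thesis
        by (intro exI[of _ "vector [\<beta>, a - \<alpha>]"] exI[of _ "vector [\<beta>, b - \<alpha>]"])
          (use True ne root in \<open>simp add: vec_eq_iff forall_2 T1 algebra_simps\<close>)
    next
      case False
      then have "\<gamma> \<noteq> 0" using True by simp
      \<comment> \<open>Here the second row is solved instead.\<close>
      then show ?thesis
        by (intro exI[of _ "vector [a - \<delta>, \<gamma>]"] exI[of _ "vector [b - \<delta>, \<gamma>]"])
          (use ne root in \<open>simp add: vec_eq_iff forall_2 T1 algebra_simps\<close>)
    qed
  next
    case False
    then have z: "\<beta> = 0" "\<gamma> = 0" by auto
    then have "(a = \<alpha> \<and> b = \<delta>) \<or> (a = \<delta> \<and> b = \<alpha>)"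
    proof -
      have "s = \<bar>\<alpha> - \<delta>\<bar>" using z by (simp add: s_def disc_def)
      then show ?thesis by (auto simp: a_def b_def abs_if field_simps)
    qed
    then show ?thesis
    proof
      assume "a = \<alpha> \<and> b = \<delta>"
      then show ?thesis
        by (intro exI[of _ "vector [1, 0]"] exI[of _ "vector [0, 1]"]) (simp add: vec_eq_iff forall_2 T1 z)
    next
      assume "a = \<delta> \<and> b = \<alpha>"
      then show ?thesis
        by (intro exI[of _ "vector [0, 1]"] exI[of _ "vector [1, 0]"]) (simp add: vec_eq_iff forall_2 T1 z)
    qed
  qed
  then obtain v w where vw: "v$1 * w$2 - v$2 * w$1 \<noteq> 0" "T v = a *\<^sub>R v" "T w = b *\<^sub>R w" by blast
  have "eigenvalues T = (a, b)"
    unfolding eigenvalues_def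
  proof (rule the_equality)
    show "case (a, b) of (a, b) \<Rightarrow> a \<le> b \<and> (\<exists>v w. v \<noteq> w \<and> independent {v, w} \<and> T v = a *\<^sub>R v \<and> T w = b *\<^sub>R w)"
      using vw ab independent_real2_iff by blast
  next
    fix q assume q: "case q of (a, b) \<Rightarrow> a \<le> b \<and> (\<exists>v w. v \<noteq> w \<and> independent {v, w} \<and> T v = a *\<^sub>R v \<and> T w = b *\<^sub>R w)"
    obtain a' b' where q': "q = (a', b')" by (cases q)
    with q obtain v w where le: "a' \<le> b'" and i: "v \<noteq> w \<and> independent {v, w}" "T v = a' *\<^sub>R v" "T w = b' *\<^sub>R w" by auto
    have "a' + b' = tr2 T" "a' * b' = det2 T"
      using eigenbasis_trace_det[OF lin i(2,3)] i(1) independent_real2_iff by blast+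
    then have e: "a' + b' = a + b" "a' * b' = a * b" using eigenbasis_trace_det[OF lin vw(2,3,1)] by auto
    have sq: "(y - x)\<^sup>2 = (x + y)\<^sup>2 - 4 * (x * y)" for x y :: real
      by (simp add: power2_eq_square algebra_simps)
    have "(b' - a')\<^sup>2 = (b - a)\<^sup>2" unfolding sq e ..
    then have "b' - a' = b - a" using le ab by (simp add: power2_eq_iff_nonneg)
    then show "q = (a, b)" using e q' by auto
  qed
  then show "fst (eigenvalues T) \<le> snd (eigenvalues T)"
    "fst (eigenvalues T) + snd (eigenvalues T) = tr2 T"
    "fst (eigenvalues T) * snd (eigenvalues T) = det2 T"
    using ab eigenbasis_trace_det[OF lin vw(2,3,1)] by auto
qed

text \<open>By dimension the range of \<open>L\<close> is the whole plane orthogonal to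
  \<open>n\<close>, so it contains every \<open>K v\<close>. This yields the radius endomorphism
  and, later, the shape operator.\<close>

lemma linear_factor_through_plane:
  fixes L K :: "real^2 \<Rightarrow> real^3"
  assumes "linear L" "linear K" "inj L" "n \<noteq> 0" "\<And>v. n \<bullet> L v = 0" "\<And>v. n \<bullet> K v = 0"
  shows "\<exists>T. linear T \<and> (\<forall>v. K v = - L (T v))"
proof -
  have "subspace (range L)" by (simp add: assms(1) linear_subspace_image subspace_UNIV)
  moreover have "subspace {x. n \<bullet> x = 0}" by (rule subspace_hyperplane)
  moreover have "range L \<subseteq> {x. n \<bullet> x = 0}" using assms(5) by auto
  moreover have "dim (range L) = 2"
    using dim_image_eq[OF assms(1), of UNIV] assms(3) by simp
  moreover have "dim {x. n \<bullet> x = 0} = 2" using dim_hyperplane[OF assms(4)] by simp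
  ultimately have R: "range L = {x. n \<bullet> x = 0}" by (metis subspace_dim_equal order_refl)
  obtain g where g: "linear g" "g \<circ> L = id"
    using linear_injective_left_inverse[OF assms(1,3)] by blast
  have "K v = - L (- g (K v))" for v
  proof -
    have "K v \<in> range L" using R assms(6) by auto
    then obtain u where "K v = L u" by blast
    then show ?thesis using g assms(1) by (metis comp_apply id_apply linear_neg minus_minus)
  qed
  moreover have "linear (\<lambda>v. - g (K v))"
    using linear_compose[OF assms(2) g(1)] linear_compose_neg by (auto simp: o_def)
  ultimately show ?thesis by blast
qed

lemma neg_quotient_unique:
  assumes "linear T" "\<And>v. dmap c \<eta> p v = - dmap c \<zeta> p (T v)" "inj (dmap c \<zeta> p)"
  shows "neg_quotient c \<eta> \<zeta> p = T"
  unfolding neg_quotient_def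
proof (rule the_equality)
  fix T' assume "linear T' \<and> (\<forall>v. dmap c \<eta> p v = - dmap c \<zeta> p (T' v))"
  then have "dmap c \<zeta> p (T' v) = dmap c \<zeta> p (T v)" for v using assms(2) by (metis neg_equal_iff_equal)
  then show "T' = T" using assms(3) by (auto simp: inj_def)
qed (use assms in auto)

subsection \<open>The triple product\<close>

definition tp :: "real^3 \<Rightarrow> real^3 \<Rightarrow> real^3 \<Rightarrow> real" where
  "tp a b c = a$1 * (b$2 * c$3 - b$3 * c$2) + a$2 * (b$3 * c$1 - b$1 * c$3) + a$3 * (b$1 * c$2 - b$2 * c$1)"

lemma inner_3: "(a::real^3) \<bullet> b = a$1 * b$1 + a$2 * b$2 + a$3 * b$3"
  by (simp add: inner_vec_def sum_3)

lemma tp_linear [simp]: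
  "tp (a + b) c d = tp a c d + tp b c d" "tp c (a + b) d = tp c a d + tp c b d" "tp c d (a + b) = tp c d a + tp c d b"
  "tp (- a) c d = - tp a c d" "tp c (- a) d = - tp c a d" "tp c d (- a) = - tp c d a"
  "tp (k *\<^sub>R a) c d = k * tp a c d" "tp c (k *\<^sub>R a) d = k * tp c a d" "tp c d (k *\<^sub>R a) = k * tp c d a"
  "tp (a - b) c d = tp a c d - tp b c d" "tp c (a - b) d = tp c a d - tp c b d" "tp c d (a - b) = tp c d a - tp c d b"
  "tp a a b = 0" "tp a b a = 0" "tp b a a = 0"
  by (simp_all add: tp_def algebra_simps)

lemma tp_conv_cross3: "tp a b c = a \<bullet> cross3 b c"
  by (simp add: cross3_simps tp_def)

text \<open>The expansion of the double cross product shows that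
  \<open>cross3 n (cross3 c d)\<close> vanishes, so \<open>cross3 c d\<close> is parallel to the
  unit vector \<open>n\<close>.\<close>

lemma cross3_tangential:
  assumes "n \<bullet> n = 1" "n \<bullet> c = 0" "n \<bullet> d = 0"
  shows "cross3 c d = tp n c d *\<^sub>R n"
proof -
  have "cross3 n (cross3 c d) = 0"
    using assms by (simp add: Lagrange)
  then have "(n \<bullet> cross3 c d) *\<^sub>R n - (n \<bullet> n) *\<^sub>R cross3 c d = 0"
    by (metis Lagrange cross_zero_right)
  then show ?thesis using assms by (simp add: tp_conv_cross3)
qed

text \<open>The Binet-Cauchy identity, as \<open>cross3 c d\<close> is a multiple of
  \<open>n\<close>. Only the second pair has to be tangential; hence multiplying by one nonzero
  \<open>tp n n1 n2\<close> turns every triple product with \<open>n\<close> into inner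
  products.\<close>

lemma tp_gram:
  assumes "n \<bullet> n = 1" "n \<bullet> c = 0" "n \<bullet> d = 0"
  shows "tp n a b * tp n c d = (a \<bullet> c) * (b \<bullet> d) - (a \<bullet> d) * (b \<bullet> c)"
proof -
  have "tp n a b * tp n c d = cross3 c d \<bullet> cross3 a b"
    by (simp add: cross3_tangential[OF assms] tp_conv_cross3[of n a b])
  also have "\<dots> = (a \<bullet> c) * (b \<bullet> d) - (a \<bullet> d) * (b \<bullet> c)"
    by (simp add: cross3_simps)
  finally show ?thesis .
qed

lemma tp_tangential:
  assumes "n \<bullet> n = 1" "n \<bullet> a = 0" "n \<bullet> b = 0" "n \<bullet> c = 0"
  shows "tp a b c = 0"
  unfolding tp_conv_cross3[of a] cross3_tangential[OF assms(1,3,4)] using assms(2) by (simp add: inner_commute)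

lemma gram_pos:
  fixes L :: "real^2 \<Rightarrow> 'f::real_inner"
  assumes "linear L" "inj L"
  shows "L ex1 \<bullet> L ex1 > 0" "(L ex1 \<bullet> L ex1) * (L ex2 \<bullet> L ex2) - (L ex1 \<bullet> L ex2)\<^sup>2 > 0"
proof -
  have z: "L v = 0 \<Longrightarrow> v = 0" for v using assms by (simp add: linear_injective_0)
  show E: "L ex1 \<bullet> L ex1 > 0" using z[of ex1] by (metis axis_eq_0_iff inner_gt_zero_iff one_neq_zero)
  let ?E = "L ex1 \<bullet> L ex1" and ?F = "L ex1 \<bullet> L ex2" and ?G = "L ex2 \<bullet> L ex2"
  \<comment> \<open>Orthogonal to \<open>ex1\<close> in the pulled back metric: - E times the
    Gram-Schmidt component of \<open>ex2\<close>.\<close>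
  let ?v = "?F *\<^sub>R ex1 - ?E *\<^sub>R ex2"
  have "?v$2 \<noteq> 0" using E by (simp add: axis_def)
  then have "L ?v \<noteq> 0" using z[of ?v] by (metis zero_index)
  then have "L ?v \<bullet> L ?v > 0" by simp
  also have "L ?v \<bullet> L ?v = ?E * (?E * ?G - ?F\<^sup>2)"
    using assms(1) by (simp add: linear_diff linear_scale inner_diff_left inner_diff_right inner_commute power2_eq_square algebra_simps)
  finally show "?E * ?G - ?F\<^sup>2 > 0" using E by (simp add: zero_less_mult_iff)
qed

subsection \<open>Charts\<close>

locale atlas_surface =
  fixes A :: "'a::{t2_space,second_countable_topology} chart set"
  assumes atlas: "smooth_2_atlas A"
begin

abbreviation "cdom c \<equiv> fst (c :: 'a chart)"
abbreviation "cimg c \<equiv> snd (c :: 'a chart) ` fst c"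

lemma open_dom: "c \<in> A \<Longrightarrow> open (cdom c)" and open_img: "c \<in> A \<Longrightarrow> open (cimg c)"
  and homeo: "c \<in> A \<Longrightarrow> homeomorphism (cdom c) (cimg c) (snd c) (chart_inv c)"
  using atlas by (auto simp: smooth_2_atlas_def)

lemma dom_cover: "\<exists>c\<in>A. p \<in> cdom c"
  using atlas by (fastforce simp: smooth_2_atlas_def)

lemma chart_inv_chart [simp]: "c \<in> A \<Longrightarrow> p \<in> cdom c \<Longrightarrow> chart_inv c (snd c p) = p"
  using homeo by (auto simp: homeomorphism_def)

lemma chart_chart_inv [simp]: "c \<in> A \<Longrightarrow> y \<in> cimg c \<Longrightarrow> snd c (chart_inv c y) = y"
  using homeo by (auto simp: homeomorphism_def)

lemma chart_inv_in_dom [simp]: "c \<in> A \<Longrightarrow> y \<in> cimg c \<Longrightarrow> chart_inv c y \<in> cdom c"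
  using homeo by (auto simp: homeomorphism_def)

lemma continuous_chart_inv: "c \<in> A \<Longrightarrow> continuous_on (cimg c) (chart_inv c)"
  and continuous_chart: "c \<in> A \<Longrightarrow> continuous_on (cdom c) (snd c)"
  using homeo by (auto simp: homeomorphism_def)

lemma open_chart_image: "c \<in> A \<Longrightarrow> open U \<Longrightarrow> U \<subseteq> cdom c \<Longrightarrow> open (snd c ` U)"
  using homeomorphism_imp_open_map[OF homeo] open_img open_dom
  by (metis (no_types, lifting) openin_open_eq openin_open_trans)

lemma open_chart_preimage:
  assumes "c \<in> A" "open W"
  shows "open {p \<in> cdom c. snd c p \<in> W}"
  using continuous_open_preimage[OF continuous_chart open_dom, OF assms(1,1,2)]
  by (simp add: vimage_def Int_def)

lemma open_chart_inv_preimage: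
  assumes "c \<in> A" "open U"
  shows "open {y \<in> cimg c. chart_inv c y \<in> U}"
  using continuous_open_preimage[OF continuous_chart_inv open_img, OF assms(1,1,2)]
  by (simp add: vimage_def Int_def)

lemma overlap_image: "c \<in> A \<Longrightarrow> snd c ` (cdom c \<inter> cdom d) = {y \<in> cimg c. chart_inv c y \<in> cdom d}"
  by force

lemma open_overlap: "c \<in> A \<Longrightarrow> d \<in> A \<Longrightarrow> open (snd c ` (cdom c \<inter> cdom d))"
  by (simp add: open_chart_image open_dom open_Int)

lemma smooth_transition: "c \<in> A \<Longrightarrow> d \<in> A \<Longrightarrow> smooth_on (snd c ` (cdom c \<inter> cdom d)) (snd d \<circ> chart_inv c)"
  using atlas by (auto simp: smooth_2_atlas_def)

lemma transition_has_derivative: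
  assumes "c \<in> A" "d \<in> A" "p \<in> cdom c" "p \<in> cdom d"
  shows "(snd d \<circ> chart_inv c has_derivative dmap c (snd d) p) (at (snd c p))"
  unfolding dmap_def
  by (rule smooth_on_has_derivative[OF smooth_transition[OF assms(1,2)]]) (use assms in auto)

lemma dmap_change_chart:
  assumes "c \<in> A" "d \<in> A" "p \<in> cdom c" "p \<in> cdom d" "(f \<circ> chart_inv d) differentiable (at (snd d p))"
  shows "dmap c f p = dmap d f p \<circ> dmap c (snd d) p" "(f \<circ> chart_inv c) differentiable (at (snd c p))"
proof -
  have 1: "(f \<circ> chart_inv d has_derivative dmap d f p) (at ((snd d \<circ> chart_inv c) (snd c p)))"
    unfolding dmap_def using differentiable_has_derivative[OF assms(5)] assms by simp
  have 2: "((f \<circ> chart_inv d) \<circ> (snd d \<circ> chart_inv c) has_derivative dmap d f p \<circ> dmap c (snd d) p) (at (snd c p))"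
    by (rule diff_chain_at[OF transition_has_derivative[OF assms(1-4)] 1])
  have "(f \<circ> chart_inv c has_derivative dmap d f p \<circ> dmap c (snd d) p) (at (snd c p))"
    by (rule has_derivative_transform_within_open[OF 2 open_overlap[OF assms(1,2)]]) (use assms in auto)
  then show "dmap c f p = dmap d f p \<circ> dmap c (snd d) p" "(f \<circ> chart_inv c) differentiable (at (snd c p))"
    unfolding dmap_def by (auto simp: differentiable_def frechet_derivative_at[symmetric])
qed

lemma smooth_map_smooth_on: "smooth_map A f \<Longrightarrow> c \<in> A \<Longrightarrow> smooth_on (cimg c) (f \<circ> chart_inv c)"
  by (simp add: smooth_map_def)

lemma smooth_map_differentiable:
  "smooth_map A f \<Longrightarrow> c \<in> A \<Longrightarrow> p \<in> cdom c \<Longrightarrow> (f \<circ> chart_inv c) differentiable (at (snd c p))"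
  using smooth_on_has_derivative[OF smooth_map_smooth_on, of f c "snd c p"] unfolding differentiable_def by blast

lemma smooth_map_has_derivative:
  assumes "smooth_map A f" "c \<in> A" "y \<in> cimg c"
  shows "(f \<circ> chart_inv c has_derivative dmap c f (chart_inv c y)) (at y)"
  unfolding dmap_def using smooth_on_has_derivative[OF smooth_map_smooth_on] assms by simp

lemma linear_dmap:
  "smooth_map A f \<Longrightarrow> c \<in> A \<Longrightarrow> p \<in> cdom c \<Longrightarrow> linear (dmap c f p)"
  using smooth_map_has_derivative[of f c "snd c p"] has_derivative_linear by fastforce

lemma linear_dmap_chart:
  "c \<in> A \<Longrightarrow> d \<in> A \<Longrightarrow> p \<in> cdom c \<Longrightarrow> p \<in> cdom d \<Longrightarrow> linear (dmap c (snd d) p)"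
  using transition_has_derivative has_derivative_linear by blast

end

text \<open>Two-forms pick up the Jacobian. Bilinearity is assumed as bare equations so that
  \<open>lag_D\<close>, \<open>lag_B\<close>, \<open>lag_C\<close> and the wedge product of two
  one-forms all fit.\<close>

lemma alternating_change_basis:
  fixes J :: "real^2 \<Rightarrow> real^2"
  assumes "linear J" "\<And>v. \<omega> v v = (0::real)" "\<And>v w u. \<omega> (v + w) u = \<omega> v u + \<omega> w u"
    "\<And>v w u. \<omega> u (v + w) = \<omega> u v + \<omega> u w" "\<And>k v u. \<omega> (k *\<^sub>R v) u = k * \<omega> v u" "\<And>k v u. \<omega> u (k *\<^sub>R v) = k * \<omega> u v"
  shows "\<omega> (J ex1) (J ex2) = det2 J * \<omega> ex1 ex2"
proof -
  have "0 = \<omega> (ex1 + ex2) (ex1 + ex2)" by (rule assms(2)[symmetric])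
  also have "\<dots> = \<omega> ex1 ex2 + \<omega> ex2 ex1" unfolding assms(3,4) unfolding assms(2) by simp
  finally have s: "\<omega> ex2 ex1 = - \<omega> ex1 ex2" by linarith
  have "\<omega> (J ex1) (J ex2) = \<omega> (J ex1$1 *\<^sub>R ex1 + J ex1$2 *\<^sub>R ex2) (J ex2$1 *\<^sub>R ex1 + J ex2$2 *\<^sub>R ex2)"
    by (rule arg_cong2[OF real2_decomp real2_decomp])
  also have "\<dots> = det2 J * \<omega> ex1 ex2"
    unfolding assms(3-6) assms(2) s by (simp add: det2_def algebra_simps)
  finally show ?thesis .
qed

lemma inner_const_derivative:
  assumes "(f has_derivative f') (at y)" "(g has_derivative g') (at y)" "open S" "y \<in> S" "\<And>z. z \<in> S \<Longrightarrow> f z \<bullet> g z = k"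
  shows "f' w \<bullet> g y + f y \<bullet> g' w = 0"
proof -
  have 1: "((\<lambda>z. f z \<bullet> g z) has_derivative (\<lambda>w. f y \<bullet> g' w + f' w \<bullet> g y)) (at y)"
    by (rule has_derivative_inner[OF assms(1,2)])
  have "((\<lambda>z. f z \<bullet> g z) has_derivative (\<lambda>w. 0)) (at y)"
    by (rule has_derivative_transform_within_open[OF has_derivative_const[of k] assms(3,4)]) (use assms(5) in simp)
  from fun_cong[OF has_derivative_unique[OF 1 this], of w] show ?thesis by simp
qed

subsection \<open>The Laguerre area density\<close>

text \<open>With \<open>x\<^sub>i\<close>, \<open>\<xi>\<^sub>i\<close> the partial derivatives of the contact map, \<open>d x = - d \<xi> \<circ> R\<close> gives
  \<open>lag_B = - tr R * lag_D\<close> and \<open>lag_C = det R * lag_D\<close>. Hence, up to sign, \<open>lag_M\<close> is the density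
  \<open>((tr R)\<^sup>2 / 2 - 2 det R) * sqrt (det III)\<close> of the Laguerre metric, now a rational function of first
  derivatives.\<close>

definition lag_D :: "'a chart \<Rightarrow> 'a contact_map \<Rightarrow> 'a \<Rightarrow> real" where
  "lag_D c f p = tp (snd (f p)) (dmap c (snd \<circ> f) p ex1) (dmap c (snd \<circ> f) p ex2)"

definition lag_B :: "'a chart \<Rightarrow> 'a contact_map \<Rightarrow> 'a \<Rightarrow> real" where
  "lag_B c f p = tp (snd (f p)) (dmap c (fst \<circ> f) p ex1) (dmap c (snd \<circ> f) p ex2)
     + tp (snd (f p)) (dmap c (snd \<circ> f) p ex1) (dmap c (fst \<circ> f) p ex2)"

definition lag_C :: "'a chart \<Rightarrow> 'a contact_map \<Rightarrow> 'a \<Rightarrow> real" where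
  "lag_C c f p = tp (snd (f p)) (dmap c (fst \<circ> f) p ex1) (dmap c (fst \<circ> f) p ex2)"

definition lag_M :: "'a chart \<Rightarrow> 'a contact_map \<Rightarrow> 'a \<Rightarrow> real" where
  "lag_M c f p = (lag_B c f p)\<^sup>2 / (2 * lag_D c f p) - 2 * lag_C c f p"

context atlas_surface begin

text \<open>The last fact is the self-adjointness of R: differentiate dx'(v) \<bullet> n = 0 along
  \<open>w\<close> and use that the second derivative of x' is symmetric. The one before it
  differentiates n \<bullet> n = 1.\<close>

lemma laguerre_surface_pointwise:
  assumes f: "laguerre_surface A f" and c: "c \<in> A" and p: "p \<in> cdom c"
  shows "linear (dmap c (fst \<circ> f) p)" "linear (dmap c (snd \<circ> f) p)" "inj (dmap c (snd \<circ> f) p)"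
    "snd (f p) \<bullet> snd (f p) = 1" "\<And>v. snd (f p) \<bullet> dmap c (fst \<circ> f) p v = 0"
    "\<And>v. snd (f p) \<bullet> dmap c (snd \<circ> f) p v = 0"
    "\<And>v w. dmap c (fst \<circ> f) p v \<bullet> dmap c (snd \<circ> f) p w = dmap c (fst \<circ> f) p w \<bullet> dmap c (snd \<circ> f) p v"
proof -
  have sm: "smooth_map A (fst \<circ> f)" "smooth_map A (snd \<circ> f)"
    using f by (auto simp: laguerre_surface_def immersion_def)
  show lin: "linear (dmap c (fst \<circ> f) p)" "linear (dmap c (snd \<circ> f) p)"
    using sm c p linear_dmap by blast+
  show "inj (dmap c (snd \<circ> f) p)" using f c p by (auto simp: laguerre_surface_def immersion_def)
  have nn: "snd (f p) \<bullet> snd (f p) = 1" for p using f by (simp add: laguerre_surface_def dot_square_norm)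
  then show "snd (f p) \<bullet> snd (f p) = 1" .
  have nx: "snd (f p) \<bullet> dmap c (fst \<circ> f) p v = 0" if "p \<in> cdom c" for v p
    using f c that by (simp add: laguerre_surface_def inner_commute)
  then show "snd (f p) \<bullet> dmap c (fst \<circ> f) p v = 0" for v using p by blast
  let ?y = "snd c p"
  have y: "?y \<in> cimg c" using p by simp
  note DN = smooth_map_has_derivative[OF sm(2) c y]
  have "dmap c (snd \<circ> f) p v \<bullet> snd (f p) + snd (f p) \<bullet> dmap c (snd \<circ> f) p v = 0" for v
    using inner_const_derivative[OF DN DN open_img[OF c] y, of 1 v] nn c p by simp
  then show "snd (f p) \<bullet> dmap c (snd \<circ> f) p v = 0" for v
    by (simp add: inner_commute)
  fix v w
  define X where "X = (fst \<circ> f) \<circ> chart_inv c"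
  have smX: "smooth_on (cimg c) X" using smooth_map_smooth_on[OF sm(1) c] by (simp add: X_def)
  have DX: "((\<lambda>z. dd X z v) has_derivative
       dd (\<lambda>z. dd X z v) ?y) (at ?y)" for v
    by (rule smooth_on_has_derivative[OF smooth_on_derivative[OF smX] y])
  have zero: "dd X z v \<bullet> (snd \<circ> f \<circ> chart_inv c) z = 0" if "z \<in> cimg c" for z v
    using nx[of "chart_inv c z" v] c that by (simp add: dmap_def X_def inner_commute)
  have e: "dd (\<lambda>z. dd X z v) ?y w \<bullet> snd (f p)
     + dd X ?y v \<bullet> dmap c (snd \<circ> f) p w = 0" for v w
    using inner_const_derivative[OF DX DN open_img[OF c] y, of v 0 w] zero c p by simp
  show "dmap c (fst \<circ> f) p v \<bullet> dmap c (snd \<circ> f) p w = dmap c (fst \<circ> f) p w \<bullet> dmap c (snd \<circ> f) p v"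
    using e[of v w] e[of w v] smooth_on_symmetric_derivative[OF open_img[OF c] smX y, of v w]
    by (simp add: dmap_def X_def)
qed

text \<open>The factor (r1 - r)^2 + (r2 - r)^2 equals (r1 - r2)^2 / 2, and the square of
  \<open>lag_D\<close> is the Gram determinant of the third fundamental form. A conformal factor
  enters the determinant of a plane metric squared, so the volume density is that factor times the
  absolute value of \<open>lag_D\<close>.\<close>

lemma laguerre_density:
  assumes f: "laguerre_surface A f" and c: "c \<in> A" and p: "p \<in> cdom c"
  shows "lag_D c f p \<noteq> 0"
    "(fst (curvature_radii c f p) - snd (curvature_radii c f p))\<^sup>2 / 2 * lag_D c f p = lag_M c f p"
    "volume_density (laguerre_metric f c p) = \<bar>lag_M c f p\<bar>"
proof -
  define n L K where "n = snd (f p)" and "L = dmap c (snd \<circ> f) p" and "K = dmap c (fst \<circ> f) p"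
  note pw = laguerre_surface_pointwise[OF assms, folded n_def L_def K_def]
  define E F G where "E = L ex1 \<bullet> L ex1" and "F = L ex1 \<bullet> L ex2" and "G = L ex2 \<bullet> L ex2"
  have pos: "E > 0" "E * G - F\<^sup>2 > 0" using gram_pos[OF pw(2,3)] by (auto simp: E_def F_def G_def)
  obtain T where T: "linear T" "\<And>v. K v = - L (T v)"
    using linear_factor_through_plane[OF pw(2,1,3) _ pw(6,5)] pw(4) by fastforce
  have q: "neg_quotient c (fst \<circ> f) (snd \<circ> f) p = T"
    by (rule neg_quotient_unique) (use T pw(3) in \<open>auto simp: L_def K_def\<close>)
  have LT: "L (T v) = T v$1 *\<^sub>R L ex1 + T v$2 *\<^sub>R L ex2" for v by (rule linear_real2[OF pw(2)])
  have D: "lag_D c f p = tp n (L ex1) (L ex2)" by (simp add: lag_D_def n_def L_def)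
  have D2: "lag_D c f p * lag_D c f p = E * G - F\<^sup>2"
    unfolding D using tp_gram[OF pw(4) pw(6) pw(6)] by (simp add: E_def F_def G_def inner_commute power2_eq_square)
  then show D0: "lag_D c f p \<noteq> 0" using pos by auto
  have "K ex1 \<bullet> L ex2 = K ex2 \<bullet> L ex1" by (rule pw(7))
  then have "L ex2 \<bullet> L (T ex1) = L ex1 \<bullet> L (T ex2)" unfolding T(2) by (simp add: inner_commute)
  then have sym: "T ex1$1 * F + T ex1$2 * G = T ex2$1 * E + T ex2$2 * F"
    unfolding LT E_def F_def G_def inner_add_right inner_scaleR_right by (simp only: inner_commute[of "L ex2" "L ex1"])
  note ev = eigenvalues_self_adjoint[OF T(1) pos sym]
  define r1 r2 where "r1 = fst (curvature_radii c f p)" and "r2 = snd (curvature_radii c f p)"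
  have r: "r1 + r2 = tr2 T" "r1 * r2 = det2 T"
    using ev by (simp_all add: r1_def r2_def curvature_radii_def q)
  have t: "tp n (L ex2) (L ex1) = - tp n (L ex1) (L ex2)" by (simp add: tp_def algebra_simps)
  have B: "lag_B c f p = - tr2 T * lag_D c f p"
    unfolding lag_B_def n_def[symmetric] L_def[symmetric] K_def[symmetric] D T(2) LT
    by (simp add: tr2_def algebra_simps)
  have C: "lag_C c f p = det2 T * lag_D c f p"
    unfolding lag_C_def n_def[symmetric] L_def[symmetric] K_def[symmetric] D T(2) LT
    by (simp add: det2_def t algebra_simps)
  have "(r1 - r2)\<^sup>2 = (tr2 T)\<^sup>2 - 4 * det2 T" unfolding r[symmetric] by (simp add: power2_eq_square algebra_simps)
  moreover have "lag_M c f p = ((tr2 T)\<^sup>2 - 4 * det2 T) / 2 * lag_D c f p"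
    unfolding lag_M_def B C using D0 by (simp add: power2_eq_square field_simps)
  ultimately show M: "(fst (curvature_radii c f p) - snd (curvature_radii c f p))\<^sup>2 / 2 * lag_D c f p = lag_M c f p"
    by (simp add: r1_def r2_def)
  define l where "l = (r1 - r2)\<^sup>2 / 2"
  have l: "laguerre_metric f c p v w = l * (L v \<bullet> L w)" for v w
    unfolding laguerre_metric_def Let_def l_def r1_def r2_def L_def
    by (simp add: case_prod_beta power2_eq_square field_simps)
  have "volume_density (laguerre_metric f c p) = sqrt ((l * lag_D c f p)\<^sup>2)"
    unfolding volume_density_def det_2 l power_mult_distrib power2_eq_square[of "lag_D c f p"] D2
    by (simp add: E_def F_def G_def inner_commute power2_eq_square algebra_simps)
  also have "\<dots> = \<bar>lag_M c f p\<bar>" using M by (simp add: l_def r1_def r2_def)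
  finally show "volume_density (laguerre_metric f c p) = \<bar>lag_M c f p\<bar>" .
qed

lemma lag_M_nonzero:
  assumes "laguerre_surface A f" "umbilical_free A f" "c \<in> A" "p \<in> cdom c"
  shows "lag_M c f p \<noteq> 0"
  using laguerre_density(1,2)[OF assms(1,3,4)] assms(2-4) by (auto simp: umbilical_free_def)

text \<open>\<open>lag_D\<close>, \<open>lag_B\<close> and \<open>lag_C\<close> are two-forms
  evaluated on the coordinate frame, and \<open>lag_M\<close> is homogeneous of degree one in them.
  The Jacobian enters with its sign.\<close>

lemma lag_change_chart:
  assumes f: "laguerre_surface A f" and c: "c \<in> A" and d: "d \<in> A" and p: "p \<in> cdom c" "p \<in> cdom d"
  shows "lag_D c f p = det2 (dmap c (snd d) p) * lag_D d f p"
    "lag_M c f p = det2 (dmap c (snd d) p) * lag_M d f p"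
proof -
  have sm: "smooth_map A (fst \<circ> f)" "smooth_map A (snd \<circ> f)"
    using f by (auto simp: laguerre_surface_def immersion_def)
  define J where "J = dmap c (snd d) p"
  have J: "linear J" unfolding J_def using linear_dmap_chart c d p by blast
  define n L K where "n = snd (f p)" and "L = dmap d (snd \<circ> f) p" and "K = dmap d (fst \<circ> f) p"
  note pw = laguerre_surface_pointwise[OF f d p(2), folded n_def L_def K_def]
  have Lc: "dmap c (snd \<circ> f) p v = L (J v)" and Kc: "dmap c (fst \<circ> f) p v = K (J v)" for v
    unfolding L_def K_def J_def
    using dmap_change_chart(1)[OF c d p smooth_map_differentiable[OF sm(1) d p(2)]]
      dmap_change_chart(1)[OF c d p smooth_map_differentiable[OF sm(2) d p(2)]] by auto
  note li = linear_add[OF pw(1)] linear_scale[OF pw(1)] linear_add[OF pw(2)] linear_scale[OF pw(2)]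
  have anti: "tp n b a = - tp n a b" for a b by (simp add: tp_def algebra_simps)
  show D: "lag_D c f p = det2 (dmap c (snd d) p) * lag_D d f p"
    unfolding lag_D_def Lc J_def[symmetric] L_def[symmetric] n_def[symmetric]
    by (rule alternating_change_basis[OF J, where \<omega>="\<lambda>v w. tp n (L v) (L w)"]) (simp_all add: li)
  have C: "lag_C c f p = det2 J * lag_C d f p"
    unfolding lag_C_def Kc J_def[symmetric] K_def[symmetric] n_def[symmetric]
    by (rule alternating_change_basis[OF J, where \<omega>="\<lambda>v w. tp n (K v) (K w)"]) (simp_all add: li)
  have B: "lag_B c f p = det2 J * lag_B d f p"
    unfolding lag_B_def Kc Lc L_def[symmetric] K_def[symmetric] n_def[symmetric]
    by (rule alternating_change_basis[OF J, where \<omega>="\<lambda>v w. tp n (K v) (L w) + tp n (L v) (K w)"])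
       (simp_all add: li anti[of "K _" "L _"] algebra_simps)
  have "det2 J \<noteq> 0" using D laguerre_density(1)[OF f c p(1)] by (auto simp: J_def)
  then show "lag_M c f p = det2 (dmap c (snd d) p) * lag_M d f p"
    unfolding lag_M_def B C D J_def[symmetric] by (simp add: power2_eq_square algebra_simps)
qed

end

subsection \<open>Change of variables for nonnegative functions\<close>

text \<open>Connects absolute integrability in the Lebesgue sense with the nonnegative integral over
  \<open>lborel\<close>; Borel measurability makes the completion of the measure harmless.\<close>

lemma absolutely_integrable_nonneg_iff:
  fixes h :: "'e::euclidean_space \<Rightarrow> real"
  assumes S: "S \<in> sets borel" and nn: "\<And>x. x \<in> S \<Longrightarrow> 0 \<le> h x"
    and m: "(\<lambda>x. indicator S x * h x) \<in> borel_measurable borel"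
  shows "h absolutely_integrable_on S \<longleftrightarrow> (\<integral>\<^sup>+x. ennreal (indicator S x * h x) \<partial>lborel) < \<infinity>" (is "?L \<longleftrightarrow> ?R")
    "h absolutely_integrable_on S \<Longrightarrow> (\<integral>\<^sup>+x. ennreal (indicator S x * h x) \<partial>lborel) = ennreal (integral S h)"
proof -
  let ?h = "\<lambda>x. indicator S x * h x"
  have nn': "0 \<le> ?h x" for x using nn by (auto simp: indicator_def)
  have m': "?h \<in> borel_measurable lborel" using m by simp
  have 1: "h absolutely_integrable_on S \<longleftrightarrow> integrable lborel ?h"
    unfolding set_integrable_def using integrable_completion[OF m'] by simp
  show "?L \<longleftrightarrow> ?R" unfolding 1 integrable_iff_bounded using m' nn' by simp
  assume L: ?L
  have "(\<integral>\<^sup>+x. ennreal (?h x) \<partial>lborel) = ennreal (integral\<^sup>L lborel ?h)"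
    by (rule nn_integral_eq_integral) (use L 1 nn' in auto)
  also have "integral\<^sup>L lborel ?h = (LINT x:S|lebesgue. h x)"
    unfolding set_lebesgue_integral_def using integral_completion[OF m'] by simp
  also have "\<dots> = integral S h" by (rule set_lebesgue_integral_eq_integral(2)[OF L])
  finally show "(\<integral>\<^sup>+x. ennreal (?h x) \<partial>lborel) = ennreal (integral S h)" .
qed

text \<open>The theorem for absolutely integrable functions covers the finite case. If one side is
  not integrable then neither is the other, and for nonnegative functions both integrals are
  infinite.\<close>

lemma nn_integral_change_of_variables:
  fixes g :: "real^'n::{finite,wellorder} \<Rightarrow> real^'n::_" and f :: "real^'n::_ \<Rightarrow> real"
  assumes S: "S \<in> sets borel" and gS: "g ` S \<in> sets borel"
    and der: "\<And>x. x \<in> S \<Longrightarrow> (g has_derivative g' x) (at x within S)" and inj: "inj_on g S"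
    and nn: "\<And>x. x \<in> g ` S \<Longrightarrow> 0 \<le> f x"
    and m: "(\<lambda>x. indicator (g ` S) x * f x) \<in> borel_measurable borel"
    and m': "(\<lambda>x. indicator S x * (\<bar>det (matrix (g' x))\<bar> * f (g x))) \<in> borel_measurable borel"
  shows "(\<integral>\<^sup>+x. ennreal (indicator (g ` S) x * f x) \<partial>lborel) =
         (\<integral>\<^sup>+x. ennreal (indicator S x * (\<bar>det (matrix (g' x))\<bar> * f (g x))) \<partial>lborel)"
proof -
  let ?h = "\<lambda>x. \<bar>det (matrix (g' x))\<bar> * f (g x)"
  have SL: "S \<in> sets lebesgue" using S by simp
  \<comment> \<open>The integrand is packed into one-dimensional vectors to fit the vector-valued
    theorem; \<open>b\<close> stays arbitrary so that integrability passes in both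
    directions.\<close>
  have key: "?h absolutely_integrable_on S \<and> integral S ?h = b
     \<longleftrightarrow> f absolutely_integrable_on (g ` S) \<and> integral (g ` S) f = b" for b
    using has_absolute_integral_change_of_variables[OF SL der inj, of "\<lambda>x. vec (f x) :: real^1" "vec b"]
    by (simp add: absolutely_integrable_on_1_iff integral_on_1_eq)
  have nnh: "0 \<le> ?h x" if "x \<in> S" for x using nn that by simp
  note 1 = absolutely_integrable_nonneg_iff[OF S nnh m'] and 2 = absolutely_integrable_nonneg_iff[OF gS nn m]
  show ?thesis
  proof (cases "f absolutely_integrable_on (g ` S)")
    case True
    then have "?h absolutely_integrable_on S" "integral S ?h = integral (g ` S) f" using key by blast+
    then show ?thesis using 1(2) 2(2)[OF _ True] by simp
  next
    case False
    then have "\<not> ?h absolutely_integrable_on S" using key by blast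
    then show ?thesis using False 1(1) 2(1) by (simp add: not_less top_unique)
  qed
qed

lemma det_matrix_eq_det2: "det (matrix T) = det2 (T :: real^2 \<Rightarrow> real^2)"
  by (simp add: det2_def det_2 matrix_def mult.commute)

subsection \<open>The Riemannian measure\<close>

context atlas_surface begin

definition chart_measure :: "('a chart \<Rightarrow> 'a \<Rightarrow> real) \<Rightarrow> 'a chart \<Rightarrow> 'a measure" where
  "chart_measure a c = distr (density (restrict_space lborel (cimg c)) (\<lambda>y. ennreal (a c (chart_inv c y)))) borel (chart_inv c)"

text \<open>The transformation law is that of a density, with the absolute Jacobian instead of the
  signed one of a two-form. It is what makes the chart measures agree on overlaps.\<close>

definition area_density :: "('a chart \<Rightarrow> 'a \<Rightarrow> real) \<Rightarrow> bool" where
  "area_density a \<longleftrightarrow> (\<forall>c\<in>A. (\<forall>p\<in>cdom c. 0 \<le> a c p) \<and> continuous_on (cimg c) (\<lambda>y. a c (chart_inv c y))) \<and>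
     (\<forall>c\<in>A. \<forall>d\<in>A. \<forall>p\<in>cdom c \<inter> cdom d. a c p = \<bar>det2 (dmap c (snd d) p)\<bar> * a d p)"

lemma area_density_nonneg: "area_density a \<Longrightarrow> c \<in> A \<Longrightarrow> p \<in> cdom c \<Longrightarrow> 0 \<le> a c p"
  and area_density_continuous: "area_density a \<Longrightarrow> c \<in> A \<Longrightarrow> continuous_on (cimg c) (\<lambda>y. a c (chart_inv c y))"
  and area_density_change_chart: "area_density a \<Longrightarrow> c \<in> A \<Longrightarrow> d \<in> A \<Longrightarrow> p \<in> cdom c \<Longrightarrow> p \<in> cdom d \<Longrightarrow>
    a c p = \<bar>det2 (dmap c (snd d) p)\<bar> * a d p"
  unfolding area_density_def by blast+

lemma chart_image_eq: "c \<in> A \<Longrightarrow> B \<subseteq> cdom c \<Longrightarrow> snd c ` B = chart_inv c -` B \<inter> cimg c"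
  by force

lemma measurable_chart_inv: "c \<in> A \<Longrightarrow> chart_inv c \<in> measurable (restrict_space borel (cimg c)) borel"
  by (rule borel_measurable_continuous_on_restrict[OF continuous_chart_inv])

lemma chart_image_borel:
  assumes "c \<in> A" "B \<in> sets borel" "B \<subseteq> cdom c"
  shows "snd c ` B \<in> sets borel"
  using measurable_sets[OF measurable_chart_inv[OF assms(1)] assms(2)] open_img[OF assms(1)]
  unfolding chart_image_eq[OF assms(1,3)] by (auto simp: sets_restrict_space_iff space_restrict_space)

lemma density_measurable:
  "area_density a \<Longrightarrow> c \<in> A \<Longrightarrow> (\<lambda>y. a c (chart_inv c y)) \<in> borel_measurable (restrict_space borel (cimg c))"
  by (rule borel_measurable_continuous_on_restrict[OF area_density_continuous])

lemma sets_restrict_lborel: "sets (restrict_space lborel S) = sets (restrict_space borel S)"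
  by (simp add: sets_restrict_space)

lemma measurable_restrict_lborel: "measurable (restrict_space lborel S) N = measurable (restrict_space borel S) N"
  by (rule measurable_cong_sets) (simp_all add: sets_restrict_lborel)

lemma emeasure_chart_measure:
  assumes a: "area_density a" and c: "c \<in> A" and B: "B \<in> sets borel"
  shows "emeasure (chart_measure a c) B = emeasure (chart_measure a c) (B \<inter> cdom c)"
    "B \<subseteq> cdom c \<Longrightarrow> emeasure (chart_measure a c) B =
       (\<integral>\<^sup>+ y\<in>snd c ` B. ennreal (a c (chart_inv c y)) \<partial>lborel)"
proof -
  let ?R = "restrict_space lborel (cimg c)" and ?f = "\<lambda>y. ennreal (a c (chart_inv c y))"
  have m: "chart_inv c \<in> measurable (density ?R ?f) borel"
    using measurable_chart_inv[OF c] by (simp add: measurable_restrict_lborel)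
  have mf: "?f \<in> borel_measurable ?R"
    using density_measurable[OF a c] by (simp add: measurable_restrict_lborel)
  have e: "emeasure (chart_measure a c) B = emeasure (density ?R ?f) (chart_inv c -` B \<inter> cimg c)" if "B \<in> sets borel" for B
    unfolding chart_measure_def using emeasure_distr[OF m that] by (simp add: space_restrict_space)
  have d: "cdom c \<in> sets borel" using open_dom[OF c] by simp
  have "chart_inv c -` B \<inter> cimg c = chart_inv c -` (B \<inter> cdom c) \<inter> cimg c" using c by auto
  then show "emeasure (chart_measure a c) B = emeasure (chart_measure a c) (B \<inter> cdom c)"
    using e[OF B] e[OF sets.Int[OF B d]] by simp
  assume s: "B \<subseteq> cdom c"
  have sub: "snd c ` B \<subseteq> cimg c" using s by blast
  have im: "snd c ` B \<in> sets borel" by (rule chart_image_borel[OF c B s])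
  have "emeasure (chart_measure a c) B = emeasure (density ?R ?f) (snd c ` B)"
    using e[OF B] chart_image_eq[OF c s] by simp
  also have "\<dots> = (\<integral>\<^sup>+ y. ?f y * indicator (snd c ` B) y \<partial>?R)"
    by (rule emeasure_density[OF mf]) (use im sub open_img[OF c] in \<open>simp add: sets_restrict_space_iff\<close>)
  also have "\<dots> = (\<integral>\<^sup>+ y. ?f y * indicator (snd c ` B) y * indicator (cimg c) y \<partial>lborel)"
    by (rule nn_integral_restrict_space) (use open_img[OF c] in simp)
  also have "\<dots> = (\<integral>\<^sup>+ y\<in>snd c ` B. ?f y \<partial>lborel)"
    by (rule nn_integral_cong) (use sub in \<open>auto simp: indicator_def\<close>)
  finally show "emeasure (chart_measure a c) B = (\<integral>\<^sup>+ y\<in>snd c ` B. ?f y \<partial>lborel)" .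
qed

text \<open>Change of variables along the transition map; the Jacobian factor is absorbed by the
  transformation law of \<open>a\<close>.\<close>

lemma chart_measure_overlap:
  assumes a: "area_density a" and c: "c \<in> A" and d: "d \<in> A" and B: "B \<in> sets borel" "B \<subseteq> cdom c" "B \<subseteq> cdom d"
  shows "emeasure (chart_measure a c) B = emeasure (chart_measure a d) B"
proof -
  define S where "S = snd c ` B"
  define g where "g = snd d \<circ> chart_inv c"
  define g' where "g' = (\<lambda>y. dmap c (snd d) (chart_inv c y))"
  let ?f = "\<lambda>y. a d (chart_inv d y)"
  have gS: "g ` S = snd d ` B"
    unfolding g_def S_def image_image using c B by (intro image_cong) auto
  have S: "S \<in> sets borel" "g ` S \<in> sets borel"
    unfolding gS unfolding S_def using chart_image_borel B c d by auto
  have der: "(g has_derivative g' x) (at x within S)" if "x \<in> S" for x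
    unfolding g_def g'_def
    using has_derivative_at_withinI[OF transition_has_derivative[OF c d]] that B c by (force simp: S_def)
  have inj: "inj_on g S"
    using c d B by (auto simp: inj_on_def g_def S_def) (metis chart_inv_chart subsetD)
  have nn: "0 \<le> ?f x" if "x \<in> g ` S" for x
    using that area_density_nonneg[OF a d] d B unfolding gS by (auto simp: subset_iff)
  have ind: "(\<lambda>y. indicator S y * h y) \<in> borel_measurable borel"
    if "h \<in> borel_measurable (restrict_space borel (cimg c))" "S \<in> sets borel" "S \<subseteq> cimg c" "c \<in> A"
    for S :: "(real^2) set" and h :: "real^2 \<Rightarrow> real" and c
  proof -
    have "(\<lambda>y. indicator (cimg c) y *\<^sub>R h y) \<in> borel_measurable borel"
      using that(1) borel_measurable_restrict_space_iff[of "cimg c" borel h] open_img[OF that(4)] by simp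
    then have "(\<lambda>y. indicator S y * (indicator (cimg c) y *\<^sub>R h y)) \<in> borel_measurable borel"
      using that(2) by measurable
    also have "(\<lambda>y. indicator S y * (indicator (cimg c) y *\<^sub>R h y)) = (\<lambda>y. indicator S y * h y)"
      using that(3) by (auto simp: indicator_def fun_eq_iff)
    finally show ?thesis .
  qed
  have m1: "(\<lambda>x. indicator (g ` S) x * ?f x) \<in> borel_measurable borel"
    by (rule ind[OF density_measurable[OF a d] S(2) _ d]) (use B gS in auto)
  have eq: "indicator S x * (\<bar>det (matrix (g' x))\<bar> * ?f (g x)) = indicator S x * a c (chart_inv c x)" for x
  proof (cases "x \<in> S")
    case True
    then obtain p where p: "p \<in> B" "x = snd c p" by (auto simp: S_def)
    then have "a c p = \<bar>det2 (dmap c (snd d) p)\<bar> * a d p"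
      using area_density_change_chart[OF a c d] B by auto
    then show ?thesis using p B c d by (auto simp: g'_def g_def det_matrix_eq_det2 subset_iff)
  qed simp
  have m2: "(\<lambda>x. indicator S x * (\<bar>det (matrix (g' x))\<bar> * ?f (g x))) \<in> borel_measurable borel"
    unfolding eq by (rule ind[OF density_measurable[OF a c] S(1) _ c]) (use B S_def in auto)
  have conv: "ennreal (indicator S y * h) = ennreal h * indicator S y" for S :: "(real^2) set" and y h
    by (auto simp: indicator_def)
  have "emeasure (chart_measure a d) B = (\<integral>\<^sup>+x. ennreal (indicator (g ` S) x * ?f x) \<partial>lborel)"
    using emeasure_chart_measure(2)[OF a d B(1,3)] by (simp add: gS conv)
  also have "\<dots> = (\<integral>\<^sup>+x. ennreal (indicator S x * (\<bar>det (matrix (g' x))\<bar> * ?f (g x))) \<partial>lborel)"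
    by (rule nn_integral_change_of_variables[OF S der inj nn m1 m2])
  also have "\<dots> = emeasure (chart_measure a c) B"
    unfolding eq using emeasure_chart_measure(2)[OF a c B(1,2)] by (simp add: S_def conv)
  finally show ?thesis by simp
qed

text \<open>Second countability reduces the chart domains to a countable cover, by Lindelof;
  removing the earlier domains makes the pieces disjoint and keeps each inside one chart.\<close>

lemma countable_chart_partition:
  obtains cs :: "nat \<Rightarrow> 'a chart" and P :: "nat \<Rightarrow> 'a set"
  where "\<And>n. cs n \<in> A" "\<And>n. P n \<in> sets borel" "\<And>n. P n \<subseteq> cdom (cs n)" "disjoint_family P" "(\<Union>n. P n) = UNIV"
proof -
  obtain \<F> where \<F>: "\<F> \<subseteq> fst ` A" "countable \<F>" "\<Union>\<F> = \<Union>(fst ` A)"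
    by (rule Lindelof[of "fst ` A"]) (use open_dom in blast)+
  have U: "\<Union>\<F> = UNIV" using \<F>(3) dom_cover by auto
  then have ne: "\<F> \<noteq> {}" by auto
  define D where "D = from_nat_into \<F>"
  have D: "D n \<in> fst ` A" for n using from_nat_into[OF ne] \<F>(1) by (auto simp: D_def)
  then have "\<forall>n. \<exists>c. c \<in> A \<and> D n = fst c" unfolding image_iff Bex_def by (rule allI)
  then obtain cs where "\<forall>n. cs n \<in> A \<and> D n = fst (cs n)" using choice[of "\<lambda>n c. c \<in> A \<and> D n = fst c"] by blast
  then have cs: "\<And>n. cs n \<in> A" "\<And>n. D n = fst (cs n)" by simp_all
  have UD: "(\<Union>n. D n) = UNIV" using range_from_nat_into[OF ne \<F>(2)] U by (simp add: D_def)
  show ?thesis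
  proof (rule that[of cs "disjointed D"])
    show "disjointed D n \<in> sets borel" for n
      using sets.range_disjointed_sets[of D borel] open_dom[OF cs(1)] cs(2) by (auto simp: image_subset_iff)
    show "disjointed D n \<subseteq> cdom (cs n)" for n using disjointed_subset[of D n] cs(2) by simp
  qed (use cs UD in \<open>simp_all add: disjoint_family_disjointed UN_disjointed_eq\<close>)
qed

text \<open>The condition inside the definite description of \<open>riemannian_measure\<close>, with
  \<open>a\<close> in place of the volume density.\<close>

definition has_area_density :: "'a measure \<Rightarrow> ('a chart \<Rightarrow> 'a \<Rightarrow> real) \<Rightarrow> bool" where
  "has_area_density \<mu> a \<longleftrightarrow> sets \<mu> = sets borel \<and>
     (\<forall>c\<in>A. \<forall>B\<in>sets borel. B \<subseteq> cdom c \<longrightarrow>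
        emeasure \<mu> B = (\<integral>\<^sup>+ y\<in>snd c ` B. ennreal (a c (chart_inv c y)) \<partial>lborel))"

text \<open>A Borel set is the countable disjoint union of its pieces in single charts, and on each
  piece the measure is prescribed.\<close>

lemma has_area_density_unique:
  assumes "has_area_density \<mu> a" "has_area_density \<nu> a"
  shows "\<mu> = \<nu>"
proof -
  obtain cs :: "nat \<Rightarrow> 'a chart" and P where P: "\<And>n. cs n \<in> A" "\<And>n. P n \<in> sets borel"
    "\<And>n. P n \<subseteq> cdom (cs n)" "disjoint_family P" "(\<Union>n. P n) = UNIV"
    by (rule countable_chart_partition) blast
  have split: "(\<Sum>n. emeasure \<mu> (B \<inter> P n)) = emeasure \<mu> B" if "sets \<mu> = sets borel" "B \<in> sets borel" for \<mu> :: "'a measure" and B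
  proof -
    have "(\<Sum>n. emeasure \<mu> (B \<inter> P n)) = emeasure \<mu> (\<Union>n. B \<inter> P n)"
      by (rule suminf_emeasure) (use that P(2,4) in \<open>auto simp: disjoint_family_on_def, blast\<close>)
    also have "(\<Union>n. B \<inter> P n) = B" using P(5) by blast
    finally show ?thesis .
  qed
  show ?thesis
  proof (rule measure_eqI)
    fix B assume "B \<in> sets \<mu>"
    then have B: "B \<in> sets borel" using assms(1) by (simp add: has_area_density_def)
    have "emeasure \<mu> (B \<inter> P n) = emeasure \<nu> (B \<inter> P n)" for n
      using assms P(1)[of n] P(2)[of n] P(3)[of n] B by (simp add: has_area_density_def le_infI2)
    then show "emeasure \<mu> B = emeasure \<nu> B"
      using split[OF _ B, of \<mu>] split[OF _ B, of \<nu>] assms by (simp add: has_area_density_def)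
  qed (use assms in \<open>simp add: has_area_density_def\<close>)
qed

text \<open>Glues the chart measures: each piece of a countable partition is measured in its own
  chart, and \<open>chart_measure_overlap\<close> shows that any other chart containing the set
  gives the same value.\<close>

lemma has_area_density_exists:
  assumes a: "area_density a"
  shows "\<exists>\<mu>. has_area_density \<mu> a"
proof -
  obtain cs :: "nat \<Rightarrow> 'a chart" and P where P: "\<And>n. cs n \<in> A" "\<And>n. P n \<in> sets borel"
    "\<And>n. P n \<subseteq> cdom (cs n)" "disjoint_family P" "(\<Union>n. P n) = UNIV"
    by (rule countable_chart_partition) blast
  let ?m = "\<lambda>B. \<Sum>n. emeasure (chart_measure a (cs n)) (B \<inter> P n)"
  have sc: "sets (chart_measure a c) = sets borel" for c by (simp add: chart_measure_def)
  define \<mu> where "\<mu> = measure_of UNIV (sets borel) ?m"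
  have sets: "sets \<mu> = sets (borel :: 'a measure)"
    unfolding \<mu>_def using sets.sigma_sets_eq[of "borel :: 'a measure"] by simp
  have em: "emeasure \<mu> B = ?m B" if B: "B \<in> sets borel" for B
    unfolding \<mu>_def
  proof (rule emeasure_measure_of_sigma)
    show "sigma_algebra UNIV (sets (borel :: 'a measure))"
      using sets.sigma_algebra_axioms[of "borel :: 'a measure"] by simp
    show "positive (sets borel) ?m" by (simp add: positive_def)
    show "countably_additive (sets borel) ?m"
      unfolding countably_additive_def
    proof (intro allI impI)
      fix F :: "nat \<Rightarrow> 'a set"
      assume F: "range F \<subseteq> sets borel" "disjoint_family F" "\<Union>(range F) \<in> sets borel"
      let ?c = "\<lambda>n. chart_measure a (cs n)"
      \<comment> \<open>The sums are rewritten as integrals over the counting measure in order to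
        exchange them.\<close>
      have "(\<Sum>i. ?m (F i)) = (\<Sum>i. \<integral>\<^sup>+ n. emeasure (?c n) (F i \<inter> P n) \<partial>count_space UNIV)"
        by (simp add: nn_integral_count_space_nat)
      also have "\<dots> = (\<integral>\<^sup>+ n. (\<Sum>i. emeasure (?c n) (F i \<inter> P n)) \<partial>count_space UNIV)"
        by (rule nn_integral_suminf[symmetric]) simp
      also have "\<dots> = (\<Sum>n. \<Sum>i. emeasure (?c n) (F i \<inter> P n))"
        by (simp add: nn_integral_count_space_nat)
      also have "\<dots> = ?m (\<Union>(range F))"
      proof (rule suminf_cong)
        fix n
        have "(\<Sum>i. emeasure (?c n) (F i \<inter> P n)) = emeasure (?c n) (\<Union>i. F i \<inter> P n)"
          by (rule suminf_emeasure) (use F P(2) sc in \<open>auto simp: disjoint_family_on_def\<close>)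
        then show "(\<Sum>i. emeasure (?c n) (F i \<inter> P n)) = emeasure (?c n) (\<Union>(range F) \<inter> P n)"
          by (simp add: Int_UN_distrib2 Int_commute)
      qed
      finally show "(\<Sum>i. ?m (F i)) = ?m (\<Union>(range F))" .
    qed
  qed (rule B)
  have "emeasure \<mu> B = emeasure (chart_measure a c) B" if "c \<in> A" "B \<in> sets borel" "B \<subseteq> cdom c" for c B
  proof -
    have "emeasure \<mu> B = (\<Sum>n. emeasure (chart_measure a c) (B \<inter> P n))"
      unfolding em[OF that(2)]
      by (intro suminf_cong chart_measure_overlap a) (use P that in auto)
    also have "\<dots> = emeasure (chart_measure a c) (\<Union>n. B \<inter> P n)"
      by (rule suminf_emeasure) (use that P(2,4) sc in \<open>auto simp: disjoint_family_on_def, blast\<close>)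
    also have "(\<Union>n. B \<inter> P n) = B" using P(5) by blast
    finally show ?thesis .
  qed
  then show ?thesis using emeasure_chart_measure(2)[OF a] sets by (intro exI[of _ \<mu>]) (simp add: has_area_density_def)
qed

text \<open>The integrals only see points of \<open>cdom c\<close>, so agreement of the densities
  there is enough; uniqueness then resolves the definite description.\<close>

lemma riemannian_measure_eqI:
  assumes "has_area_density \<mu> a" "\<And>c p. c \<in> A \<Longrightarrow> p \<in> cdom c \<Longrightarrow> volume_density (g c p) = a c p"
  shows "riemannian_measure A g = \<mu>"
proof -
  have eq: "has_area_density \<nu> (\<lambda>c p. volume_density (g c p)) \<longleftrightarrow> has_area_density \<nu> a" for \<nu>
  proof -
    have "(\<integral>\<^sup>+ y\<in>snd c ` B. ennreal (volume_density (g c (chart_inv c y))) \<partial>lborel) =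
       (\<integral>\<^sup>+ y\<in>snd c ` B. ennreal (a c (chart_inv c y)) \<partial>lborel)" if "c \<in> A" "B \<subseteq> cdom c" for c B
      by (rule nn_integral_cong) (use assms(2)[OF that(1)] that in \<open>auto simp: indicator_def subset_iff\<close>)
    then show ?thesis by (auto simp: has_area_density_def)
  qed
  have "riemannian_measure A g = (THE \<nu>. has_area_density \<nu> (\<lambda>c p. volume_density (g c p)))"
    unfolding riemannian_measure_def has_area_density_def ..
  also have "\<dots> = \<mu>" unfolding eq using assms(1) has_area_density_unique by blast
  finally show ?thesis .
qed

text \<open>Since a chart measure is a push-forward, this turns integrals over \<open>\<mu>\<close>
  of functions living on one chart into integrals over the chart image.\<close>

lemma density_indicator_chart:
  assumes \<mu>: "has_area_density \<mu> a" and a: "area_density a" and c: "c \<in> A"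
  shows "density \<mu> (\<lambda>x. ennreal (indicator (cdom c) x)) = chart_measure a c"
proof -
  have sets: "sets \<mu> = sets borel" using \<mu> by (simp add: has_area_density_def)
  have d: "cdom c \<in> sets borel" using open_dom[OF c] by simp
  show ?thesis
  proof (rule measure_eqI)
    fix B assume "B \<in> sets (density \<mu> (\<lambda>x. ennreal (indicator (cdom c) x)))"
    then have B: "B \<in> sets borel" using sets by simp
    have "emeasure (density \<mu> (\<lambda>x. ennreal (indicator (cdom c) x))) B = emeasure \<mu> (B \<inter> cdom c)"
      using B d sets by (subst emeasure_density)
        (auto simp: ennreal_indicator indicator_inter_arith[symmetric] Int_commute measurable_cong_sets[OF sets refl])
    also have "\<dots> = emeasure (chart_measure a c) B"
      using \<mu> c B d emeasure_chart_measure[OF a c] by (simp add: has_area_density_def)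
    finally show "emeasure (density \<mu> (\<lambda>x. ennreal (indicator (cdom c) x))) B = emeasure (chart_measure a c) B" .
  qed (simp add: chart_measure_def sets)
qed

lemma nn_integral_has_area_density:
  fixes u :: "'a \<Rightarrow> ennreal"
  assumes \<mu>: "has_area_density \<mu> a" and a: "area_density a" and c: "c \<in> A"
    and u: "u \<in> borel_measurable borel"
  shows "(\<integral>\<^sup>+p. u p * indicator (cdom c) p \<partial>\<mu>) =
     (\<integral>\<^sup>+y\<in>cimg c. (ennreal (a c (chart_inv c y)) * u (chart_inv c y)) \<partial>lborel)"
proof -
  let ?R = "restrict_space lborel (cimg c)"
  have sets: "sets \<mu> = sets borel" using \<mu> by (simp add: has_area_density_def)
  have um: "u \<in> borel_measurable \<mu>" using u sets by (simp cong: measurable_cong_sets)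
  have im: "(\<lambda>x. ennreal (indicator (cdom c) x)) \<in> borel_measurable \<mu>"
    using borel_measurable_indicator[of "cdom c" \<mu>] open_dom[OF c] sets by (simp add: ennreal_indicator)
  have "(\<integral>\<^sup>+p. u p * indicator (cdom c) p \<partial>\<mu>) = integral\<^sup>N (density \<mu> (\<lambda>x. ennreal (indicator (cdom c) x))) u"
    by (subst nn_integral_density[OF im um]) (simp add: ennreal_indicator mult.commute)
  also have "\<dots> = (\<integral>\<^sup>+y. u (chart_inv c y) \<partial>density ?R (\<lambda>y. ennreal (a c (chart_inv c y))))"
    unfolding density_indicator_chart[OF \<mu> a c] chart_measure_def
    by (rule nn_integral_distr) (use measurable_chart_inv[OF c] u in \<open>simp_all add: measurable_restrict_lborel\<close>)
  also have "\<dots> = (\<integral>\<^sup>+y. ennreal (a c (chart_inv c y)) * u (chart_inv c y) \<partial>?R)"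
    by (rule nn_integral_density)
      (use density_measurable[OF a c] measurable_compose[OF measurable_chart_inv[OF c] u] in
        \<open>simp_all add: measurable_restrict_lborel\<close>)
  also have "\<dots> = (\<integral>\<^sup>+y\<in>cimg c. (ennreal (a c (chart_inv c y)) * u (chart_inv c y)) \<partial>lborel)"
    by (rule nn_integral_restrict_space) (use open_img[OF c] in simp)
  finally show ?thesis .
qed

lemma integral_has_area_density:
  fixes u :: "'a \<Rightarrow> real"
  assumes \<mu>: "has_area_density \<mu> a" and a: "area_density a" and c: "c \<in> A"
    and u: "u \<in> borel_measurable borel" "\<And>p. p \<notin> cdom c \<Longrightarrow> u p = 0"
  shows "integral\<^sup>L \<mu> u = (\<integral>y. indicator (cimg c) y * (a c (chart_inv c y) * u (chart_inv c y)) \<partial>lborel)"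
proof -
  let ?R = "restrict_space lborel (cimg c)"
  have sets: "sets \<mu> = sets borel" using \<mu> by (simp add: has_area_density_def)
  have d: "cdom c \<in> sets borel" using open_dom[OF c] by simp
  have ai: "AE y in ?R. 0 \<le> a c (chart_inv c y)"
    using area_density_nonneg[OF a c] c by (intro AE_I2) (auto simp: space_restrict_space)
  have um: "u \<in> borel_measurable \<mu>" using u(1) sets by (simp cong: measurable_cong_sets)
  have im: "(indicator (cdom c) :: 'a \<Rightarrow> real) \<in> borel_measurable \<mu>" using d sets by simp
  have "integral\<^sup>L \<mu> u = (\<integral>x. indicator (cdom c) x *\<^sub>R u x \<partial>\<mu>)"
    by (intro Bochner_Integration.integral_cong) (use u(2) in \<open>auto simp: indicator_def\<close>)
  also have "\<dots> = integral\<^sup>L (density \<mu> (\<lambda>x. ennreal (indicator (cdom c) x))) u"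
    by (rule integral_density[symmetric, OF um im]) simp
  also have "\<dots> = (\<integral>y. u (chart_inv c y) \<partial>density ?R (\<lambda>y. ennreal (a c (chart_inv c y))))"
    unfolding density_indicator_chart[OF \<mu> a c] chart_measure_def
    by (rule integral_distr) (use measurable_chart_inv[OF c] u(1) in \<open>simp_all add: measurable_restrict_lborel\<close>)
  also have "\<dots> = (\<integral>y. a c (chart_inv c y) *\<^sub>R u (chart_inv c y) \<partial>?R)"
    by (rule integral_density[OF _ _ ai])
      (use density_measurable[OF a c] measurable_compose[OF measurable_chart_inv[OF c] u(1)] in
        \<open>simp_all add: measurable_restrict_lborel\<close>)
  also have "\<dots> = (\<integral>y. indicator (cimg c) y *\<^sub>R (a c (chart_inv c y) *\<^sub>R u (chart_inv c y)) \<partial>lborel)"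
    by (rule integral_restrict_space) (use open_img[OF c] in simp)
  finally show ?thesis by simp
qed

lemma compact_chart_neighbourhood:
  assumes "c \<in> A" "p \<in> cdom c"
  obtains r where "r > 0" "cball (snd c p) r \<subseteq> cimg c"
  using open_img[OF assms(1)] assms by (metis open_contains_cball image_eqI)

text \<open>The continuous density is bounded on a closed coordinate ball, so every point has a
  neighbourhood of finite measure; finitely many of them cover \<open>K\<close>.\<close>

lemma emeasure_compact_finite:
  assumes \<mu>: "has_area_density \<mu> a" and a: "area_density a" and K: "compact K"
  shows "emeasure \<mu> K < \<infinity>"
proof -
  have sets: "sets \<mu> = sets borel" using \<mu> by (simp add: has_area_density_def)
  have "\<exists>W. p \<in> W \<and> open W \<and> emeasure \<mu> W < \<infinity>" for p
  proof -
    obtain c where c: "c \<in> A" "p \<in> cdom c" using dom_cover by blast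
    obtain r where r: "r > 0" "cball (snd c p) r \<subseteq> cimg c" using compact_chart_neighbourhood[OF c] .
    let ?W = "{q \<in> cdom c. snd c q \<in> ball (snd c p) r}"
    have o: "open ?W" by (rule open_chart_preimage[OF c(1) open_ball])
    have "continuous_on (cball (snd c p) r) (\<lambda>y. a c (chart_inv c y))"
      using area_density_continuous[OF a c(1)] r(2) by (rule continuous_on_subset)
    then have "bounded ((\<lambda>y. a c (chart_inv c y)) ` cball (snd c p) r)"
      by (intro compact_imp_bounded compact_continuous_image) auto
    then obtain M where M: "\<And>y. y \<in> cball (snd c p) r \<Longrightarrow> a c (chart_inv c y) \<le> M"
      unfolding bounded_iff by (force simp: abs_le_iff)
    have "emeasure \<mu> ?W = (\<integral>\<^sup>+ y\<in>snd c ` ?W. ennreal (a c (chart_inv c y)) \<partial>lborel)"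
      using \<mu> c(1) o by (auto simp: has_area_density_def)
    also have "\<dots> \<le> (\<integral>\<^sup>+ y. ennreal M * indicator (cball (snd c p) r) y \<partial>lborel)"
      by (rule nn_integral_mono) (use M in \<open>auto simp: indicator_def intro!: ennreal_leI\<close>)
    also have "\<dots> = ennreal M * emeasure lborel (cball (snd c p) r)"
      by (simp add: nn_integral_cmult_indicator)
    also have "\<dots> < \<infinity>"
      using emeasure_bounded_finite[of "cball (snd c p) r"] by (simp add: ennreal_mult_less_top)
    finally have "emeasure \<mu> ?W < \<infinity>" .
    then show ?thesis using o c r by (intro exI[of _ ?W]) auto
  qed
  then obtain W where W: "\<And>p. p \<in> W p" "\<And>p. open (W p)" "\<And>p. emeasure \<mu> (W p) < \<infinity>" by metis
  obtain C where C: "finite C" "K \<subseteq> (\<Union>p\<in>C. W p)"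
    using compactE_image[OF K, of K W] W by (metis UN_I subsetI)
  have "emeasure \<mu> K \<le> emeasure \<mu> (\<Union>p\<in>C. W p)"
    by (rule emeasure_mono[OF C(2)]) (use W(2) in \<open>simp add: sets borel_open open_UN\<close>)
  also have "\<dots> \<le> (\<Sum>p\<in>C. emeasure \<mu> (W p))"
    by (rule emeasure_subadditive_finite) (use C W(2) sets in auto)
  also have "\<dots> < \<infinity>" using W(3) C(1) by simp
  finally show ?thesis .
qed

end

subsection \<open>Differentiation under the integral sign\<close>

text \<open>Dominated convergence for the difference quotients along an arbitrary sequence tending
  to 0; \<open>dom\<close> says that \<open>w\<close> bounds them all.\<close>

lemma has_real_derivative_integral:
  fixes f :: "real \<Rightarrow> 'a \<Rightarrow> real"
  assumes d: "d > 0" and int: "\<And>t. \<bar>t\<bar> < d \<Longrightarrow> integrable M (f t)"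
    and der: "\<And>x. x \<in> space M \<Longrightarrow> ((\<lambda>t. f t x) has_real_derivative f' x) (at 0)"
    and m: "f' \<in> borel_measurable M" and w: "integrable M w"
    and dom: "\<And>t x. \<lbrakk>\<bar>t\<bar> < d; x \<in> space M\<rbrakk> \<Longrightarrow> \<bar>f t x - f 0 x\<bar> \<le> \<bar>t\<bar> * w x"
  shows "((\<lambda>t. \<integral>x. f t x \<partial>M) has_real_derivative (\<integral>x. f' x \<partial>M)) (at 0)"
proof -
  have "(\<lambda>i. ((\<integral>x. f (X i) x \<partial>M) - (\<integral>x. f 0 x \<partial>M)) / X i) \<longlonglongrightarrow> (\<integral>x. f' x \<partial>M)"
    if X0: "\<And>i. X i \<noteq> 0" and X: "X \<longlonglongrightarrow> 0" for X
  proof -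
    \<comment> \<open>Set to 0 while \<open>X i\<close> is outside the admissible interval, so that
      measurability and domination hold for every index and not only eventually.\<close>
    define s where "s = (\<lambda>i x. if \<bar>X i\<bar> < d then (f (X i) x - f 0 x) / X i else 0)"
    have small: "\<forall>\<^sub>F i in sequentially. \<bar>X i\<bar> < d"
      using X d by (simp add: lim_sequentially tendsto_iff dist_real_def eventually_sequentially)
    have "(\<lambda>i. integral\<^sup>L M (s i)) \<longlonglongrightarrow> integral\<^sup>L M f'"
    proof (rule integral_dominated_convergence[where w="\<lambda>x. \<bar>w x\<bar>"])
      show "s i \<in> borel_measurable M" for i
        using borel_measurable_integrable[OF int, of "X i"] borel_measurable_integrable[OF int, of 0] d by (cases "\<bar>X i\<bar> < d") (simp_all add: s_def)
      show "AE x in M. (\<lambda>i. s i x) \<longlonglongrightarrow> f' x"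
      proof (rule AE_I2)
        fix x assume x: "x \<in> space M"
        have "((\<lambda>h. (f h x - f 0 x) / h) \<longlongrightarrow> f' x) (at 0)"
          using der[OF x] by (simp add: DERIV_def)
        then have "(\<lambda>i. (f (X i) x - f 0 x) / X i) \<longlonglongrightarrow> f' x"
          using X X0 by (auto simp: tendsto_at_iff_sequentially o_def)
        then show "(\<lambda>i. s i x) \<longlonglongrightarrow> f' x"
          by (rule Lim_transform_eventually) (use small in \<open>auto simp: s_def elim: eventually_mono\<close>)
      qed
      show "AE x in M. norm (s i x) \<le> \<bar>w x\<bar>" for i
      proof (rule AE_I2)
        fix x assume x: "x \<in> space M"
        show "norm (s i x) \<le> \<bar>w x\<bar>"
        proof (cases "\<bar>X i\<bar> < d")
          case True
          then have "\<bar>f (X i) x - f 0 x\<bar> \<le> \<bar>X i\<bar> * \<bar>w x\<bar>"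
            using dom[OF True x] by (smt (verit) mult_left_mono abs_ge_zero abs_ge_self)
          then show ?thesis using True X0[of i] by (simp add: s_def field_simps)
        qed (simp add: s_def)
      qed
    qed (use m w in auto)
    moreover have "\<forall>\<^sub>F i in sequentially. integral\<^sup>L M (s i) = ((\<integral>x. f (X i) x \<partial>M) - (\<integral>x. f 0 x \<partial>M)) / X i"
      using small by (rule eventually_mono) (use int d in \<open>simp add: s_def\<close>)
    ultimately show ?thesis by (rule Lim_transform_eventually)
  qed
  then show ?thesis unfolding DERIV_def by (auto simp: tendsto_at_iff_sequentially o_def)
qed

text \<open>Translation invariance: \<open>\<integral> u (y + t v) dy\<close> does not depend on \<open>t\<close>; differentiate at \<open>0\<close>.\<close>

lemma integral_derivative_compact_support:
  fixes u :: "'e::euclidean_space \<Rightarrow> real"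
  assumes der: "\<And>y. (u has_derivative u' y) (at y)" and cont: "continuous_on UNIV (\<lambda>y. u' y v)"
    and C: "compact C" "\<And>y. y \<notin> C \<Longrightarrow> u y = 0"
  shows "integrable lborel (\<lambda>y. u' y v)" "(\<integral>y. u' y v \<partial>lborel) = 0"
proof -
  have u'0: "u' y v = 0" if "y \<notin> C" for y
  proof -
    have "(u has_derivative (\<lambda>v. 0)) (at y)"
      by (rule has_derivative_transform_within_open[OF has_derivative_const[of 0], of "- C"])
        (use C that in \<open>auto intro: compact_imp_closed\<close>)
    from has_derivative_unique[OF der this] show ?thesis by simp
  qed
  have "integrable lborel (\<lambda>y. indicator C y *\<^sub>R u' y v)"
    by (rule borel_integrable_compact[OF C(1) continuous_on_subset[OF cont]]) simp
  moreover have "(\<lambda>y. indicator C y *\<^sub>R u' y v) = (\<lambda>y. u' y v)" using u'0 by (auto simp: indicator_def fun_eq_iff)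
  ultimately show "integrable lborel (\<lambda>y. u' y v)" by simp
  have "bounded ((\<lambda>y. u' y v) ` C)"
    by (intro compact_imp_bounded compact_continuous_image C continuous_on_subset[OF cont]) simp
  then obtain B where B: "\<And>y. y \<in> C \<Longrightarrow> \<bar>u' y v\<bar> \<le> B" unfolding bounded_iff by auto
  have B': "\<bar>u' y v\<bar> \<le> \<bar>B\<bar>" for y using B[of y] u'0[of y] by (cases "y \<in> C") auto
  obtain R where R: "\<And>y. y \<in> C \<Longrightarrow> norm y \<le> R" using compact_imp_bounded[OF C(1)] by (auto simp: bounded_iff)
  \<comment> \<open>Contains the support of every translate by \<open>t *\<^sub>R v\<close> with
    \<open>\<bar>t\<bar> < 1\<close>, hence carries the dominating function.\<close>
  define C' where "C' = cball (0::'e) (R + norm v)"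
  have out: "u (y + t *\<^sub>R v) = 0" if "y \<notin> C'" "\<bar>t\<bar> < 1" for y t
  proof (rule C(2), rule notI)
    assume "y + t *\<^sub>R v \<in> C"
    then have "norm (y + t *\<^sub>R v) \<le> R" by (rule R)
    moreover have "norm y \<le> norm (y + t *\<^sub>R v) + norm (t *\<^sub>R v)"
      using norm_triangle_ineq4[of "y + t *\<^sub>R v" "t *\<^sub>R v"] by simp
    moreover have "norm (t *\<^sub>R v) \<le> norm v" using that(2) by (simp add: mult_left_le_one_le)
    ultimately show False using that(1) by (simp add: C'_def)
  qed
  have contu: "continuous_on UNIV u"
    using has_derivative_continuous[OF der] by (simp add: continuous_at_imp_continuous_on)
  have intu: "integrable lborel u"
  proof -
    have "integrable lborel (\<lambda>x. indicator C x *\<^sub>R u x)"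
      by (rule borel_integrable_compact[OF C(1)]) (use contu continuous_on_subset in blast)
    moreover have "(\<lambda>x. indicator C x *\<^sub>R u x) = u" using C(2) by (auto simp: indicator_def fun_eq_iff)
    ultimately show ?thesis by simp
  qed
  have trans: "integrable lborel (\<lambda>y. u (y + t *\<^sub>R v))" "(\<integral>y. u (y + t *\<^sub>R v) \<partial>lborel) = integral\<^sup>L lborel u" for t
  proof -
    have meas: "(\<lambda>y. t *\<^sub>R v + y) \<in> measurable lborel borel" by simp
    have um: "u \<in> borel_measurable borel" using contu by (rule borel_measurable_continuous_onI)
    have "integrable (distr lborel borel ((+) (t *\<^sub>R v))) u" using intu by (simp add: lborel_distr_plus)
    then show "integrable lborel (\<lambda>y. u (y + t *\<^sub>R v))"
      using integrable_distr_eq[OF meas um] by (simp add: add.commute)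
    show "(\<integral>y. u (y + t *\<^sub>R v) \<partial>lborel) = integral\<^sup>L lborel u"
      using integral_distr[OF meas um, unfolded lborel_distr_plus] by (simp add: add.commute)
  qed
  have line: "((\<lambda>t. u (y + t *\<^sub>R v)) has_real_derivative u' (y + t *\<^sub>R v) v) (at t)" for y t
    by (rule has_real_derivative_along_line[OF der])
  have "((\<lambda>t. \<integral>y. u (y + t *\<^sub>R v) \<partial>lborel) has_real_derivative (\<integral>y. u' y v \<partial>lborel)) (at 0)"
  proof (rule has_real_derivative_integral[where d=1 and w="\<lambda>y. \<bar>B\<bar> * indicator C' y"])
    show "((\<lambda>t. u (y + t *\<^sub>R v)) has_real_derivative u' y v) (at 0)" for y using line[of y 0] by simp
    show "(\<lambda>y. u' y v) \<in> borel_measurable lborel" using borel_measurable_continuous_onI[OF cont] by simp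
    have "emeasure lborel C' < \<infinity>" by (rule emeasure_bounded_finite) (simp add: C'_def)
    then show "integrable lborel (\<lambda>y. \<bar>B\<bar> * indicator C' y)"
      by (intro integrable_mult_right integrable_real_indicator) (auto simp: C'_def)
    fix t :: real and y assume t: "\<bar>t\<bar> < 1"
    show "\<bar>u (y + t *\<^sub>R v) - u (y + 0 *\<^sub>R v)\<bar> \<le> \<bar>t\<bar> * (\<bar>B\<bar> * indicator C' y)"
    proof (cases "y \<in> C'")
      case True
      have "norm (u (y + t *\<^sub>R v) - u (y + 0 *\<^sub>R v)) \<le> \<bar>B\<bar> * norm (t - 0)"
        by (rule field_differentiable_bound[where S=UNIV and f'="\<lambda>t. u' (y + t *\<^sub>R v) v"])
          (use line B' in auto)
      then show ?thesis using True by (simp add: mult.commute)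
    next
      case False
      then show ?thesis using out[OF False t] out[OF False, of 0] by simp
    qed
  qed (use trans in auto)
  then have "((\<lambda>t. integral\<^sup>L lborel u) has_real_derivative (\<integral>y. u' y v \<partial>lborel)) (at 0)"
    unfolding trans(2) .
  then show "(\<integral>y. u' y v \<partial>lborel) = 0" using DERIV_unique DERIV_const by blast
qed

subsection \<open>Bump functions\<close>

lemma C_1_compose_real:
  fixes f :: "'e::real_normed_vector \<Rightarrow> real"
  assumes "open S" "C_k_on (Suc 0) S f" "\<And>s. (\<phi> has_real_derivative \<phi>' s) (at s)" "continuous_on UNIV \<phi>'"
  shows "C_k_on (Suc 0) S (\<lambda>y. \<phi> (f y))"
proof (rule C_k_on_SucI[OF assms(1)])
  show "((\<lambda>y. \<phi> (f y)) has_derivative (\<lambda>v. \<phi>' (f y) * dd f y v)) (at y)" if "y \<in> S" for y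
    using has_derivative_compose_real[OF C_k_on_has_derivative[OF assms(2) that] assms(3)[unfolded has_field_derivative_def]] .
  show "C_k_on 0 S (\<lambda>y. \<phi>' (f y) * dd f y v)" for v
    using assms(2) C_k_on_imp_continuous_on[OF assms(2)]
    by (auto intro!: continuous_intros continuous_on_compose2[OF assms(4)])
qed

lemma C_1_compose:
  fixes f :: "real^2 \<Rightarrow> real"
  assumes "open S" "C_k_on (Suc 0) T f" "C_k_on (Suc 0) S g" "\<And>y. y \<in> S \<Longrightarrow> g y \<in> T"
  shows "C_k_on (Suc 0) S (\<lambda>y. f (g y))"
proof (rule C_k_on_SucI[OF assms(1)])
  let ?Df = "\<lambda>y. dd f y" and ?Dg = "\<lambda>y. dd g y"
  show "((\<lambda>y. f (g y)) has_derivative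
      (\<lambda>v. ?Dg y v$1 * ?Df (g y) ex1 + ?Dg y v$2 * ?Df (g y) ex2)) (at y)" if "y \<in> S" for y
  proof -
    have D: "(f has_derivative ?Df (g y)) (at (g y))" by (rule C_k_on_has_derivative[OF assms(2) assms(4)[OF that]])
    have "((\<lambda>y. f (g y)) has_derivative (\<lambda>v. ?Df (g y) (?Dg y v))) (at y)"
      by (rule has_derivative_compose_real[OF C_k_on_has_derivative[OF assms(3) that] D])
    moreover have "?Df (g y) (?Dg y v) = ?Dg y v$1 * ?Df (g y) ex1 + ?Dg y v$2 * ?Df (g y) ex2" for v
      using linear_real2[OF has_derivative_linear[OF D], of "?Dg y v"] by simp
    ultimately show ?thesis by simp
  qed
  have "continuous_on S (\<lambda>y. ?Df (g y) e)" for e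
    using assms(2) by (intro continuous_on_compose2[OF _ C_k_on_imp_continuous_on[OF assms(3)], of T]) (use assms(4) in auto)
  then show "C_k_on 0 S (\<lambda>y. ?Dg y v$1 * ?Df (g y) ex1 + ?Dg y v$2 * ?Df (g y) ex2)" for v
    using assms(3) by (auto intro!: continuous_intros)
qed

text \<open>A parabola glued to zero: continuously differentiable but no more, which suffices
  because test functions are differentiated only once.\<close>

definition pos_square :: "real \<Rightarrow> real" where "pos_square s = (max 0 s)\<^sup>2"

lemma pos_square_derivative: "(pos_square has_real_derivative 2 * max 0 s) (at s)"
proof -
  consider "s > 0" | "s < 0" | "s = 0" by linarith
  then show ?thesis
  proof cases
    case 1
    have "((\<lambda>s. s\<^sup>2) has_real_derivative 2 * max 0 s) (at s)" using 1 by (auto intro!: derivative_eq_intros)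
    then show ?thesis
      by (rule has_field_derivative_transform_within_open[of _ _ _ "{0<..}"]) (use 1 in \<open>auto simp: pos_square_def\<close>)
  next
    case 2
    have "((\<lambda>s. 0) has_real_derivative 2 * max 0 s) (at s)" using 2 by (auto intro!: derivative_eq_intros)
    then show ?thesis
      by (rule has_field_derivative_transform_within_open[of _ _ _ "{..<0}"]) (use 2 in \<open>auto simp: pos_square_def\<close>)
  next
    case 3
    have "((\<lambda>h. pos_square h / h) \<longlongrightarrow> 0) (at 0)"
    proof (rule Lim_null_comparison)
      show "\<forall>\<^sub>F h in at 0. norm (pos_square h / h) \<le> \<bar>h\<bar>"
        by (auto simp: pos_square_def power2_eq_square max_def eventually_at_filter)
      show "((\<lambda>h::real. \<bar>h\<bar>) \<longlongrightarrow> 0) (at 0)" by (auto intro!: tendsto_eq_intros)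
    qed
    then show ?thesis using 3 by (simp add: DERIV_def pos_square_def)
  qed
qed

lemma C_1_pos_square:
  "open S \<Longrightarrow> C_k_on (Suc 0) S f \<Longrightarrow> C_k_on (Suc 0) S (\<lambda>y. pos_square (f y))"
  by (rule C_1_compose_real[OF _ _ pos_square_derivative]) (auto intro!: continuous_intros)

text \<open>The inner truncation vanishes up to distance \<open>r\<close> and is at least 3^2 > 1
  from distance \<open>2 * r\<close> on; the outer one is therefore 1 and 0 there.\<close>

definition bump :: "real^2 \<Rightarrow> real \<Rightarrow> real^2 \<Rightarrow> real" where
  "bump y0 r y = pos_square (1 - pos_square ((y - y0) \<bullet> (y - y0) / r\<^sup>2 - 1))"

lemma bump_eq_1: "r > 0 \<Longrightarrow> y \<in> cball y0 r \<Longrightarrow> bump y0 r y = 1"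
proof -
  assume r: "r > 0" "y \<in> cball y0 r"
  then have "(norm (y - y0))\<^sup>2 \<le> r\<^sup>2" by (intro power_mono) (auto simp: dist_norm norm_minus_commute)
  then have "(y - y0) \<bullet> (y - y0) / r\<^sup>2 \<le> 1" using r by (simp add: power2_norm_eq_inner)
  then show ?thesis by (simp add: bump_def pos_square_def max_def)
qed

lemma bump_eq_0: "r > 0 \<Longrightarrow> y \<notin> cball y0 (2 * r) \<Longrightarrow> bump y0 r y = 0"
proof -
  assume r: "r > 0" "y \<notin> cball y0 (2 * r)"
  then have "(2 * r)\<^sup>2 \<le> (norm (y - y0))\<^sup>2" by (intro power_mono) (auto simp: dist_norm norm_minus_commute)
  then have "4 \<le> (y - y0) \<bullet> (y - y0) / r\<^sup>2" using r unfolding power2_norm_eq_inner by (simp add: power2_eq_square field_simps)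
  then have "3 \<le> (y - y0) \<bullet> (y - y0) / r\<^sup>2 - 1" by simp
  then have "3\<^sup>2 \<le> (max 0 ((y - y0) \<bullet> (y - y0) / r\<^sup>2 - 1))\<^sup>2" by (intro power_mono) auto
  then show ?thesis by (simp add: bump_def pos_square_def max_def)
qed

lemma C_1_bump: "C_k_on (Suc 0) UNIV (bump y0 r)"
proof -
  have sq: "smooth_on UNIV (\<lambda>y. (y - y0) \<bullet> (y - y0) / r\<^sup>2 - 1)"
    unfolding divide_inverse by (intro smooth_intros open_UNIV) (simp_all add: smooth_on_def C_k_on_linear)
  have 1: "C_k_on (Suc 0) UNIV (\<lambda>y. 1 + (- 1) *\<^sub>R pos_square ((y - y0) \<bullet> (y - y0) / r\<^sup>2 - 1))"
    by (intro C_k_on_add C_k_on_const C_k_on_compose_linear[OF _ bounded_linear_scaleR_right] C_1_pos_square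
        open_UNIV smooth_on_imp_C_k[OF sq])
  show ?thesis unfolding bump_def[abs_def] using C_1_pos_square[OF open_UNIV 1] by simp
qed

context atlas_surface begin

definition C1_map :: "('a \<Rightarrow> real) \<Rightarrow> bool" where
  "C1_map f \<longleftrightarrow> (\<forall>c\<in>A. C_k_on (Suc 0) (cimg c) (f \<circ> chart_inv c))"

lemma C1_map_const: "C1_map (\<lambda>p. k)"
  by (simp add: C1_map_def o_def)

lemma C1_map_mult: "C1_map f \<Longrightarrow> C1_map g \<Longrightarrow> C1_map (\<lambda>p. f p * g p)"
  unfolding C1_map_def o_def using C_k_on_bilinear[OF open_img bounded_bilinear_mult] by blast

lemma C1_map_diff:
  assumes "C1_map f" "C1_map g"
  shows "C1_map (\<lambda>p. f p - g p)"
  unfolding C1_map_def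
proof
  fix c assume c: "c \<in> A"
  have "C_k_on (Suc 0) (cimg c) (\<lambda>y. (f \<circ> chart_inv c) y + (- 1) *\<^sub>R (g \<circ> chart_inv c) y)"
    using assms c unfolding C1_map_def
    by (intro C_k_on_add C_k_on_compose_linear[OF _ bounded_linear_scaleR_right] open_img) blast+
  then show "C_k_on (Suc 0) (cimg c) ((\<lambda>p. f p - g p) \<circ> chart_inv c)" by (simp add: o_def)
qed

lemma C1_map_has_derivative:
  "C1_map f \<Longrightarrow> c \<in> A \<Longrightarrow> y \<in> cimg c \<Longrightarrow> (f \<circ> chart_inv c has_derivative dmap c f (chart_inv c y)) (at y)"
  unfolding dmap_def C1_map_def using C_k_on_has_derivative[of 0 "cimg c" "f \<circ> chart_inv c" y] by simp

lemma C1_map_continuous_derivative: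
  "C1_map f \<Longrightarrow> c \<in> A \<Longrightarrow> continuous_on (cimg c) (\<lambda>y. dmap c f (chart_inv c y) v)"
proof -
  assume f: "C1_map f" and c: "c \<in> A"
  have "continuous_on (cimg c) (\<lambda>y. dd (f \<circ> chart_inv c) y v)"
    using f c by (auto simp: C1_map_def)
  then show ?thesis
    by (rule continuous_on_eq) (use c in \<open>simp add: dmap_def\<close>)
qed

lemma continuous_on_chartwise:
  fixes f :: "'a \<Rightarrow> 'f::topological_space"
  assumes "\<And>c. c \<in> A \<Longrightarrow> continuous_on (cimg c) (f \<circ> chart_inv c)"
  shows "continuous_on UNIV f"
proof -
  have "continuous_on (cdom c) f" if c: "c \<in> A" for c
  proof -
    have "continuous_on (cdom c) ((f \<circ> chart_inv c) \<circ> snd c)"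
      by (rule continuous_on_compose[OF continuous_chart[OF c] assms[OF c]])
    then show ?thesis by (rule continuous_on_eq) (use c in simp)
  qed
  then have "continuous_on (\<Union>c\<in>A. cdom c) f" by (intro continuous_on_open_UN) (use open_dom in auto)
  moreover have "(\<Union>c\<in>A. cdom c) = UNIV" using dom_cover by blast
  ultimately show ?thesis by simp
qed

lemma C1_map_continuous: "C1_map f \<Longrightarrow> continuous_on UNIV f"
  by (rule continuous_on_chartwise, rule C_k_on_imp_continuous_on[of "Suc 0"])
    (simp add: C1_map_def del: C_k_on.simps)

definition chart_bump :: "'a chart \<Rightarrow> real^2 \<Rightarrow> real \<Rightarrow> 'a \<Rightarrow> real" where
  "chart_bump c y0 r p = (if p \<in> cdom c then bump y0 r (snd c p) else 0)"

lemma chart_bump_outside: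
  assumes "c \<in> A" "r > 0" "p \<notin> chart_inv c ` cball y0 (2 * r)"
  shows "chart_bump c y0 r p = 0"
proof (cases "p \<in> cdom c")
  case True
  then have "snd c p \<notin> cball y0 (2 * r)" using assms by (metis chart_inv_chart image_eqI)
  then show ?thesis using True assms bump_eq_0 by (simp add: chart_bump_def)
qed (simp add: chart_bump_def)

lemma compact_chart_ball:
  assumes "c \<in> A" "cball y0 r \<subseteq> cimg c"
  shows "compact (chart_inv c ` cball y0 r)"
  using continuous_on_subset[OF continuous_chart_inv assms(2)] assms(1)
  by (intro compact_continuous_image) auto

text \<open>Extension by zero stays C^1 because the bump vanishes off the image of a closed ball,
  which is compact and hence closed in a Hausdorff space: \<open>cdom c\<close> and the complement
  of that image form an open cover.\<close>

lemma C1_map_chart_bump: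
  assumes c: "c \<in> A" and r: "r > 0" "cball y0 (2 * r) \<subseteq> cimg c"
  shows "C1_map (chart_bump c y0 r)"
  unfolding C1_map_def
proof
  fix d assume d: "d \<in> A"
  let ?S = "chart_inv c ` cball y0 (2 * r)"
  have S: "closed ?S" by (rule compact_imp_closed[OF compact_chart_ball[OF c r(2)]])
  define W where "W = (\<lambda>i::bool. if i then snd d ` (cdom d \<inter> cdom c) else {y \<in> cimg d. chart_inv d y \<in> - ?S})"
  have "C_k_on (Suc 0) (\<Union>i\<in>UNIV. W i) (chart_bump c y0 r \<circ> chart_inv d)"
  proof (rule C_k_on_Union)
    fix i :: bool
    show o: "open (W i)"
      unfolding W_def using open_overlap[OF d c] open_chart_inv_preimage[OF d, of "- ?S"] S by auto
    show "C_k_on (Suc 0) (W i) (chart_bump c y0 r \<circ> chart_inv d)"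
    proof (cases i)
      case True
      have "C_k_on (Suc 0) (W i) (\<lambda>y. bump y0 r ((snd c \<circ> chart_inv d) y))"
        by (rule C_1_compose[OF o C_1_bump])
          (use True smooth_on_imp_C_k[OF smooth_transition[OF d c]] in \<open>simp_all add: W_def o_def del: C_k_on.simps\<close>)
      then show ?thesis
        by (rule C_k_on_cong[OF o, rotated]) (use True d in \<open>auto simp: W_def chart_bump_def\<close>)
    next
      case False
      show ?thesis
        by (rule C_k_on_cong[OF o _ C_k_on_const[of _ _ 0]])
          (use False chart_bump_outside[OF c r(1)] in \<open>auto simp: W_def\<close>)
    qed
  qed
  moreover have "(\<Union>i\<in>UNIV. W i) = cimg d"
  proof -
    have "?S \<subseteq> cdom c" using c r(2) by auto
    then have "y \<in> W True \<or> y \<in> W False" if "y \<in> cimg d" for y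
      using that overlap_image[OF d, of c] by (auto simp: W_def)
    moreover have "W i \<subseteq> cimg d" for i by (auto simp: W_def)
    moreover have "(\<Union>i\<in>UNIV. W i) = W False \<union> W True" unfolding UNIV_bool by simp
    ultimately show ?thesis by blast
  qed
  ultimately show "C_k_on (Suc 0) (cimg d) (chart_bump c y0 r \<circ> chart_inv d)" by simp
qed

end

subsection \<open>The first variation of the Laguerre area\<close>

text \<open>Cramer's rule for \<open>d\<close> in terms of \<open>a\<close>, \<open>b\<close>,
  \<open>c\<close>, cleared of its denominator.\<close>

lemma tp_cramer: "tp a b c *\<^sub>R d = tp d b c *\<^sub>R a + tp a d c *\<^sub>R b + tp a b d *\<^sub>R c"
  by (simp add: vec_eq_iff forall_3 tp_def algebra_simps)

text \<open>Evaluates the difference between the variation of the Laguerre density and the exterior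
  derivative of the one-form \<open>tp n (V + r W) (dx + r dn) + (V \<bullet> n) \<eta>\<close>: it vanishes if \<open>r\<close> is the mean
  curvature radius and \<open>\<eta>\<close> is conjugate to \<open>dr\<close>.\<close>

lemma variation_algebra:
  fixes n n1 n2 x1 x2 V W V1 V2 :: "real^3"
  assumes n: "n \<bullet> n = 1" "n \<bullet> n1 = 0" "n \<bullet> n2 = 0" "n \<bullet> x1 = 0" "n \<bullet> x2 = 0" "n \<bullet> W = 0"
    and V: "V1 \<bullet> n + x1 \<bullet> W = 0" "V2 \<bullet> n + x2 \<bullet> W = 0" and sym: "x1 \<bullet> n2 = x2 \<bullet> n1"
    and D0: "tp n n1 n2 \<noteq> 0"
    and mean: "tp n x1 n2 + tp n n1 x2 = - 2 * r * tp n n1 n2"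
    and conj: "tp n n1 n2 * h1 = (n1 \<bullet> n1) * r2 - (n1 \<bullet> n2) * r1"
      "tp n n1 n2 * h2 = (n1 \<bullet> n2) * r2 - (n2 \<bullet> n2) * r1"
  shows "tp n1 (V + r *\<^sub>R W) (x2 + r *\<^sub>R n2) - tp n2 (V + r *\<^sub>R W) (x1 + r *\<^sub>R n1)
     + r1 * tp n W (x2 + r *\<^sub>R n2) - r2 * tp n W (x1 + r *\<^sub>R n1)
     + r1 * tp n (V + r *\<^sub>R W) n2 - r2 * tp n (V + r *\<^sub>R W) n1
     + (V1 \<bullet> n + V \<bullet> n1) * h2 - (V2 \<bullet> n + V \<bullet> n2) * h1 = 0"
proof -
  define Y where "Y = V + r *\<^sub>R W"
  define s1 s2 where "s1 = x1 + r *\<^sub>R n1" and "s2 = x2 + r *\<^sub>R n2"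
  define D where "D = tp n n1 n2"
  have s: "n \<bullet> s1 = 0" "n \<bullet> s2 = 0" using n by (simp_all add: s1_def s2_def inner_add_right)
  have ssym: "s1 \<bullet> n2 = s2 \<bullet> n1" using sym by (simp add: s1_def s2_def inner_add_left inner_add_right inner_commute)
  have anti: "tp n b a = - tp n a b" "tp a n b = - tp n a b" for a b by (simp_all add: tp_def algebra_simps)
  have tr: "tp n s1 n2 + tp n n1 s2 = 0" using mean by (simp add: s1_def s2_def)
  define u where "u = Y \<bullet> n"
  \<comment> \<open>Split \<open>Y\<close> into its normal and tangential parts. Three tangential
    vectors have triple product zero, and the normal part multiplies
    \<open>tp n s1 n2 + tp n n1 s2\<close>, which vanishes because \<open>r\<close> is the mean
    radius.\<close>
  have first: "tp n1 Y s2 - tp n2 Y s1 = 0"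
  proof -
    define Z where "Z = Y - u *\<^sub>R n"
    have Z: "n \<bullet> Z = 0" using n(1) by (simp add: Z_def inner_diff_right u_def inner_commute)
    have Y: "Y = u *\<^sub>R n + Z" by (simp add: Z_def)
    have "tp n1 Z s2 = 0" "tp n2 Z s1 = 0" using tp_tangential[OF n(1)] n s Z by auto
    then have "tp n1 Y s2 - tp n2 Y s1 = - u * (tp n s1 n2 + tp n n1 s2)"
      unfolding Y using anti(2)[of n1 s2] anti(2)[of n2 s1] anti(1)[of s1 n2] by (simp add: algebra_simps)
    then show ?thesis using tr by simp
  qed
  note gram = tp_gram[OF n(1)]
  define E F G where "E = n1 \<bullet> n1" and "F = n1 \<bullet> n2" and "G = n2 \<bullet> n2"
  define a b d where "a = s1 \<bullet> n1" and "b = s1 \<bullet> n2" and "d = s2 \<bullet> n2"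
  define w1 w2 where "w1 = W \<bullet> n1" and "w2 = W \<bullet> n2"
  have b': "s2 \<bullet> n1 = b" using ssym by (simp add: b_def)
  have DD: "D * D = E * G - F * F"
    using gram[OF n(2,3), of n1 n2] by (simp add: D_def E_def F_def G_def inner_commute)
  \<comment> \<open>The same trace condition in inner products: the symmetric form with entries
    \<open>a\<close>, \<open>b\<close>, \<open>d\<close> contracted with the adjugate of the Gram
    matrix of \<open>n1\<close>, \<open>n2\<close>.\<close>
  have trace: "a * G - 2 * b * F + d * E = 0"
  proof -
    have "tp n s1 n2 * D = a * G - b * F"
      using gram[OF n(2,3), of s1 n2] by (simp add: D_def a_def b_def F_def G_def inner_commute)
    moreover have "tp n n1 s2 * D = E * d - F * b"
      using gram[OF n(2,3), of n1 s2] b' by (simp add: D_def E_def d_def F_def inner_commute)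
    moreover have "(tp n s1 n2 + tp n n1 s2) * D = 0" using tr by simp
    ultimately show ?thesis by (simp add: algebra_simps)
  qed
  \<comment> \<open>Expands the tangential vector \<open>W\<close> in the basis \<open>n1\<close>,
    \<open>n2\<close>, with denominators cleared by \<open>D * D\<close>.\<close>
  have sW: "D * D * (v \<bullet> W) = (w1 * G - w2 * F) * (v \<bullet> n1) + (E * w2 - F * w1) * (v \<bullet> n2)" if "n \<bullet> v = 0" for v
  proof -
    have "D *\<^sub>R W = tp n W n2 *\<^sub>R n1 + tp n n1 W *\<^sub>R n2"
      using tp_cramer[of n n1 n2 W] tp_tangential[OF n(1,6,2,3)] by (simp add: D_def)
    then have "D * (v \<bullet> W) = tp n W n2 * (v \<bullet> n1) + tp n n1 W * (v \<bullet> n2)"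
      by (metis inner_add_right inner_scaleR_right)
    moreover have "tp n W n2 * D = w1 * G - w2 * F" "tp n n1 W * D = E * w2 - F * w1"
      using gram[OF n(2,3), of W n2] gram[OF n(2,3), of n1 W]
      by (simp_all add: D_def w1_def w2_def E_def F_def G_def inner_commute)
    ultimately show ?thesis by (metis (no_types, opaque_lifting) distrib_right mult.assoc mult.commute)
  qed
  have D0': "D * D \<noteq> 0" using D0 by (simp add: D_def)
  \<comment> \<open>Up to sign, \<open>c1\<close> and \<open>c2\<close> are the coefficients of
    \<open>r1\<close> and \<open>r2\<close> in the final sum; after inserting \<open>sW\<close> each
    becomes a multiple of the trace relation.\<close>
  have c1: "w1 * d - w2 * b + G * (s1 \<bullet> W) - F * (s2 \<bullet> W) = 0"
  proof -
    have "D * D * (w1 * d - w2 * b + G * (s1 \<bullet> W) - F * (s2 \<bullet> W)) =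
       D * D * (w1 * d - w2 * b) + G * (D * D * (s1 \<bullet> W)) - F * (D * D * (s2 \<bullet> W))" by (simp add: algebra_simps)
    also have "\<dots> = (w1 * G - w2 * F) * (a * G - 2 * b * F + d * E)"
      unfolding sW[OF s(1)] sW[OF s(2)] a_def[symmetric] b_def[symmetric] b' d_def[symmetric] unfolding DD
      by (simp add: algebra_simps)
    finally show ?thesis using trace D0' by simp
  qed
  have c2: "w1 * b - w2 * a + F * (s1 \<bullet> W) - E * (s2 \<bullet> W) = 0"
  proof -
    have "D * D * (w1 * b - w2 * a + F * (s1 \<bullet> W) - E * (s2 \<bullet> W)) =
       D * D * (w1 * b - w2 * a) + F * (D * D * (s1 \<bullet> W)) - E * (D * D * (s2 \<bullet> W))" by (simp add: algebra_simps)
    also have "\<dots> = (w1 * F - w2 * E) * (a * G - 2 * b * F + d * E)"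
      unfolding sW[OF s(1)] sW[OF s(2)] a_def[symmetric] b_def[symmetric] b' d_def[symmetric] unfolding DD
      by (simp add: algebra_simps)
    finally show ?thesis using trace D0' by simp
  qed
  \<comment> \<open>The partial derivatives of V \<bullet> n. The linearised contact condition
    trades \<open>V1 \<bullet> n\<close> for \<open>- (x1 \<bullet> W)\<close>, so no derivative of
    \<open>V\<close> remains.\<close>
  define u1 u2 where "u1 = V1 \<bullet> n + V \<bullet> n1" and "u2 = V2 \<bullet> n + V \<bullet> n2"
  have u: "u1 = Y \<bullet> n1 - s1 \<bullet> W" "u2 = Y \<bullet> n2 - s2 \<bullet> W"
    using V by (simp_all add: u1_def u2_def Y_def s1_def s2_def inner_add_left inner_add_right inner_commute)
  have "D * (r1 * tp n W s2 - r2 * tp n W s1 + r1 * tp n Y n2 - r2 * tp n Y n1 + u1 * h2 - u2 * h1) =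
     r1 * (tp n W s2 * D) - r2 * (tp n W s1 * D) + r1 * (tp n Y n2 * D) - r2 * (tp n Y n1 * D)
     + u1 * (D * h2) - u2 * (D * h1)" by (simp add: algebra_simps)
  also have "\<dots> = r1 * (w1 * d - w2 * b) - r2 * (w1 * b - w2 * a)
     + r1 * ((Y \<bullet> n1) * G - (Y \<bullet> n2) * F) - r2 * ((Y \<bullet> n1) * F - (Y \<bullet> n2) * E)
     + u1 * (F * r2 - G * r1) - u2 * (E * r2 - F * r1)"
  proof -
    have "tp n W s2 * D = w1 * d - w2 * b" "tp n W s1 * D = w1 * b - w2 * a"
      using gram[OF n(2,3), of W s2] gram[OF n(2,3), of W s1] b'
      by (simp_all add: D_def w1_def w2_def a_def b_def d_def)
    moreover have "tp n Y n2 * D = (Y \<bullet> n1) * G - (Y \<bullet> n2) * F" "tp n Y n1 * D = (Y \<bullet> n1) * F - (Y \<bullet> n2) * E"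
      using gram[OF n(2,3), of Y n2] gram[OF n(2,3), of Y n1]
      by (simp_all add: D_def E_def F_def G_def inner_commute)
    ultimately show ?thesis using conj by (simp add: D_def E_def F_def G_def)
  qed
  also have "\<dots> = r1 * (w1 * d - w2 * b + G * (s1 \<bullet> W) - F * (s2 \<bullet> W))
     - r2 * (w1 * b - w2 * a + F * (s1 \<bullet> W) - E * (s2 \<bullet> W))"
    unfolding u by (simp add: algebra_simps)
  also have "\<dots> = 0" unfolding c1 c2 by simp
  finally have "r1 * tp n W s2 - r2 * tp n W s1 + r1 * tp n Y n2 - r2 * tp n Y n1 + u1 * h2 - u2 * h1 = 0"
    using D0' by simp
  with first show ?thesis
    unfolding Y_def[symmetric] s1_def[symmetric] s2_def[symmetric] u1_def[symmetric] u2_def[symmetric] by linarith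
qed

lemma has_derivative_tp:
  assumes "(a has_derivative a') (at y)" "(b has_derivative b') (at y)" "(c has_derivative c') (at y)"
  shows "((\<lambda>y. tp (a y) (b y) (c y)) has_derivative
     (\<lambda>v. tp (a' v) (b y) (c y) + tp (a y) (b' v) (c y) + tp (a y) (b y) (c' v))) (at y)"
proof -
  note nth = bounded_linear.has_derivative[OF bounded_linear_vec_nth]
  show ?thesis
    unfolding tp_def
    by (rule has_derivative_eq_rhs, (rule has_derivative_add has_derivative_diff has_derivative_mult nth assms)+)
      (simp add: fun_eq_iff algebra_simps)
qed

lemma smooth_on_tp:
  "open S \<Longrightarrow> smooth_on S a \<Longrightarrow> smooth_on S b \<Longrightarrow> smooth_on S c \<Longrightarrow> smooth_on S (\<lambda>y. tp (a y) (b y) (c y))"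
  unfolding tp_def by (intro smooth_intros)

lemma smooth_on_slice:
  fixes G :: "real \<times> 'b::real_normed_vector \<Rightarrow> 'c::real_normed_vector"
  assumes G: "smooth_on (I \<times> V) G" and o: "open I" "open V" and t: "t \<in> I"
  shows "smooth_on V (\<lambda>y. G (t, y))"
    "\<And>y. y \<in> V \<Longrightarrow> ((\<lambda>y. G (t, y)) has_derivative (\<lambda>v. dd G (t, y) (0, v))) (at y)"
    "\<And>y. y \<in> V \<Longrightarrow> ((\<lambda>t. G (t, y)) has_derivative (\<lambda>s. dd G (t, y) (s, 0))) (at t)"
proof -
  have b: "bounded_linear (\<lambda>y::'b. (0::real, y))"
    by (rule bounded_linear_Pair[OF bounded_linear_zero bounded_linear_ident])
  show "smooth_on V (\<lambda>y. G (t, y))"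
    using smooth_on_affine[OF open_Times[OF o] o(2) b, of "(t, 0)" G] G t by simp
  fix y assume y: "y \<in> V"
  have D: "(G has_derivative dd G (t, y)) (at (t, y))"
    by (rule smooth_on_has_derivative[OF G]) (use t y in simp)
  have 1: "((\<lambda>y. (t, y)) has_derivative (\<lambda>v. (0, v))) (at y)" and 2: "((\<lambda>t. (t, y)) has_derivative (\<lambda>s. (s, 0))) (at t)"
    by (auto intro!: derivative_eq_intros)
  show "((\<lambda>y. G (t, y)) has_derivative (\<lambda>v. dd G (t, y) (0, v))) (at y)"
    using diff_chain_at[OF 1 D] by (simp add: o_def)
  show "((\<lambda>t. G (t, y)) has_derivative (\<lambda>s. dd G (t, y) (s, 0))) (at t)"
    using diff_chain_at[OF 2 D] by (simp add: o_def)
qed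

context atlas_surface begin

text \<open>\<open>r\<close> is the mean curvature radius of \<open>f\<close>, and \<open>\<eta>\<close> is a closed one-form, conjugate to \<open>dr\<close> with
  respect to the third fundamental form; its existence says that \<open>r\<close> is harmonic.\<close>

definition conjugate_radius :: "'a contact_map \<Rightarrow> ('a \<Rightarrow> real) \<Rightarrow> ('a chart \<Rightarrow> 'a \<Rightarrow> real^2 \<Rightarrow> real) \<Rightarrow> bool" where
  "conjugate_radius f r \<eta> \<longleftrightarrow> smooth_map A r \<and>
     (\<forall>c\<in>A. \<forall>p\<in>cdom c. linear (\<eta> c p)) \<and>
     (\<forall>c\<in>A. \<forall>d\<in>A. \<forall>p\<in>cdom c \<inter> cdom d. \<forall>v. \<eta> c p v = \<eta> d p (dmap c (snd d) p v)) \<and>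
     (\<forall>c\<in>A. \<forall>v. smooth_on (cimg c) (\<lambda>y. \<eta> c (chart_inv c y) v)) \<and>
     (\<forall>c\<in>A. \<forall>y\<in>cimg c. dd (\<lambda>y. \<eta> c (chart_inv c y) ex2) y ex1 =
        dd (\<lambda>y. \<eta> c (chart_inv c y) ex1) y ex2) \<and>
     (\<forall>c\<in>A. \<forall>p\<in>cdom c. lag_B c f p = - 2 * r p * lag_D c f p \<and>
        lag_D c f p * \<eta> c p ex1 = (dmap c (snd \<circ> f) p ex1 \<bullet> dmap c (snd \<circ> f) p ex1) * dmap c r p ex2
          - (dmap c (snd \<circ> f) p ex1 \<bullet> dmap c (snd \<circ> f) p ex2) * dmap c r p ex1 \<and>
        lag_D c f p * \<eta> c p ex2 = (dmap c (snd \<circ> f) p ex1 \<bullet> dmap c (snd \<circ> f) p ex2) * dmap c r p ex2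
          - (dmap c (snd \<circ> f) p ex2 \<bullet> dmap c (snd \<circ> f) p ex2) * dmap c r p ex1)"

end

locale laguerre_first_variation = atlas_surface A
  for A :: "'a::{t2_space,second_countable_topology} chart set" +
  fixes f r \<eta> \<epsilon> K F
  assumes surf: "laguerre_surface A f" and umb: "umbilical_free A f"
    and conj: "conjugate_radius f r \<eta>" and var: "laguerre_variation A f \<epsilon> K F"
begin

abbreviation "I \<equiv> {-\<epsilon><..<\<epsilon>}"

lemma eps_pos: "\<epsilon> > 0" and compact_K: "compact K" and F0: "F 0 = f"
  and surf_F: "t \<in> I \<Longrightarrow> laguerre_surface A (F t)" and umb_F: "t \<in> I \<Longrightarrow> umbilical_free A (F t)"
  and F_off: "t \<in> I \<Longrightarrow> p \<notin> K \<Longrightarrow> F t p = f p"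
  using var unfolding laguerre_variation_def by blast+

lemma zero_I: "0 \<in> I" using eps_pos by simp

text \<open>Time and coordinates are joined in one argument so that the exchange of time and space
  derivatives is an instance of the symmetry of second derivatives.\<close>

definition cX :: "'a chart \<Rightarrow> real \<times> (real^2) \<Rightarrow> real^3" where "cX c z = fst (F (fst z) (chart_inv c (snd z)))"
definition cN :: "'a chart \<Rightarrow> real \<times> (real^2) \<Rightarrow> real^3" where "cN c z = snd (F (fst z) (chart_inv c (snd z)))"

lemma open_domain: "c \<in> A \<Longrightarrow> open (I \<times> cimg c)"
  by (intro open_Times open_img) auto

lemma smooth_cX: "c \<in> A \<Longrightarrow> smooth_on (I \<times> cimg c) (cX c)"
  and smooth_cN: "c \<in> A \<Longrightarrow> smooth_on (I \<times> cimg c) (cN c)"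
proof -
  assume c: "c \<in> A"
  have "smooth_on (I \<times> cimg c) (\<lambda>(t, y). F t (chart_inv c y))"
    using var c by (simp add: laguerre_variation_def)
  from smooth_on_compose_linear[OF open_domain[OF c] bounded_linear_fst this]
    smooth_on_compose_linear[OF open_domain[OF c] bounded_linear_snd this]
  show "smooth_on (I \<times> cimg c) (cX c)" "smooth_on (I \<times> cimg c) (cN c)"
    unfolding cX_def[abs_def] cN_def[abs_def] by (simp_all add: case_prod_beta)
qed

abbreviation "DX c z \<equiv> dd (cX c) z"
abbreviation "DN c z \<equiv> dd (cN c) z"

lemma dmap_F:
  assumes "c \<in> A" "t \<in> I" "y \<in> cimg c"
  shows "dmap c (fst \<circ> F t) (chart_inv c y) v = DX c (t, y) (0, v)"
    "dmap c (snd \<circ> F t) (chart_inv c y) v = DN c (t, y) (0, v)"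
proof -
  have e: "fst \<circ> F t \<circ> chart_inv c = (\<lambda>y. cX c (t, y))" "snd \<circ> F t \<circ> chart_inv c = (\<lambda>y. cN c (t, y))"
    by (auto simp: cX_def cN_def)
  note sl = smooth_on_slice(2)[OF _ _ open_img[OF assms(1)] assms(2,3)]
  show "dmap c (fst \<circ> F t) (chart_inv c y) v = DX c (t, y) (0, v)"
    unfolding dmap_def e chart_chart_inv[OF assms(1,3)]
    using fun_cong[OF frechet_derivative_at[OF sl[OF smooth_cX[OF assms(1)]]], of v] by simp
  show "dmap c (snd \<circ> F t) (chart_inv c y) v = DN c (t, y) (0, v)"
    unfolding dmap_def e chart_chart_inv[OF assms(1,3)]
    using fun_cong[OF frechet_derivative_at[OF sl[OF smooth_cN[OF assms(1)]]], of v] by simp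
qed

definition cD :: "'a chart \<Rightarrow> real \<times> (real^2) \<Rightarrow> real" where
  "cD c z = tp (cN c z) (DN c z (0, ex1)) (DN c z (0, ex2))"
definition cB :: "'a chart \<Rightarrow> real \<times> (real^2) \<Rightarrow> real" where
  "cB c z = tp (cN c z) (DX c z (0, ex1)) (DN c z (0, ex2)) + tp (cN c z) (DN c z (0, ex1)) (DX c z (0, ex2))"
definition cC :: "'a chart \<Rightarrow> real \<times> (real^2) \<Rightarrow> real" where
  "cC c z = tp (cN c z) (DX c z (0, ex1)) (DX c z (0, ex2))"
definition cM :: "'a chart \<Rightarrow> real \<times> (real^2) \<Rightarrow> real" where
  "cM c z = (cB c z)\<^sup>2 / (2 * cD c z) - 2 * cC c z"

lemma lag_F:
  assumes "c \<in> A" "t \<in> I" "y \<in> cimg c"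
  shows "lag_D c (F t) (chart_inv c y) = cD c (t, y)" "lag_B c (F t) (chart_inv c y) = cB c (t, y)"
    "lag_M c (F t) (chart_inv c y) = cM c (t, y)"
  unfolding lag_M_def lag_D_def lag_B_def lag_C_def cM_def cD_def cB_def cC_def dmap_F[OF assms]
  by (simp_all add: cN_def)

lemma cD_nonzero: "c \<in> A \<Longrightarrow> z \<in> I \<times> cimg c \<Longrightarrow> cD c z \<noteq> 0"
  using laguerre_density(1)[OF surf_F, of "fst z" c "chart_inv c (snd z)"] lag_F(1)[of c "fst z" "snd z"]
  by (auto simp: mem_Times_iff)

lemma cM_nonzero: "c \<in> A \<Longrightarrow> z \<in> I \<times> cimg c \<Longrightarrow> cM c z \<noteq> 0"
  using lag_M_nonzero[OF surf_F umb_F, of "fst z" c "chart_inv c (snd z)"] lag_F(3)[of c "fst z" "snd z"]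
  by (auto simp: mem_Times_iff)

lemma smooth_cM: "c \<in> A \<Longrightarrow> smooth_on (I \<times> cimg c) (cM c)"
  unfolding cM_def[abs_def] power2_eq_square
proof (intro smooth_intros open_domain)
  assume c: "c \<in> A"
  note * = smooth_on_tp smooth_on_add smooth_on_derivative open_domain[OF c] smooth_cN[OF c] smooth_cX[OF c]
  show "smooth_on (I \<times> cimg c) (cB c)" "smooth_on (I \<times> cimg c) (cB c)"
    unfolding cB_def[abs_def] by (intro *)+
  show "smooth_on (I \<times> cimg c) (cD c)" unfolding cD_def[abs_def] by (intro *)
  show "smooth_on (I \<times> cimg c) (cC c)" unfolding cC_def[abs_def] by (intro *)
  show "2 * cD c z \<noteq> 0" if "z \<in> I \<times> cimg c" for z using cD_nonzero[OF c that] by simp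
qed

text \<open>Taken pointwise on the surface, so that the variation fields V and W do not refer to any
  chart.\<close>

definition var_x :: "'a \<Rightarrow> real^3" where "var_x p = vector_derivative (\<lambda>t. fst (F t p)) (at 0)"
definition var_n :: "'a \<Rightarrow> real^3" where "var_n p = vector_derivative (\<lambda>t. snd (F t p)) (at 0)"

lemma var_chart:
  assumes c: "c \<in> A" and y: "y \<in> cimg c"
  shows "var_x (chart_inv c y) = DX c (0, y) (1, 0)" "var_n (chart_inv c y) = DN c (0, y) (1, 0)"
proof -
  have *: "vector_derivative (\<lambda>t. G (t, y)) (at 0) = dd G (0, y) (1, 0)"
    if "smooth_on (I \<times> cimg c) G" for G :: "real \<times> (real^2) \<Rightarrow> real^3"
  proof -
    have D: "((\<lambda>t. G (t, y)) has_derivative (\<lambda>s. dd G (0, y) (s, 0))) (at 0)"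
      by (rule smooth_on_slice(3)[OF that _ open_img[OF c] zero_I y]) simp
    have "dd G (0, y) (s, 0) = s *\<^sub>R dd G (0, y) (1, 0)" for s
      using linear_scale[OF has_derivative_linear[OF D], of s 1] by simp
    then have "(\<lambda>s. dd G (0, y) (s, 0)) = (\<lambda>s. s *\<^sub>R dd G (0, y) (1, 0))" by (rule ext)
    from D[unfolded this] show ?thesis
      by (intro vector_derivative_at) (simp only: has_vector_derivative_def)
  qed
  show "var_x (chart_inv c y) = DX c (0, y) (1, 0)" "var_n (chart_inv c y) = DN c (0, y) (1, 0)"
    unfolding *[OF smooth_cX[OF c], symmetric] *[OF smooth_cN[OF c], symmetric]
    by (simp_all add: var_x_def var_n_def cX_def cN_def)
qed

lemma var_off: "p \<notin> K \<Longrightarrow> var_x p = 0" "p \<notin> K \<Longrightarrow> var_n p = 0"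
proof -
  assume p: "p \<notin> K"
  have "((\<lambda>t. h (F t p)) has_vector_derivative 0) (at 0)" for h :: "(real^3) \<times> (real^3) \<Rightarrow> real^3"
    by (rule has_vector_derivative_transform_within_open[of "\<lambda>t. h (f p)" _ _ I])
      (use zero_I F_off p in \<open>auto intro!: derivative_eq_intros\<close>)
  then show "var_x p = 0" "var_n p = 0" unfolding var_x_def var_n_def by (simp_all add: vector_derivative_at)
qed

definition om :: "'a chart \<Rightarrow> 'a \<Rightarrow> real^2 \<Rightarrow> real" where
  "om c p v = tp (snd (f p)) (var_x p + r p *\<^sub>R var_n p)
       (dmap c (fst \<circ> f) p v + r p *\<^sub>R dmap c (snd \<circ> f) p v)
     + (var_x p \<bullet> snd (f p)) * \<eta> c p v"

lemma smooth_r: "smooth_map A r" using conj by (simp add: conjugate_radius_def)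

lemma om_chart:
  assumes c: "c \<in> A" and y: "y \<in> cimg c"
  shows "om c (chart_inv c y) v = tp (cN c (0, y)) (DX c (0, y) (1, 0) + r (chart_inv c y) *\<^sub>R DN c (0, y) (1, 0))
       (DX c (0, y) (0, v) + r (chart_inv c y) *\<^sub>R DN c (0, y) (0, v))
     + (DX c (0, y) (1, 0) \<bullet> cN c (0, y)) * \<eta> c (chart_inv c y) v"
  using dmap_F[OF c zero_I y] by (simp add: om_def var_chart[OF c y] F0 cN_def)

lemma smooth_om: "c \<in> A \<Longrightarrow> smooth_on (cimg c) (\<lambda>y. om c (chart_inv c y) v)"
proof -
  assume c: "c \<in> A"
  have sl: "smooth_on (cimg c) (\<lambda>y. G (0, y))" if "smooth_on (I \<times> cimg c) G" for G :: "_ \<Rightarrow> real^3"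
    by (rule smooth_on_slice(1)[OF that _ open_img[OF c] zero_I]) simp
  have r: "smooth_on (cimg c) (\<lambda>y. r (chart_inv c y))"
    using smooth_map_smooth_on[OF smooth_r c] by (simp add: o_def)
  have e: "smooth_on (cimg c) (\<lambda>y. \<eta> c (chart_inv c y) v)"
    using conj c by (simp add: conjugate_radius_def)
  have "smooth_on (cimg c) (\<lambda>y. tp (cN c (0, y)) (DX c (0, y) (1, 0) + r (chart_inv c y) *\<^sub>R DN c (0, y) (1, 0))
       (DX c (0, y) (0, v) + r (chart_inv c y) *\<^sub>R DN c (0, y) (0, v))
     + (DX c (0, y) (1, 0) \<bullet> cN c (0, y)) * \<eta> c (chart_inv c y) v)"
    by (intro smooth_on_add smooth_on_tp smooth_on_mult smooth_on_scaleR smooth_on_inner open_img[OF c] r e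
        sl[OF smooth_cN[OF c]] sl[OF smooth_on_derivative[OF smooth_cX[OF c]]] sl[OF smooth_on_derivative[OF smooth_cN[OF c]]])
  then show ?thesis
    by (rule smooth_on_cong[OF open_img[OF c], rotated]) (simp add: om_chart[OF c])
qed

text \<open>Both sides are -2 \<delta>, where \<delta> pairs d(V + r W) with dx' + r dn by the
  triple product with n, r being frozen. On the left this is the envelope computation; on the right
  the remaining terms of the exterior derivative cancel by \<open>variation_algebra\<close> and the
  closedness of \<open>\<eta>\<close>.\<close>

lemma first_variation:
  assumes c: "c \<in> A" and y: "y \<in> cimg c"
  shows "dd (cM c) (0, y) (1, 0) =
     - 2 * (dd (\<lambda>y. om c (chart_inv c y) ex2) y ex1
          - dd (\<lambda>y. om c (chart_inv c y) ex1) y ex2)"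
proof -
  let ?O = "I \<times> cimg c" and ?z = "(0::real, y)" and ?p = "chart_inv c y"
  have z: "?z \<in> ?O" using zero_I y by simp
  have p: "?p \<in> cdom c" using c y by simp
  note o = open_domain[OF c]
  note sX = smooth_cX[OF c] and sN = smooth_cN[OF c]
  define n V W where "n = cN c ?z" and "V = DX c ?z (1, 0)" and "W = DN c ?z (1, 0)"
  define xv nv where "xv = (\<lambda>v. DX c ?z (0, v))" and "nv = (\<lambda>v. DN c ?z (0, v))"
  define Vv Wv where "Vv = (\<lambda>v. dd (\<lambda>z. DX c z (0, v)) ?z (1, 0))"
    and "Wv = (\<lambda>v. dd (\<lambda>z. DN c z (0, v)) ?z (1, 0))"
  define xx nn where "xx = (\<lambda>v w. dd (\<lambda>z. DX c z (0, v)) ?z (0, w))"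
    and "nn = (\<lambda>v w. dd (\<lambda>z. DN c z (0, v)) ?z (0, w))"
  define \<rho> where "\<rho> = r ?p"
  define rv where "rv = (\<lambda>v. dmap c r ?p v)"
  define ev where "ev = (\<lambda>v. \<eta> c ?p v)"
  note dsX = smooth_on_derivative[OF sX] and dsN = smooth_on_derivative[OF sN]
  have symx: "xx v w = xx w v" "nn v w = nn w v" for v w
    unfolding xx_def nn_def
    using smooth_on_symmetric_derivative[OF o sX z] smooth_on_symmetric_derivative[OF o sN z] by auto
  \<comment> \<open>The spatial derivative of the variation field is the time derivative of the
    spatial derivative.\<close>
  have symV: "dd (\<lambda>z. DX c z (1, 0)) ?z (0, w) = Vv w"
    "dd (\<lambda>z. DN c z (1, 0)) ?z (0, w) = Wv w" for w
    unfolding Vv_def Wv_def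
    using smooth_on_symmetric_derivative[OF o sX z] smooth_on_symmetric_derivative[OF o sN z] by auto
  have HN: "(cN c has_derivative DN c ?z) (at ?z)" by (rule smooth_on_has_derivative[OF sN z])
  have HXv: "((\<lambda>z. DX c z (0, v)) has_derivative dd (\<lambda>z. DX c z (0, v)) ?z) (at ?z)" for v
    by (rule smooth_on_has_derivative[OF dsX z])
  have HNv: "((\<lambda>z. DN c z (0, v)) has_derivative dd (\<lambda>z. DN c z (0, v)) ?z) (at ?z)" for v
    by (rule smooth_on_has_derivative[OF dsN z])
  note pw = laguerre_surface_pointwise[OF surf_F, of "fst z" c "chart_inv c (snd z)" for z]
  have un: "cN c z \<bullet> cN c z = 1" "DX c z (0, v) \<bullet> cN c z = 0" if "z \<in> ?O" for z v
    using pw(4,5)[of z] dmap_F[of c "fst z" "snd z"] c that by (auto simp: cN_def mem_Times_iff inner_commute)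
  have n: "n \<bullet> n = 1" "n \<bullet> nv v = 0" "n \<bullet> xv v = 0" "xv v \<bullet> nv w = xv w \<bullet> nv v" for v w
    using pw(4-7)[of ?z] dmap_F[OF c zero_I y] c p zero_I by (auto simp: n_def nv_def xv_def cN_def)
  have nW: "n \<bullet> W = 0"
    using inner_const_derivative[OF HN HN o z, of 1 "(1, 0)"] un by (simp add: n_def W_def inner_commute)
  \<comment> \<open>The contact condition dx' \<bullet> n = 0 holds at all times; this is its time
    derivative at 0.\<close>
  have VW: "Vv v \<bullet> n + xv v \<bullet> W = 0" for v
    using inner_const_derivative[OF HXv HN o z, of v 0 "(1, 0)"] un by (simp add: n_def W_def Vv_def xv_def)
  have D: "lag_D c f ?p = tp n (nv ex1) (nv ex2)" "lag_B c f ?p = tp n (xv ex1) (nv ex2) + tp n (nv ex1) (xv ex2)"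
    using lag_F(1,2)[OF c zero_I y] by (simp_all add: F0 cD_def cB_def n_def nv_def xv_def)
  have D0: "tp n (nv ex1) (nv ex2) \<noteq> 0" using cD_nonzero[OF c z] by (simp add: cD_def n_def nv_def)
  have nv: "dmap c (snd \<circ> f) ?p v = nv v" for v using dmap_F(2)[OF c zero_I y] by (simp add: F0 nv_def)
  have cj: "tp n (xv ex1) (nv ex2) + tp n (nv ex1) (xv ex2) = - 2 * \<rho> * tp n (nv ex1) (nv ex2)"
    "tp n (nv ex1) (nv ex2) * ev ex1 = (nv ex1 \<bullet> nv ex1) * rv ex2 - (nv ex1 \<bullet> nv ex2) * rv ex1"
    "tp n (nv ex1) (nv ex2) * ev ex2 = (nv ex1 \<bullet> nv ex2) * rv ex2 - (nv ex2 \<bullet> nv ex2) * rv ex1"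
  proof -
    have "lag_B c f ?p = - 2 * r ?p * lag_D c f ?p"
      "lag_D c f ?p * \<eta> c ?p ex1 = (dmap c (snd \<circ> f) ?p ex1 \<bullet> dmap c (snd \<circ> f) ?p ex1) * dmap c r ?p ex2
          - (dmap c (snd \<circ> f) ?p ex1 \<bullet> dmap c (snd \<circ> f) ?p ex2) * dmap c r ?p ex1"
      "lag_D c f ?p * \<eta> c ?p ex2 = (dmap c (snd \<circ> f) ?p ex1 \<bullet> dmap c (snd \<circ> f) ?p ex2) * dmap c r ?p ex2
          - (dmap c (snd \<circ> f) ?p ex2 \<bullet> dmap c (snd \<circ> f) ?p ex2) * dmap c r ?p ex1"
      using conj c p unfolding conjugate_radius_def by blast+
    then show "tp n (xv ex1) (nv ex2) + tp n (nv ex1) (xv ex2) = - 2 * \<rho> * tp n (nv ex1) (nv ex2)"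
      "tp n (nv ex1) (nv ex2) * ev ex1 = (nv ex1 \<bullet> nv ex1) * rv ex2 - (nv ex1 \<bullet> nv ex2) * rv ex1"
      "tp n (nv ex1) (nv ex2) * ev ex2 = (nv ex1 \<bullet> nv ex2) * rv ex2 - (nv ex2 \<bullet> nv ex2) * rv ex1"
      unfolding D nv by (simp_all add: \<rho>_def ev_def rv_def)
  qed
  \<comment> \<open>The terms with \<open>rv\<close> appear because \<open>r\<close> is
    differentiated here, unlike in \<delta> below.\<close>
  have DO: "dd (\<lambda>y. om c (chart_inv c y) v) y w =
      tp (nv w) (V + \<rho> *\<^sub>R W) (xv v + \<rho> *\<^sub>R nv v)
    + tp n (Vv w + \<rho> *\<^sub>R Wv w + rv w *\<^sub>R W) (xv v + \<rho> *\<^sub>R nv v)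
    + tp n (V + \<rho> *\<^sub>R W) (xx v w + \<rho> *\<^sub>R nn v w + rv w *\<^sub>R nv v)
    + (V \<bullet> nv w + Vv w \<bullet> n) * ev v + (V \<bullet> n) * dd (\<lambda>y. \<eta> c (chart_inv c y) v) y w" for v w
  proof -
    have sl: "((\<lambda>y. G (0, y)) has_derivative (\<lambda>v. dd G ?z (0, v))) (at y)"
      if "smooth_on ?O G" for G :: "_ \<Rightarrow> real^3"
      by (rule smooth_on_slice(2)[OF that _ open_img[OF c] zero_I y]) simp
    have hn: "((\<lambda>y. cN c (0, y)) has_derivative nv) (at y)" using sl[OF sN] by (simp add: nv_def)
    have hV: "((\<lambda>y. DX c (0, y) (1, 0)) has_derivative Vv) (at y)" using sl[OF dsX, of "(1,0)"] by (simp add: symV)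
    have hW: "((\<lambda>y. DN c (0, y) (1, 0)) has_derivative Wv) (at y)" using sl[OF dsN, of "(1,0)"] by (simp add: symV)
    have hx: "((\<lambda>y. DX c (0, y) (0, v)) has_derivative xx v) (at y)" using sl[OF dsX, of "(0,v)"] by (simp add: xx_def)
    have hnv: "((\<lambda>y. DN c (0, y) (0, v)) has_derivative nn v) (at y)" using sl[OF dsN, of "(0,v)"] by (simp add: nn_def)
    have hr: "((\<lambda>y. r (chart_inv c y)) has_derivative rv) (at y)"
      using smooth_map_has_derivative[OF smooth_r c y] by (simp add: o_def rv_def)
    have he: "((\<lambda>y. \<eta> c (chart_inv c y) v) has_derivative dd (\<lambda>y. \<eta> c (chart_inv c y) v) y) (at y)"
      by (rule smooth_on_has_derivative[OF _ y]) (use conj c in \<open>simp add: conjugate_radius_def\<close>)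
    note h = has_derivative_add[OF has_derivative_tp[OF hn
          has_derivative_add[OF hV has_derivative_scaleR[OF hr hW]]
          has_derivative_add[OF hx has_derivative_scaleR[OF hr hnv]]]
        has_derivative_mult[OF has_derivative_inner[OF hV hn] he]]
    have "((\<lambda>y. om c (chart_inv c y) v) has_derivative
       (\<lambda>w. tp (nv w) (V + \<rho> *\<^sub>R W) (xv v + \<rho> *\<^sub>R nv v)
    + tp n (Vv w + (\<rho> *\<^sub>R Wv w + rv w *\<^sub>R W)) (xv v + \<rho> *\<^sub>R nv v)
    + tp n (V + \<rho> *\<^sub>R W) (xx v w + (\<rho> *\<^sub>R nn v w + rv w *\<^sub>R nv v))
    + ((V \<bullet> n) * dd (\<lambda>y. \<eta> c (chart_inv c y) v) y w + (V \<bullet> nv w + Vv w \<bullet> n) * ev v))) (at y)"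
      using has_derivative_transform_within_open[OF h open_img[OF c] y om_chart[OF c, symmetric]]
      by (simp only: n_def V_def W_def xv_def nv_def \<rho>_def ev_def)
    from frechet_derivative_at[OF this, symmetric] show ?thesis by (simp add: algebra_simps)
  qed
  have closed: "dd (\<lambda>y. \<eta> c (chart_inv c y) ex2) y ex1 =
      dd (\<lambda>y. \<eta> c (chart_inv c y) ex1) y ex2"
    using conj c y unfolding conjugate_radius_def by blast
  define \<delta> where "\<delta> = tp n (Vv ex1 + \<rho> *\<^sub>R Wv ex1) (xv ex2 + \<rho> *\<^sub>R nv ex2) - tp n (Vv ex2 + \<rho> *\<^sub>R Wv ex2) (xv ex1 + \<rho> *\<^sub>R nv ex1)"
  have "dd (\<lambda>y. om c (chart_inv c y) ex2) y ex1
      - dd (\<lambda>y. om c (chart_inv c y) ex1) y ex2 = \<delta>"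
    using variation_algebra[OF n(1) n(2) n(2) n(3) n(3) nW VW VW n(4) D0 cj]
    unfolding DO closed symx(1)[of ex2 ex1] symx(2)[of ex2 ex1] \<delta>_def
    by (simp add: algebra_simps inner_commute)
  moreover have "dd (cM c) ?z (1, 0) = - 2 * \<delta>"
  proof -
    define Dt Bt Ct where "Dt = tp n (Wv ex1) (nv ex2) + tp n (nv ex1) (Wv ex2)"
      and "Bt = tp n (Vv ex1) (nv ex2) + tp n (xv ex1) (Wv ex2) + tp n (Wv ex1) (xv ex2) + tp n (nv ex1) (Vv ex2)"
      and "Ct = tp n (Vv ex1) (xv ex2) + tp n (xv ex1) (Vv ex2)"
    \<comment> \<open>\<open>W\<close> is tangential as n has constant length, so in the time
      derivatives of \<open>cD\<close>, \<open>cB\<close>, \<open>cC\<close> the terms that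
      differentiate the factor n vanish.\<close>
    have tan: "tp W a b = 0" if "n \<bullet> a = 0" "n \<bullet> b = 0" for a b
      using tp_tangential[OF n(1) nW that] .
    have hD: "(cD c has_derivative (\<lambda>v. tp (DN c ?z v) (nv ex1) (nv ex2)
        + tp n (dd (\<lambda>z. DN c z (0, ex1)) ?z v) (nv ex2)
        + tp n (nv ex1) (dd (\<lambda>z. DN c z (0, ex2)) ?z v))) (at ?z)"
      unfolding cD_def[abs_def] n_def nv_def by (rule has_derivative_tp[OF HN HNv HNv])
    have hC: "(cC c has_derivative (\<lambda>v. tp (DN c ?z v) (xv ex1) (xv ex2)
        + tp n (dd (\<lambda>z. DX c z (0, ex1)) ?z v) (xv ex2)
        + tp n (xv ex1) (dd (\<lambda>z. DX c z (0, ex2)) ?z v))) (at ?z)"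
      unfolding cC_def[abs_def] n_def xv_def by (rule has_derivative_tp[OF HN HXv HXv])
    have hB: "(cB c has_derivative (\<lambda>v. (tp (DN c ?z v) (xv ex1) (nv ex2)
        + tp n (dd (\<lambda>z. DX c z (0, ex1)) ?z v) (nv ex2)
        + tp n (xv ex1) (dd (\<lambda>z. DN c z (0, ex2)) ?z v)) +
        (tp (DN c ?z v) (nv ex1) (xv ex2)
        + tp n (dd (\<lambda>z. DN c z (0, ex1)) ?z v) (xv ex2)
        + tp n (nv ex1) (dd (\<lambda>z. DX c z (0, ex2)) ?z v)))) (at ?z)"
      unfolding cB_def[abs_def] n_def nv_def xv_def
      by (rule has_derivative_add[OF has_derivative_tp[OF HN HXv HNv] has_derivative_tp[OF HN HNv HXv]])
    have along: "((\<lambda>t. G (t, y)) has_real_derivative G' (1, 0)) (at 0)" if "(G has_derivative G') (at ?z)" for G G'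
    proof -
      have 2: "((\<lambda>t. (t, y)) has_derivative (\<lambda>s. (s, 0))) (at (0::real))" by (auto intro!: derivative_eq_intros)
      from has_derivative_compose_real[OF 2 that]
      have d: "((\<lambda>t. G (t, y)) has_derivative (\<lambda>s. G' (s, 0))) (at 0)" .
      have "G' (s, 0) = G' (1, 0) * s" for s using linear_scale[OF has_derivative_linear[OF d], of s 1] by simp
      then have "(\<lambda>s. G' (s, 0)) = (*) (G' (1, 0))" by (rule ext)
      from d[unfolded this] show ?thesis by (simp only: has_field_derivative_def)
    qed
    have tD: "((\<lambda>t. cD c (t, y)) has_real_derivative Dt) (at 0)"
      using along[OF hD] by (simp add: tan n W_def[symmetric] Wv_def Dt_def)
    have tC: "((\<lambda>t. cC c (t, y)) has_real_derivative Ct) (at 0)"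
      using along[OF hC] by (simp add: tan n W_def[symmetric] Vv_def Ct_def)
    have tB: "((\<lambda>t. cB c (t, y)) has_real_derivative Bt) (at 0)"
      using along[OF hB] by (simp add: tan n W_def[symmetric] Vv_def Wv_def Bt_def add.assoc)
    have zD: "cD c (0, y) = tp n (nv ex1) (nv ex2)" by (simp add: cD_def n_def nv_def)
    have zB: "cB c (0, y) = - 2 * \<rho> * tp n (nv ex1) (nv ex2)"
      using cj(1) by (simp add: cB_def n_def nv_def xv_def)
    have "((\<lambda>t. cM c (t, y)) has_real_derivative
        (2 * cB c (0, y) * Bt * (2 * cD c (0, y)) - (cB c (0, y))\<^sup>2 * (2 * Dt)) / (2 * cD c (0, y))\<^sup>2 - 2 * Ct) (at 0)"
      unfolding cM_def[abs_def]
      by (rule derivative_eq_intros tD tB tC refl | use D0 zD in \<open>simp add: power2_eq_square\<close>)+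
    \<comment> \<open>Inserting B = -2 \<rho> D into the quotient rule leaves -2 times the time
      derivative of C + \<rho> B + \<rho>^2 D with \<rho> constant: the envelope argument.\<close>
    moreover have "(2 * cB c (0, y) * Bt * (2 * cD c (0, y)) - (cB c (0, y))\<^sup>2 * (2 * Dt)) / (2 * cD c (0, y))\<^sup>2 - 2 * Ct
       = - 2 * (Ct + \<rho> * Bt + \<rho>\<^sup>2 * Dt)"
      unfolding zB zD using D0 by (simp add: power2_eq_square field_simps)
    moreover have "Ct + \<rho> * Bt + \<rho>\<^sup>2 * Dt = \<delta>"
    proof -
      have anti: "tp n b a = - tp n a b" for a b by (simp add: tp_def algebra_simps)
      show ?thesis
        unfolding \<delta>_def Ct_def Bt_def Dt_def
        by (simp add: anti[of "xv ex1" "Vv ex2"] anti[of "xv ex1" "Wv ex2"] anti[of "nv ex1" "Vv ex2"] anti[of "nv ex1" "Wv ex2"]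
            power2_eq_square algebra_simps)
    qed
    ultimately have "((\<lambda>t. cM c (t, y)) has_real_derivative - 2 * \<delta>) (at 0)" by simp
    moreover have "((\<lambda>t. cM c (t, y)) has_real_derivative dd (cM c) ?z (1, 0)) (at 0)"
      by (rule along[OF smooth_on_has_derivative[OF smooth_cM[OF c] z]])
    ultimately show ?thesis using DERIV_unique by blast
  qed
  ultimately show ?thesis by simp
qed

end

section \<open>Areas of the varied surfaces as integrals against one fixed measure\<close>

context atlas_surface begin

lemma area_density_lag_M:
  assumes "laguerre_surface A f" "\<And>c. c \<in> A \<Longrightarrow> continuous_on (cimg c) (\<lambda>y. lag_M c f (chart_inv c y))"
  shows "area_density (\<lambda>c p. \<bar>lag_M c f p\<bar>)"
  unfolding area_density_def
proof (intro conjI ballI)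
  fix c d p assume c: "c \<in> A" and d: "d \<in> A" and p: "p \<in> cdom c \<inter> cdom d"
  show "\<bar>lag_M c f p\<bar> = \<bar>det2 (dmap c (snd d) p)\<bar> * \<bar>lag_M d f p\<bar>"
    using lag_change_chart(2)[OF assms(1) c d, of p] p by (simp add: abs_mult)
qed (use assms(2) in \<open>auto intro: continuous_on_rabs\<close>)

lemma riemannian_measure_laguerre:
  assumes "laguerre_surface A f" "has_area_density \<mu> (\<lambda>c p. \<bar>lag_M c f p\<bar>)"
  shows "riemannian_measure A (laguerre_metric f) = \<mu>"
  using riemannian_measure_eqI[OF assms(2)] laguerre_density(3)[OF assms(1)] by blast

end

context laguerre_first_variation begin

definition some_chart :: "'a \<Rightarrow> 'a chart" where "some_chart p = (SOME c. c \<in> A \<and> p \<in> cdom c)"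

lemma some_chart: "some_chart p \<in> A" "p \<in> cdom (some_chart p)"
proof -
  have "\<exists>c. c \<in> A \<and> p \<in> cdom c" using dom_cover[of p] by blast
  from someI_ex[OF this] show "some_chart p \<in> A" "p \<in> cdom (some_chart p)" unfolding some_chart_def by blast+
qed

lemma chart_jacobian_nonzero:
  assumes "c \<in> A" "d \<in> A" "p \<in> cdom c" "p \<in> cdom d"
  shows "det2 (dmap c (snd d) p) \<noteq> 0"
  using lag_change_chart(1)[OF surf assms] laguerre_density(1)[OF surf assms(1,3)] by force

text \<open>A quotient of two quantities with the same transformation law, hence a function on the
  surface whichever chart is picked. It compares the area at time \<open>t\<close> with that at time
  0.\<close>

definition rho :: "real \<Rightarrow> 'a \<Rightarrow> real" where
  "rho t p = lag_M (some_chart p) (F t) p / lag_M (some_chart p) f p"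

lemma rho_chart:
  assumes "c \<in> A" "t \<in> I" "y \<in> cimg c"
  shows "rho t (chart_inv c y) = cM c (t, y) / cM c (0, y)"
proof -
  let ?p = "chart_inv c y" and ?d = "some_chart (chart_inv c y)"
  have p: "?p \<in> cdom c" using assms by simp
  note d = some_chart[of ?p]
  have "lag_M c (F t) ?p / lag_M c f ?p = rho t ?p"
    unfolding rho_def lag_change_chart(2)[OF surf_F[OF assms(2)] assms(1) d(1) p d(2)]
      lag_change_chart(2)[OF surf assms(1) d(1) p d(2)]
    using chart_jacobian_nonzero[OF assms(1) d(1) p d(2)] by simp
  then show ?thesis using lag_F(3)[OF assms] lag_F(3)[OF assms(1) zero_I assms(3)] by (simp add: F0)
qed

lemma rho_0: "rho 0 p = 1"
  using lag_M_nonzero[OF surf umb some_chart] by (simp add: rho_def F0)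

lemma continuous_cM_0: "c \<in> A \<Longrightarrow> continuous_on (cimg c) (\<lambda>y. cM c (t, y))" if "t \<in> I"
  using smooth_on_continuous_on[OF smooth_on_slice(1)[OF smooth_cM _ open_img that]] by simp

lemma continuous_rho: "t \<in> I \<Longrightarrow> continuous_on UNIV (rho t)"
proof (rule continuous_on_chartwise)
  fix c assume t: "t \<in> I" and c: "c \<in> A"
  have "continuous_on (cimg c) (\<lambda>y. cM c (t, y) / cM c (0, y))"
    by (intro continuous_intros continuous_cM_0 t c zero_I) (use cM_nonzero[OF c] zero_I in auto)
  then show "continuous_on (cimg c) (rho t \<circ> chart_inv c)"
    by (rule continuous_on_eq) (use rho_chart[OF c t] in simp)
qed

lemma rho_has_derivative:
  assumes "c \<in> A" "t \<in> I" "y \<in> cimg c"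
  shows "((\<lambda>s. rho s (chart_inv c y)) has_real_derivative
     dd (cM c) (t, y) (1, 0) / cM c (0, y)) (at t)"
proof -
  have d: "((\<lambda>t. cM c (t, y)) has_derivative (\<lambda>s. dd (cM c) (t, y) (s, 0))) (at t)"
    by (rule smooth_on_slice(3)[OF smooth_cM[OF assms(1)] _ open_img[OF assms(1)] assms(2,3)]) simp
  have "dd (cM c) (t, y) (s, 0) = dd (cM c) (t, y) (1, 0) * s" for s
    using linear_scale[OF has_derivative_linear[OF d], of s 1] by simp
  then have "(\<lambda>s. dd (cM c) (t, y) (s, 0)) = (*) (dd (cM c) (t, y) (1, 0))"
    by (rule ext)
  from d[unfolded this] have "((\<lambda>t. cM c (t, y)) has_real_derivative dd (cM c) (t, y) (1, 0)) (at t)"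
    by (simp only: has_field_derivative_def)
  then have "((\<lambda>t. cM c (t, y) / cM c (0, y)) has_real_derivative
     dd (cM c) (t, y) (1, 0) / cM c (0, y)) (at t)" by (rule DERIV_cdivide)
  then show ?thesis
    by (rule has_field_derivative_transform_within_open[of _ _ _ I])
      (use assms rho_chart in auto)
qed

text \<open>The ratio is continuous in time, equals 1 at time 0 and never vanishes because every
  \<open>F t\<close> is umbilical free; a change of sign would contradict the intermediate value
  theorem. So no absolute value has to be differentiated.\<close>

lemma rho_pos:
  assumes t: "t \<in> I"
  shows "rho t p > 0"
proof (rule ccontr)
  assume n: "\<not> rho t p > 0"
  obtain c where c: "c \<in> A" "p \<in> cdom c" using dom_cover by blast
  let ?y = "snd c p"
  have y: "?y \<in> cimg c" using c by simp
  have cont: "continuous_on I (\<lambda>s. rho s p)"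
  proof (intro continuous_at_imp_continuous_on ballI)
    fix s assume "s \<in> I"
    from DERIV_isCont[OF rho_has_derivative[OF c(1) this y]] show "isCont (\<lambda>s. rho s p) s" using c by simp
  qed
  have "connected ((\<lambda>s. rho s p) ` I)" by (rule connected_continuous_image[OF cont]) simp
  moreover have "rho t p \<in> (\<lambda>s. rho s p) ` I" "rho 0 p \<in> (\<lambda>s. rho s p) ` I" using t zero_I by auto
  ultimately have "0 \<in> (\<lambda>s. rho s p) ` I"
    using connectedD_interval[of "(\<lambda>s. rho s p) ` I" "rho t p" "rho 0 p" 0] n rho_0 by force
  then obtain s where "s \<in> I" "rho s p = 0" by auto
  then show False using rho_chart[OF c(1) _ y, of s] cM_nonzero[OF c(1)] y zero_I c by auto
qed

lemma rho_abs_M: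
  assumes "c \<in> A" "t \<in> I" "y \<in> cimg c"
  shows "\<bar>cM c (0, y)\<bar> * rho t (chart_inv c y) = \<bar>cM c (t, y)\<bar>"
proof -
  have "rho t (chart_inv c y) = \<bar>rho t (chart_inv c y)\<bar>"
    using rho_pos[OF assms(2), of "chart_inv c y"] by simp
  then have "rho t (chart_inv c y) = \<bar>cM c (t, y) / cM c (0, y)\<bar>"
    unfolding rho_chart[OF assms] .
  then show ?thesis using cM_nonzero[OF assms(1), of "(0, y)"] zero_I assms(3) by (simp add: abs_divide)
qed

abbreviation "a0 \<equiv> \<lambda>c p. \<bar>lag_M c f p\<bar>"

lemma a0_chart: "c \<in> A \<Longrightarrow> y \<in> cimg c \<Longrightarrow> a0 c (chart_inv c y) = \<bar>cM c (0, y)\<bar>"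
  using lag_F(3)[OF _ zero_I] by (simp add: F0)

lemma area_density_a0: "area_density a0"
proof (rule area_density_lag_M[OF surf])
  fix c assume c: "c \<in> A"
  show "continuous_on (cimg c) (\<lambda>y. lag_M c f (chart_inv c y))"
    by (rule continuous_on_eq[OF continuous_cM_0[OF zero_I c]]) (use lag_F(3)[OF c zero_I] F0 in simp)
qed

definition \<mu> :: "'a measure" where "\<mu> = (SOME \<mu>. has_area_density \<mu> a0)"

lemma mu: "has_area_density \<mu> a0"
  unfolding \<mu>_def using has_area_density_exists[OF area_density_a0] by (rule someI_ex)

lemma sets_mu [measurable_cong]: "sets \<mu> = sets borel"
  using mu by (simp add: has_area_density_def)

lemma measurable_rho: "t \<in> I \<Longrightarrow> rho t \<in> borel_measurable borel"
  by (intro borel_measurable_continuous_onI continuous_rho)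

text \<open>Moves the time dependence from the measure into the integrand, which is what
  differentiation under the integral sign requires. In a chart it is
  \<open>rho_abs_M\<close>.\<close>

lemma laguerre_measure_F:
  assumes t: "t \<in> I"
  shows "riemannian_measure A (laguerre_metric (F t)) = density \<mu> (\<lambda>p. ennreal (rho t p))"
proof (rule riemannian_measure_laguerre[OF surf_F[OF t]])
  show "has_area_density (density \<mu> (\<lambda>p. ennreal (rho t p))) (\<lambda>c p. \<bar>lag_M c (F t) p\<bar>)"
    unfolding has_area_density_def
  proof (intro conjI ballI impI)
    fix c B assume c: "c \<in> A" and B: "B \<in> sets borel" "B \<subseteq> cdom c"
    have m: "(\<lambda>p. ennreal (rho t p)) \<in> borel_measurable borel" using measurable_rho[OF t] by simp
    have m': "(\<lambda>p. ennreal (rho t p) * indicator B p) \<in> borel_measurable borel" using m B by simp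
    have "emeasure (density \<mu> (\<lambda>p. ennreal (rho t p))) B = (\<integral>\<^sup>+p. ennreal (rho t p) * indicator B p \<partial>\<mu>)"
      by (rule emeasure_density) (use m B sets_mu in \<open>simp_all cong: measurable_cong_sets\<close>)
    also have "\<dots> = (\<integral>\<^sup>+p. (ennreal (rho t p) * indicator B p) * indicator (cdom c) p \<partial>\<mu>)"
      by (rule nn_integral_cong) (use B in \<open>auto simp: indicator_def\<close>)
    also have "\<dots> = (\<integral>\<^sup>+y\<in>cimg c. (ennreal (a0 c (chart_inv c y)) * (ennreal (rho t (chart_inv c y)) * indicator B (chart_inv c y))) \<partial>lborel)"
      by (rule nn_integral_has_area_density[OF mu area_density_a0 c m'])
    also have "\<dots> = (\<integral>\<^sup>+y\<in>snd c ` B. ennreal \<bar>lag_M c (F t) (chart_inv c y)\<bar> \<partial>lborel)"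
    proof (rule nn_integral_cong)
      fix y :: "real^2"
      have "ennreal (a0 c (chart_inv c y)) * ennreal (rho t (chart_inv c y)) = ennreal \<bar>lag_M c (F t) (chart_inv c y)\<bar>" if "y \<in> cimg c"
        using rho_abs_M[OF c t that] lag_F(3)[OF c t that] a0_chart[OF c that] rho_pos[OF t]
        by (simp add: ennreal_mult[symmetric] less_imp_le)
      moreover have "y \<in> snd c ` B \<longleftrightarrow> y \<in> cimg c \<and> chart_inv c y \<in> B"
        using chart_image_eq[OF c B(2)] by auto
      ultimately show "ennreal (a0 c (chart_inv c y)) * (ennreal (rho t (chart_inv c y)) * indicator B (chart_inv c y)) * indicator (cimg c) y
         = ennreal \<bar>lag_M c (F t) (chart_inv c y)\<bar> * indicator (snd c ` B) y"
        by (auto simp: indicator_def mult.assoc[symmetric])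
    qed
    finally show "emeasure (density \<mu> (\<lambda>p. ennreal (rho t p))) B = (\<integral>\<^sup>+y\<in>snd c ` B. ennreal \<bar>lag_M c (F t) (chart_inv c y)\<bar> \<partial>lborel)" .
  qed (simp add: sets_mu)
qed

lemma K_borel: "K \<in> sets borel"
  using compact_K by (simp add: borel_compact)

lemma mu_K: "emeasure \<mu> K < \<infinity>"
  by (rule emeasure_compact_finite[OF mu area_density_a0 compact_K])

lemma laguerre_area_F:
  assumes t: "t \<in> I"
  shows "laguerre_area A (F t) K = (\<integral>p. indicator K p * rho t p \<partial>\<mu>)"
proof -
  have m: "(\<lambda>p. ennreal (rho t p)) \<in> borel_measurable \<mu>" using measurable_rho[OF t] by measurable
  have m': "(\<lambda>p. indicator K p * rho t p) \<in> borel_measurable \<mu>" using measurable_rho[OF t] K_borel by measurable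
  have "laguerre_area A (F t) K = enn2real (\<integral>\<^sup>+p. ennreal (rho t p) * indicator K p \<partial>\<mu>)"
    unfolding laguerre_area_def laguerre_measure_F[OF t] measure_def
    using emeasure_density[OF m, of K] K_borel sets_mu by simp
  also have "(\<integral>\<^sup>+p. ennreal (rho t p) * indicator K p \<partial>\<mu>) = (\<integral>\<^sup>+p. ennreal (indicator K p * rho t p) \<partial>\<mu>)"
    by (rule nn_integral_cong) (auto simp: indicator_def)
  also have "enn2real \<dots> = (\<integral>p. indicator K p * rho t p \<partial>\<mu>)"
    by (rule integral_eq_nn_integral[symmetric, OF m']) (use rho_pos[OF t] in \<open>auto simp: less_imp_le\<close>)
  finally show ?thesis .
qed

lemma integrable_on_K:
  fixes h :: "'a \<Rightarrow> real"
  assumes "continuous_on UNIV h"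
  shows "integrable \<mu> (\<lambda>p. indicator K p * h p)"
proof -
  have "bounded (h ` K)"
    by (intro compact_imp_bounded compact_continuous_image compact_K continuous_on_subset[OF assms]) simp
  then obtain B where B: "\<And>p. p \<in> K \<Longrightarrow> \<bar>h p\<bar> \<le> B" by (auto simp: bounded_iff)
  have "integrable \<mu> (\<lambda>p. \<bar>B\<bar> * indicator K p)"
    using mu_K K_borel sets_mu by (intro integrable_mult_right integrable_real_indicator) auto
  moreover have "(\<lambda>p. indicator K p * h p) \<in> borel_measurable \<mu>"
    using borel_measurable_continuous_onI[OF assms] K_borel by measurable
  ultimately show ?thesis
    by (rule Bochner_Integration.integrable_bound) (use B in \<open>force simp: indicator_def\<close>)
qed

definition drho :: "real \<Rightarrow> 'a \<Rightarrow> real" where "drho t p = deriv (\<lambda>s. rho s p) t"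

lemma drho_chart:
  assumes "c \<in> A" "t \<in> I" "y \<in> cimg c"
  shows "drho t (chart_inv c y) = dd (cM c) (t, y) (1, 0) / cM c (0, y)"
  unfolding drho_def using rho_has_derivative[OF assms] by (rule DERIV_imp_deriv)

lemma rho_drho: "t \<in> I \<Longrightarrow> ((\<lambda>s. rho s p) has_real_derivative drho t p) (at t)"
proof -
  assume t: "t \<in> I"
  obtain c where c: "c \<in> A" "p \<in> cdom c" using dom_cover by blast
  then show ?thesis
    using rho_has_derivative[OF c(1) t, of "snd c p"] drho_chart[OF c(1) t, of "snd c p"] by simp
qed

text \<open>Joint continuity bounds the time derivative on a compact time interval times
  \<open>K\<close>; that bound is the dominating constant for the derivative of the area.\<close>

lemma continuous_drho: "continuous_on (I \<times> UNIV) (\<lambda>(t, p). drho t p)"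
proof -
  have "continuous_on (I \<times> cdom c) (\<lambda>(t, p). drho t p)" if c: "c \<in> A" for c
  proof -
    have g: "continuous_on (I \<times> cdom c) (\<lambda>z. (fst z, snd c (snd z)))"
      "continuous_on (I \<times> cdom c) (\<lambda>z. (0::real, snd c (snd z)))"
      by (intro continuous_intros continuous_on_compose2[OF continuous_chart[OF c]]; force)+
    have "continuous_on (I \<times> cdom c) (\<lambda>z. dd (cM c) (fst z, snd c (snd z)) (1, 0) / cM c (0, snd c (snd z)))"
    proof (rule continuous_on_divide)
      show "continuous_on (I \<times> cdom c) (\<lambda>z. dd (cM c) (fst z, snd c (snd z)) (1, 0))"
        by (rule continuous_on_compose2[OF smooth_on_continuous_on[OF smooth_on_derivative[OF smooth_cM[OF c]]] g(1)]) auto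
      show "continuous_on (I \<times> cdom c) (\<lambda>z. cM c (0, snd c (snd z)))"
        by (rule continuous_on_compose2[OF smooth_on_continuous_on[OF smooth_cM[OF c]] g(2)]) (use zero_I in auto)
      show "\<forall>z\<in>I \<times> cdom c. cM c (0, snd c (snd z)) \<noteq> 0" using cM_nonzero[OF c] zero_I by auto
    qed
    then show ?thesis
      by (rule continuous_on_eq) (use drho_chart[OF c] c in \<open>force simp: image_def\<close>)
  qed
  then have "continuous_on (\<Union>c\<in>A. I \<times> cdom c) (\<lambda>(t, p). drho t p)"
    by (intro continuous_on_open_UN) (use open_dom in \<open>auto intro: open_Times\<close>)
  moreover have "(\<Union>c\<in>A. I \<times> cdom c) = I \<times> UNIV" using dom_cover by blast
  ultimately show ?thesis by simp
qed

lemma continuous_drho_0: "continuous_on UNIV (drho 0)"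
proof -
  have "continuous_on UNIV (\<lambda>p::'a. (0::real, p))" by (intro continuous_intros)
  moreover have "range (\<lambda>p::'a. (0::real, p)) \<subseteq> I \<times> UNIV" using zero_I by auto
  ultimately show ?thesis using continuous_on_compose2[OF continuous_drho] by fastforce
qed

lemma laguerre_area_derivative:
  "((\<lambda>t. laguerre_area A (F t) K) has_real_derivative (\<integral>p. indicator K p * drho 0 p \<partial>\<mu>)) (at 0)"
proof -
  \<comment> \<open>Compactness calls for a closed time interval inside the open one.\<close>
  have half: "{- (\<epsilon>/2)..\<epsilon>/2} \<subseteq> I" using eps_pos by auto
  have "compact ({- (\<epsilon>/2)..\<epsilon>/2} \<times> K)" by (intro compact_Times compact_K compact_Icc)
  then have "bounded ((\<lambda>(t, p). drho t p) ` ({- (\<epsilon>/2)..\<epsilon>/2} \<times> K))"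
    by (intro compact_imp_bounded compact_continuous_image continuous_on_subset[OF continuous_drho]) (use half in auto)
  then obtain B where B: "\<And>t p. t \<in> {- (\<epsilon>/2)..\<epsilon>/2} \<Longrightarrow> p \<in> K \<Longrightarrow> \<bar>drho t p\<bar> \<le> B"
    by (force simp: bounded_iff)
  have "((\<lambda>t. \<integral>p. indicator K p * rho t p \<partial>\<mu>) has_real_derivative (\<integral>p. indicator K p * drho 0 p \<partial>\<mu>)) (at 0)"
  proof (rule has_real_derivative_integral[where d="\<epsilon>/2" and w="\<lambda>p. indicator K p * \<bar>B\<bar>"])
    show "\<epsilon>/2 > 0" using eps_pos by simp
    show "integrable \<mu> (\<lambda>p. indicator K p * rho t p)" if "\<bar>t\<bar> < \<epsilon>/2" for t
      by (rule integrable_on_K[OF continuous_rho]) (use that in auto)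
    show "((\<lambda>t. indicator K p * rho t p) has_real_derivative indicator K p * drho 0 p) (at 0)" for p
      by (rule DERIV_cmult[OF rho_drho[OF zero_I]])
    show "(\<lambda>p. indicator K p * drho 0 p) \<in> borel_measurable \<mu>"
      by (rule borel_measurable_integrable[OF integrable_on_K[OF continuous_drho_0]])
    show "integrable \<mu> (\<lambda>p. indicator K p * \<bar>B\<bar>)" by (rule integrable_on_K) simp
    fix t p assume t: "\<bar>t\<bar> < \<epsilon>/2"
    show "\<bar>indicator K p * rho t p - indicator K p * rho 0 p\<bar> \<le> \<bar>t\<bar> * (indicator K p * \<bar>B\<bar>)"
    proof (cases "p \<in> K")
      case True
      have "norm (rho t p - rho 0 p) \<le> \<bar>B\<bar> * norm (t - 0)"
      proof (rule field_differentiable_bound[where S="{- (\<epsilon>/2)..\<epsilon>/2}" and f'="\<lambda>t. drho t p"])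
        fix s assume s: "s \<in> {- (\<epsilon>/2)..\<epsilon>/2}"
        show "((\<lambda>t. rho t p) has_field_derivative drho s p) (at s within {- (\<epsilon>/2)..\<epsilon>/2})"
          by (rule has_field_derivative_at_within[OF rho_drho]) (use s half in blast)
        show "norm (drho s p) \<le> \<bar>B\<bar>" using B[OF s True] by simp
      qed (use t in auto)
      then show ?thesis using True by (simp add: mult.commute)
    qed simp
  qed
  then show ?thesis
    by (rule has_field_derivative_transform_within_open[of _ _ _ I]) (use zero_I laguerre_area_F in auto)
qed

subsection \<open>The derivative of the area vanishes\<close>

lemma om_change_chart:
  assumes "c \<in> A" "d \<in> A" "p \<in> cdom c" "p \<in> cdom d"
  shows "om c p v = om d p (dmap c (snd d) p v)"
proof -
  have sm: "smooth_map A (fst \<circ> f)" "smooth_map A (snd \<circ> f)"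
    using surf by (auto simp: laguerre_surface_def immersion_def)
  have "\<eta> c p v = \<eta> d p (dmap c (snd d) p v)"
    using conj assms unfolding conjugate_radius_def by blast
  then show ?thesis
    unfolding om_def dmap_change_chart(1)[OF assms smooth_map_differentiable[OF sm(1) assms(2,4)]]
      dmap_change_chart(1)[OF assms smooth_map_differentiable[OF sm(2) assms(2,4)]] by simp
qed

lemma linear_om: "c \<in> A \<Longrightarrow> p \<in> cdom c \<Longrightarrow> linear (om c p)"
proof -
  assume c: "c \<in> A" "p \<in> cdom c"
  have e: "linear (\<eta> c p)" using conj c by (simp add: conjugate_radius_def)
  note pw = laguerre_surface_pointwise(1,2)[OF surf c]
  show ?thesis
    by (rule linearI)
      (simp_all add: om_def linear_add[OF pw(1)] linear_add[OF pw(2)] linear_add[OF e] linear_scale[OF pw(1)]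
        linear_scale[OF pw(2)] linear_scale[OF e] algebra_simps)
qed

lemma om_off: "p \<notin> K \<Longrightarrow> om c p v = 0"
proof -
  assume "p \<notin> K"
  moreover have "tp n 0 v = 0" for n v by (simp add: tp_def)
  ultimately show ?thesis by (simp add: om_def var_off)
qed

text \<open>The wedge product of d\<theta> with \<omega>, divided by the two-form of the Laguerre
  density: the Jacobians cancel and a function on the surface remains.\<close>

definition wedge :: "('a \<Rightarrow> real) \<Rightarrow> 'a chart \<Rightarrow> 'a \<Rightarrow> real" where
  "wedge \<theta> c p = (dmap c \<theta> p ex1 * om c p ex2 - dmap c \<theta> p ex2 * om c p ex1) / lag_M c f p"

lemma C1_map_linear: "C1_map \<theta> \<Longrightarrow> c \<in> A \<Longrightarrow> p \<in> cdom c \<Longrightarrow> linear (dmap c \<theta> p)"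
  using C1_map_has_derivative[of \<theta> c "snd c p"] has_derivative_linear by fastforce

lemma wedge_change_chart:
  assumes \<theta>: "C1_map \<theta>" and cd: "c \<in> A" "d \<in> A" "p \<in> cdom c" "p \<in> cdom d"
  shows "wedge \<theta> c p = wedge \<theta> d p"
proof -
  let ?J = "dmap c (snd d) p"
  have "(\<theta> \<circ> chart_inv d) differentiable (at (snd d p))"
    using C1_map_has_derivative[OF \<theta> cd(2), of "snd d p"] cd by (auto simp: differentiable_def)
  note D = dmap_change_chart(1)[OF cd this]
  note l = C1_map_linear[OF \<theta> cd(2,4)] and m = linear_om[OF cd(2,4)]
  have "dmap d \<theta> p (?J ex1) * om d p (?J ex2) - dmap d \<theta> p (?J ex2) * om d p (?J ex1) =
     det2 ?J * (dmap d \<theta> p ex1 * om d p ex2 - dmap d \<theta> p ex2 * om d p ex1)"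
    by (rule alternating_change_basis[OF linear_dmap_chart[OF cd],
          where \<omega>="\<lambda>v w. dmap d \<theta> p v * om d p w - dmap d \<theta> p w * om d p v"])
      (simp_all add: linear_add[OF l] linear_add[OF m] linear_scale[OF l] linear_scale[OF m] algebra_simps)
  then show ?thesis
    unfolding wedge_def D om_change_chart[OF cd] lag_change_chart(2)[OF surf cd]
    using chart_jacobian_nonzero[OF cd] by simp
qed

text \<open>By the product rule this is -2 d(\<theta> \<omega>) divided by \<open>lag_M\<close>,
  since \<open>drho 0\<close> is -2 d\<omega> divided by \<open>lag_M\<close>. It is linear in
  \<theta> and gives back \<open>drho 0\<close> for \<theta> = 1.\<close>

definition tested :: "('a \<Rightarrow> real) \<Rightarrow> 'a \<Rightarrow> real" where
  "tested \<theta> p = \<theta> p * drho 0 p - 2 * wedge \<theta> (some_chart p) p"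

lemma tested_chart:
  assumes \<theta>: "C1_map \<theta>" and c: "c \<in> A" "p \<in> cdom c"
  shows "tested \<theta> p = \<theta> p * drho 0 p - 2 * wedge \<theta> c p"
  using wedge_change_chart[OF \<theta> c(1) some_chart(1) c(2) some_chart(2)] by (simp add: tested_def)

lemma continuous_tested:
  assumes \<theta>: "C1_map \<theta>"
  shows "continuous_on UNIV (tested \<theta>)"
proof (rule continuous_on_chartwise)
  fix c assume c: "c \<in> A"
  note om = smooth_on_continuous_on[OF smooth_om[OF c]]
  have M: "continuous_on (cimg c) (\<lambda>y. lag_M c f (chart_inv c y))"
    by (rule continuous_on_eq[OF continuous_cM_0[OF zero_I c]]) (use lag_F(3)[OF c zero_I] F0 in simp)
  have "continuous_on (cimg c) (\<lambda>y. \<theta> (chart_inv c y) * drho 0 (chart_inv c y) - 2 * wedge \<theta> c (chart_inv c y))"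
    unfolding wedge_def
    by (intro continuous_intros om M C1_map_continuous_derivative[OF \<theta> c]
        continuous_on_compose2[OF C1_map_continuous[OF \<theta>] continuous_chart_inv[OF c]]
        continuous_on_compose2[OF continuous_drho_0 continuous_chart_inv[OF c]])
      (use lag_M_nonzero[OF surf umb c] c in auto)
  then show "continuous_on (cimg c) (tested \<theta> \<circ> chart_inv c)"
    by (rule continuous_on_eq) (use tested_chart[OF \<theta> c] c in simp)
qed

lemma drho_first_variation:
  assumes c: "c \<in> A" and y: "y \<in> cimg c"
  shows "cM c (0, y) * drho 0 (chart_inv c y) =
    - 2 * (dd (\<lambda>y. om c (chart_inv c y) ex2) y ex1
          - dd (\<lambda>y. om c (chart_inv c y) ex1) y ex2)"
  using drho_chart[OF c zero_I y] first_variation[OF c y] cM_nonzero[OF c, of "(0, y)"] zero_I y by simp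

text \<open>Stokes' theorem in one chart: integrating against \<open>a0\<close>, the absolute value
  of \<open>lag_M\<close>, cancels the denominator of \<open>tested\<close> up to a sign and leaves
  coordinate derivatives of compactly supported functions.\<close>

lemma integral_tested_chart:
  assumes \<theta>: "C1_map \<theta>" and c: "c \<in> A" and S: "compact S" "S \<subseteq> cdom c" "\<And>p. p \<notin> S \<Longrightarrow> \<theta> p = 0"
  shows "(\<integral>p. indicator K p * tested \<theta> p \<partial>\<mu>) = 0"
proof -
  define C where "C = snd c ` (K \<inter> S)"
  have KS: "compact (K \<inter> S)" using compact_K S(1) by (simp add: compact_Int_closed compact_imp_closed)
  have C: "compact C" unfolding C_def
    by (rule compact_continuous_image[OF continuous_on_subset[OF continuous_chart[OF c]] KS]) (use S in auto)
  have CV: "C \<subseteq> cimg c" using S(2) by (auto simp: C_def)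
  have KSC: "chart_inv c y \<in> K \<Longrightarrow> chart_inv c y \<in> S \<Longrightarrow> y \<in> C" if "y \<in> cimg c" for y
    using that c unfolding C_def by (metis Int_iff chart_chart_inv image_eqI)
  \<comment> \<open>The sign between the two-form and its density. It is only locally constant, as
    the chart image may be disconnected, but that is enough to differentiate through it.\<close>
  define \<sigma> where "\<sigma> = (\<lambda>y. sgn (cM c (0, y)))"
  \<comment> \<open>\<omega> vanishes off \<open>K\<close> and \<theta> off \<open>S\<close>, so the
    extension of their product by zero to the whole plane vanishes off the compact set
    \<open>C\<close>.\<close>
  define g where "g = (\<lambda>v y. if y \<in> cimg c then \<sigma> y * (\<theta> (chart_inv c y) * om c (chart_inv c y) v) else 0)"
  have g0: "g v y = 0" if "y \<notin> C" for v y
    using that KSC[of y] S(3)[of "chart_inv c y"] om_off[of "chart_inv c y" c v]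
    by (cases "chart_inv c y \<in> K"; cases "chart_inv c y \<in> S") (auto simp: g_def)
  have \<sigma>: "\<exists>U. open U \<and> y \<in> U \<and> U \<subseteq> cimg c \<and> (\<forall>z\<in>U. \<sigma> z = \<sigma> y)" if y: "y \<in> cimg c" for y
  proof -
    have cont: "continuous_on (cimg c) (\<lambda>y. cM c (0, y))" by (rule continuous_cM_0[OF zero_I c])
    let ?U = "(\<lambda>z. cM c (0, z) * cM c (0, y)) -` {0<..} \<inter> cimg c"
    have "open ?U"
      using continuous_open_preimage[OF continuous_on_mult_right[OF cont] open_img[OF c], of "{0<..}" "cM c (0, y)"]
      by (simp add: Int_commute)
    moreover have "y \<in> ?U" using y cM_nonzero[OF c, of "(0, y)"] zero_I by (auto simp: zero_less_mult_iff linorder_neq_iff)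
    moreover have "\<sigma> z = \<sigma> y" if "z \<in> ?U" for z using that by (auto simp: \<sigma>_def zero_less_mult_iff)
    ultimately show ?thesis by (intro exI[of _ ?U]) blast
  qed
  define Dg where "Dg = (\<lambda>v y w. if y \<in> cimg c then \<sigma> y * (\<theta> (chart_inv c y) * dd (\<lambda>y. om c (chart_inv c y) v) y w
      + dmap c \<theta> (chart_inv c y) w * om c (chart_inv c y) v) else 0)"
  have der: "(g v has_derivative Dg v y) (at y)" for v y
  proof (cases "y \<in> cimg c")
    case True
    obtain U where U: "open U" "y \<in> U" "U \<subseteq> cimg c" "\<And>z. z \<in> U \<Longrightarrow> \<sigma> z = \<sigma> y" using \<sigma>[OF True] by blast
    have 1: "((\<lambda>y. \<theta> (chart_inv c y)) has_derivative dmap c \<theta> (chart_inv c y)) (at y)"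
      using C1_map_has_derivative[OF \<theta> c True] by (simp add: o_def)
    have 2: "((\<lambda>y. om c (chart_inv c y) v) has_derivative dd (\<lambda>y. om c (chart_inv c y) v) y) (at y)"
      by (rule smooth_on_has_derivative[OF smooth_om[OF c] True])
    have "((\<lambda>z. \<sigma> y * (\<theta> (chart_inv c z) * om c (chart_inv c z) v)) has_derivative Dg v y) (at y)"
      using has_derivative_mult_right[OF has_derivative_mult[OF 1 2], of "\<sigma> y"] True by (simp add: Dg_def)
    then show ?thesis
      by (rule has_derivative_transform_within_open[OF _ U(1,2)]) (use U(3,4) in \<open>auto simp: g_def\<close>)
  next
    case False
    have "(g v has_derivative (\<lambda>w. 0)) (at y)"
      by (rule has_derivative_transform_within_open[OF has_derivative_const[of 0], of "- C"])
        (use C CV False g0 in \<open>auto intro: compact_imp_closed\<close>)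
    then show ?thesis using False by (simp add: Dg_def[abs_def])
  qed
  have Dg0: "Dg v y w = 0" if "y \<notin> C" for v y w
  proof -
    have "(g v has_derivative (\<lambda>w. 0)) (at y)"
      by (rule has_derivative_transform_within_open[OF has_derivative_const[of 0], of "- C"])
        (use C that g0 in \<open>auto intro: compact_imp_closed\<close>)
    from has_derivative_unique[OF der this] show ?thesis by simp
  qed
  have cont: "continuous_on UNIV (\<lambda>y. Dg v y w)" for v w
  proof -
    have "isCont (\<lambda>y. Dg v y w) y" for y
    proof (cases "y \<in> cimg c")
      case True
      obtain U where U: "open U" "y \<in> U" "U \<subseteq> cimg c" "\<And>z. z \<in> U \<Longrightarrow> \<sigma> z = \<sigma> y" using \<sigma>[OF True] by blast
      have "continuous_on (cimg c) (\<lambda>z. \<sigma> y * (\<theta> (chart_inv c z) * dd (\<lambda>y. om c (chart_inv c y) v) z w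
         + dmap c \<theta> (chart_inv c z) w * om c (chart_inv c z) v))"
        by (intro continuous_intros C1_map_continuous_derivative[OF \<theta> c] smooth_on_continuous_on[OF smooth_om[OF c]]
            smooth_on_continuous_on[OF smooth_on_derivative[OF smooth_om[OF c]]]
            continuous_on_compose2[OF C1_map_continuous[OF \<theta>] continuous_chart_inv[OF c]]) auto
      from continuous_on_subset[OF this U(3)] have "continuous_on U (\<lambda>y. Dg v y w)"
        by (rule continuous_on_eq) (use U(3,4) in \<open>auto simp: Dg_def\<close>)
      then show ?thesis using U(1,2) by (simp add: continuous_on_eq_continuous_at)
    next
      case False
      have "continuous_on (- C) (\<lambda>y. Dg v y w)"
        by (rule continuous_on_eq[OF continuous_on_const[of _ 0]]) (use Dg0 in simp)
      moreover have "open (- C)" using C by (auto intro: compact_imp_closed)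
      ultimately show ?thesis using False CV by (auto simp: continuous_on_eq_continuous_at)
    qed
    then show ?thesis by (simp add: continuous_at_imp_continuous_on)
  qed
  note z = integral_derivative_compact_support[OF der cont C g0]
  \<comment> \<open>In coordinates the integrand is -2 times the curl of the field with components
    \<open>g ex1\<close> and \<open>g ex2\<close>; off \<open>C\<close> both sides vanish.\<close>
  have pt: "indicator (cimg c) y * (a0 c (chart_inv c y) * (indicator K (chart_inv c y) * tested \<theta> (chart_inv c y))) =
     - 2 * (Dg ex2 y ex1 - Dg ex1 y ex2)" for y
  proof (cases "y \<in> cimg c")
    case V: True
    let ?p = "chart_inv c y" and ?M = "cM c (0, y)"
    have p: "?p \<in> cdom c" using V c by simp
    show ?thesis
    proof (cases "?p \<in> K")
      case True
      have M0: "?M \<noteq> 0" using cM_nonzero[OF c, of "(0, y)"] zero_I V by simp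
      have w: "?M * wedge \<theta> c ?p = dmap c \<theta> ?p ex1 * om c ?p ex2 - dmap c \<theta> ?p ex2 * om c ?p ex1"
        using M0 lag_F(3)[OF c zero_I V] by (simp add: wedge_def F0)
      have a: "a0 c ?p = \<sigma> y * ?M" using a0_chart[OF c V] by (simp add: \<sigma>_def abs_sgn mult.commute)
      have "a0 c ?p * tested \<theta> ?p = \<sigma> y * (\<theta> ?p * (?M * drho 0 ?p) - 2 * (?M * wedge \<theta> c ?p))"
        unfolding a tested_chart[OF \<theta> c p] by (simp add: algebra_simps)
      also have "\<dots> = - 2 * (Dg ex2 y ex1 - Dg ex1 y ex2)"
        unfolding drho_first_variation[OF c V] w using V by (simp add: Dg_def algebra_simps)
      finally show ?thesis using V True by simp
    next
      case False
      then have "y \<notin> C" using c S(2) by (auto simp: C_def)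
      then show ?thesis using False Dg0 by simp
    qed
  next
    case False
    then have "y \<notin> C" using CV by blast
    then show ?thesis using Dg0 False by simp
  qed
  have mt: "(\<lambda>p. indicator K p * tested \<theta> p) \<in> borel_measurable borel"
    using borel_measurable_continuous_onI[OF continuous_tested[OF \<theta>]] K_borel by measurable
  \<comment> \<open>\<theta> vanishes on the open complement of \<open>S\<close>, so its
    differential vanishes there as well.\<close>
  have out: "indicator K p * tested \<theta> p = 0" if p: "p \<notin> cdom c" for p
  proof -
    have pS: "p \<notin> S" using p S(2) by auto
    let ?d = "some_chart p"
    note d = some_chart[of p]
    have "dmap ?d \<theta> p v = 0" for v
    proof -
      have y: "snd ?d p \<in> cimg ?d" using d by simp
      have "(\<theta> \<circ> chart_inv ?d has_derivative (\<lambda>v. 0)) (at (snd ?d p))"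
        by (rule has_derivative_transform_within_open[OF has_derivative_const[of 0]
              open_chart_inv_preimage[OF d(1), of "- S"]])
          (use S(1,3) pS d in \<open>auto intro: compact_imp_closed\<close>)
      from has_derivative_unique[OF C1_map_has_derivative[OF \<theta> d(1) y] this] show ?thesis using d by simp
    qed
    then show ?thesis using S(3)[OF pS] by (simp add: tested_def wedge_def)
  qed
  have "(\<integral>p. indicator K p * tested \<theta> p \<partial>\<mu>) = (\<integral>y. - 2 * (Dg ex2 y ex1 - Dg ex1 y ex2) \<partial>lborel)"
    using integral_has_area_density[OF mu area_density_a0 c mt out] unfolding pt by simp
  also have "\<dots> = 0" using z by simp
  finally show ?thesis .
qed

lemma dmap_locally_const:
  assumes "c \<in> A" "p \<in> cdom c" "open U" "p \<in> U" "\<And>q. q \<in> U \<Longrightarrow> \<theta> q = (k::real)"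
  shows "dmap c \<theta> p v = 0"
proof -
  have "(\<theta> \<circ> chart_inv c has_derivative (\<lambda>v. 0)) (at (snd c p))"
    by (rule has_derivative_transform_within_open[OF has_derivative_const[of k] open_chart_inv_preimage[OF assms(1,3)]])
      (use assms in auto)
  from frechet_derivative_at[OF this] show ?thesis by (simp add: dmap_def fun_eq_iff)
qed

lemma tested_diff:
  assumes "C1_map \<phi>" "C1_map \<psi>"
  shows "tested (\<lambda>p. \<phi> p - \<psi> p) p = tested \<phi> p - tested \<psi> p"
proof -
  let ?c = "some_chart p"
  note c = some_chart[of p]
  have y: "snd ?c p \<in> cimg ?c" using c by simp
  have "((\<lambda>p. \<phi> p - \<psi> p) \<circ> chart_inv ?c has_derivative (\<lambda>v. dmap ?c \<phi> p v - dmap ?c \<psi> p v)) (at (snd ?c p))"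
    using has_derivative_diff[OF C1_map_has_derivative[OF assms(1) c(1) y] C1_map_has_derivative[OF assms(2) c(1) y]] c
    by (simp add: o_def)
  from frechet_derivative_at[OF this]
  have e: "dmap ?c (\<lambda>p. \<phi> p - \<psi> p) p v = dmap ?c \<phi> p v - dmap ?c \<psi> p v" for v
    unfolding dmap_def[of _ "\<lambda>p. \<phi> p - \<psi> p"] by (metis (no_types, lifting))
  show ?thesis unfolding tested_def wedge_def e by (simp add: algebra_simps diff_divide_distrib add_divide_distrib)
qed

lemma C1_map_prod:
  "finite P \<Longrightarrow> (\<And>i. i \<in> P \<Longrightarrow> C1_map (b i)) \<Longrightarrow> C1_map (\<lambda>p. \<Prod>i\<in>P. 1 - b i p)"
  by (induction P rule: finite_induct) (simp_all add: C1_map_const C1_map_mult C1_map_diff)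

text \<open>Instead of a partition of unity: for bumps \<open>b\<^sub>i\<close> equal to \<open>1\<close> on sets covering \<open>K\<close>, the integral
  tested with \<open>\<Prod>(1 - b\<^sub>i)\<close> vanishes, and each factor \<open>1 - b\<^sub>i\<close> may be dropped because \<open>b\<^sub>i\<close> is supported
  in a single chart.\<close>

lemma integral_drho_zero: "(\<integral>p. indicator K p * drho 0 p \<partial>\<mu>) = 0"
proof -
  \<comment> \<open>A bump of radius \<open>r\<close> extends to distance \<open>2 * r\<close>, and
    the ball of that radius must fit into the chart image.\<close>
  have "\<exists>c r. c \<in> A \<and> q \<in> cdom c \<and> r > 0 \<and> cball (snd c q) (2 * r) \<subseteq> cimg c" for q
  proof -
    obtain c where c: "c \<in> A" "q \<in> cdom c" using dom_cover by blast
    obtain r where "r > 0" "cball (snd c q) r \<subseteq> cimg c" using compact_chart_neighbourhood[OF c] .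
    then show ?thesis using c by (intro exI[of _ c] exI[of _ "r/2"]) simp
  qed
  then obtain ch rd where ch: "\<And>q. ch q \<in> A" "\<And>q. q \<in> cdom (ch q)" "\<And>q. rd q > 0"
    "\<And>q. cball (snd (ch q) q) (2 * rd q) \<subseteq> cimg (ch q)" by metis
  define W where "W = (\<lambda>q. {p \<in> cdom (ch q). snd (ch q) p \<in> ball (snd (ch q) q) (rd q)})"
  define b where "b = (\<lambda>q. chart_bump (ch q) (snd (ch q) q) (rd q))"
  have oW: "open (W q)" for q unfolding W_def by (rule open_chart_preimage[OF ch(1) open_ball])
  have qW: "q \<in> W q" for q using ch(2,3) by (simp add: W_def)
  have b1: "b q p = 1" if "p \<in> W q" for p q
    using that bump_eq_1[OF ch(3), of "snd (ch q) p"] by (simp add: W_def b_def chart_bump_def)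
  have bC: "C1_map (b q)" for q unfolding b_def by (rule C1_map_chart_bump[OF ch(1,3,4)])
  obtain P where P: "finite P" "K \<subseteq> (\<Union>q\<in>P. W q)"
    using compactE_image[OF compact_K, of K W] oW qW by (metis UN_I subsetI)
  let ?Q = "\<lambda>P p. \<Prod>q\<in>P. 1 - b q p"
  let ?int = "\<lambda>\<theta>. \<integral>p. indicator K p * tested \<theta> p \<partial>\<mu>"
  have step: "?int (?Q P) = ?int (?Q {})" if "finite P" for P
    using that
  proof (induction P rule: finite_induct)
    case (insert q P)
    have CQ: "C1_map (?Q P)" by (rule C1_map_prod) (use insert bC in auto)
    have Cb: "C1_map (\<lambda>p. b q p * ?Q P p)" by (rule C1_map_mult[OF bC CQ])
    let ?S = "chart_inv (ch q) ` cball (snd (ch q) q) (2 * rd q)"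
    have "?int (\<lambda>p. b q p * ?Q P p) = 0"
    proof (rule integral_tested_chart[OF Cb ch(1) compact_chart_ball[OF ch(1,4)]])
      show "?S \<subseteq> cdom (ch q)"
        by (rule image_subsetI, rule chart_inv_in_dom[OF ch(1)]) (use ch(4) in blast)
      show "b q p * ?Q P p = 0" if "p \<notin> ?S" for p
        using chart_bump_outside[OF ch(1,3) that] by (simp add: b_def)
    qed
    moreover have "?Q (insert q P) = (\<lambda>p. ?Q P p - b q p * ?Q P p)"
      using insert by (simp add: fun_eq_iff algebra_simps)
    then have "?int (?Q (insert q P)) = ?int (?Q P) - ?int (\<lambda>p. b q p * ?Q P p)"
      using integrable_on_K[OF continuous_tested[OF CQ]] integrable_on_K[OF continuous_tested[OF Cb]]
      by (simp add: tested_diff[OF CQ Cb] right_diff_distrib)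
    ultimately show ?case using insert by simp
  qed simp
  have "indicator K p * tested (?Q P) p = 0" for p
  proof (cases "p \<in> K")
    case True
    then obtain q where q: "q \<in> P" "p \<in> W q" using P by blast
    \<comment> \<open>The product vanishes on the whole open set \<open>W q\<close>, so its
      differential at \<open>p\<close> vanishes too and nothing of \<open>tested\<close>
      survives.\<close>
    have z: "?Q P p = 0" if "p \<in> W q" for p
      using q P(1) b1[OF that] by (intro prod_zero) auto
    have "dmap (some_chart p) (?Q P) p v = 0" for v
      by (rule dmap_locally_const[OF some_chart oW q(2)]) (rule z)
    then show ?thesis using z[OF q(2)] by (simp add: tested_def wedge_def)
  qed simp
  then have "(\<lambda>p. indicator K p * tested (?Q P) p) = (\<lambda>p. 0)" by (rule ext)
  then have "?int (?Q P) = 0" by simp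
  moreover have "tested (?Q {}) p = drho 0 p" for p
  proof -
    have "dmap (some_chart p) (\<lambda>p. 1::real) p v = 0" for v
      by (rule dmap_locally_const[OF some_chart open_UNIV UNIV_I refl])
    then show ?thesis by (simp add: tested_def wedge_def)
  qed
  ultimately show ?thesis using step[OF P(1)] by simp
qed

end

context atlas_surface begin

theorem conjugate_radius_imp_laguerre_minimal:
  assumes "laguerre_surface A f" "umbilical_free A f" "conjugate_radius f r \<eta>"
  shows "laguerre_minimal A f"
  unfolding laguerre_minimal_def
proof (intro conjI allI impI)
  fix \<epsilon> K F assume "laguerre_variation A f \<epsilon> K F"
  then interpret laguerre_first_variation A f r \<eta> \<epsilon> K F
    using assms by unfold_locales
  show "((\<lambda>t. laguerre_area A (F t) K) has_real_derivative 0) (at 0)"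
    using laguerre_area_derivative integral_drho_zero by simp
qed (use assms in auto)

end

subsection \<open>Minimal surfaces as models\<close>

text \<open>\<open>\<real>\<^sup>3\<^sub>1\<close> and \<open>\<real>\<^sup>3\<^sub>0\<close> are treated together: \<open>\<kappa> = 0\<close> is \<open>\<real>\<^sup>3\<^sub>1\<close>, and \<open>\<kappa> = 1\<close> is \<open>\<real>\<^sup>3\<^sub>0\<close> in the coordinates
  \<open>(x\<^sub>0, x\<^sub>1)\<close> that omit the redundant first component of \<open>\<real>\<^sup>4\<^sub>1\<close>. In either case
  \<open>\<xi>' = (e + P \<xi>) / \<xi>\<^sub>1\<close> and \<open>x' = P x - x\<^sub>1 \<xi>'\<close> with the linear map \<open>P = frame_map \<kappa>\<close>, and
  \<open>conormal_coeff\<close> is the last coefficient of the linear relation satisfied by \<open>dx\<close>.\<close>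

definition frame_map :: "real \<Rightarrow> real^3 \<Rightarrow> real^3" where
  "frame_map \<kappa> u = vector [\<kappa> * u$3, u$1, u$2]"

definition frame_metric :: "real \<Rightarrow> real^3 \<Rightarrow> real^3 \<Rightarrow> real" where
  "frame_metric \<kappa> u w = u$1 * w$1 + u$2 * w$2 + (\<kappa>\<^sup>2 - 1) * (u$3 * w$3)"

definition conormal_coeff :: "real \<Rightarrow> real^3 \<Rightarrow> real" where
  "conormal_coeff \<kappa> \<xi> = \<kappa> + (\<kappa>\<^sup>2 - 1) * \<xi>$3"

definition frame_normal :: "real \<Rightarrow> real^3 \<Rightarrow> real^3" where
  "frame_normal \<kappa> \<xi> = (1 / \<xi>$3) *\<^sub>R (axis 1 1 + frame_map \<kappa> \<xi>)"

definition frame_contact :: "real \<Rightarrow> real^3 \<Rightarrow> real^3 \<Rightarrow> (real^3) \<times> (real^3)" where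
  "frame_contact \<kappa> x \<xi> = (frame_map \<kappa> x - x$3 *\<^sub>R frame_normal \<kappa> \<xi>, frame_normal \<kappa> \<xi>)"

lemma bounded_linear_frame_map: "bounded_linear (frame_map \<kappa>)"
  unfolding frame_map_def vector_3_eq
  by (intro bounded_linear_add bounded_linear_scaleR_const bounded_linear_const_mult bounded_linear_vec_nth)

lemma frame_normal_unit:
  assumes "\<xi>$3 \<noteq> 0" "(1 + \<kappa> * \<xi>$3)\<^sup>2 + (\<xi>$1)\<^sup>2 + (\<xi>$2)\<^sup>2 = (\<xi>$3)\<^sup>2"
  shows "frame_normal \<kappa> \<xi> \<bullet> frame_normal \<kappa> \<xi> = 1"
proof -
  have "frame_normal \<kappa> \<xi> \<bullet> frame_normal \<kappa> \<xi> = ((1 + \<kappa> * \<xi>$3)\<^sup>2 + (\<xi>$1)\<^sup>2 + (\<xi>$2)\<^sup>2) / (\<xi>$3)\<^sup>2"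
    using assms(1) by (simp add: frame_normal_def frame_map_def inner_3 axis_def power2_eq_square field_simps)
  then show ?thesis using assms by simp
qed

text \<open>The relation assumed for \<open>u\<close> is the one satisfied by dx. The last
  coordinate is then the normal component of \<open>frame_map \<kappa> u\<close>, the amount to
  subtract to make it tangential.\<close>

lemma frame_normal_inner:
  assumes "\<xi>$3 \<noteq> 0" "\<xi>$1 * u$1 + \<xi>$2 * u$2 + conormal_coeff \<kappa> \<xi> * u$3 = 0"
  shows "frame_normal \<kappa> \<xi> \<bullet> frame_map \<kappa> u = u$3"
proof -
  have e: "\<xi>$1 * u$1 + \<xi>$2 * u$2 = - conormal_coeff \<kappa> \<xi> * u$3" using assms(2) by simp
  have "frame_normal \<kappa> \<xi> \<bullet> frame_map \<kappa> u = ((1 + \<kappa> * \<xi>$3) * (\<kappa> * u$3) + (\<xi>$1 * u$1 + \<xi>$2 * u$2)) / \<xi>$3"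
    using assms(1) by (simp add: frame_normal_def frame_map_def inner_3 axis_def field_simps)
  also have "\<dots> = u$3" unfolding e using assms(1) by (simp add: conormal_coeff_def power2_eq_square field_simps)
  finally show ?thesis .
qed

text \<open>These relations express that \<xi>_1 dx_2 - \<xi>_2 dx_1 is conjugate to dx_3 in the
  induced metric. Both vectors are orthogonal to one conormal, so \<open>cross3 u w\<close> is a
  multiple \<open>k\<close> of it and both sides become multiples of \<open>k\<close>.\<close>

lemma frame_normal_tp:
  assumes \<xi>: "\<xi>$3 \<noteq> 0" "(1 + \<kappa> * \<xi>$3)\<^sup>2 + (\<xi>$1)\<^sup>2 + (\<xi>$2)\<^sup>2 = (\<xi>$3)\<^sup>2"
    and u: "\<xi>$1 * u$1 + \<xi>$2 * u$2 + conormal_coeff \<kappa> \<xi> * u$3 = 0"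
    and w: "\<xi>$1 * w$1 + \<xi>$2 * w$2 + conormal_coeff \<kappa> \<xi> * w$3 = 0"
    and n0: "vector [\<xi>$1, \<xi>$2, conormal_coeff \<kappa> \<xi>] \<noteq> (0 :: real^3)"
  shows "tp (frame_normal \<kappa> \<xi>) (frame_map \<kappa> u) (frame_map \<kappa> w) * (\<xi>$1 * u$2 - \<xi>$2 * u$1) =
      - (frame_metric \<kappa> u u * w$3 - frame_metric \<kappa> u w * u$3)"
    "tp (frame_normal \<kappa> \<xi>) (frame_map \<kappa> u) (frame_map \<kappa> w) * (\<xi>$1 * w$2 - \<xi>$2 * w$1) =
      - (frame_metric \<kappa> u w * w$3 - frame_metric \<kappa> w w * u$3)"
proof -
  define m :: "real^3" where "m = vector [\<xi>$1, \<xi>$2, conormal_coeff \<kappa> \<xi>]"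
  have m: "m$1 = \<xi>$1" "m$2 = \<xi>$2" "m$3 = conormal_coeff \<kappa> \<xi>" by (simp_all add: m_def vector_3)
  have mu: "m \<bullet> u = 0" "m \<bullet> w = 0" using u w by (simp_all add: inner_3 m)
  have mm: "m \<bullet> m \<noteq> 0" using n0 by (simp add: m_def)
  obtain k where k: "cross3 u w = k *\<^sub>R m"
  proof
    have "cross3 m (cross3 u w) = 0" using mu by (simp add: Lagrange)
    then have "(m \<bullet> cross3 u w) *\<^sub>R m - (m \<bullet> m) *\<^sub>R cross3 u w = 0" by (metis Lagrange cross_zero_right)
    then have "(m \<bullet> m) *\<^sub>R cross3 u w = (m \<bullet> cross3 u w) *\<^sub>R m" by simp
    then have "(1 / (m \<bullet> m)) *\<^sub>R ((m \<bullet> m) *\<^sub>R cross3 u w) = ((m \<bullet> cross3 u w) / (m \<bullet> m)) *\<^sub>R m" by simp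
    then show "cross3 u w = ((m \<bullet> cross3 u w) / (m \<bullet> m)) *\<^sub>R m" using mm by simp
  qed
  have c: "u$2 * w$3 - u$3 * w$2 = k * \<xi>$1" "u$3 * w$1 - u$1 * w$3 = k * \<xi>$2"
    "u$1 * w$2 - u$2 * w$1 = k * conormal_coeff \<kappa> \<xi>"
    using arg_cong[OF k, of "\<lambda>v. v$1"] arg_cong[OF k, of "\<lambda>v. v$2"] arg_cong[OF k, of "\<lambda>v. v$3"]
    by (simp_all add: cross_components m mult.commute)
  have "\<xi>$3 * tp (frame_normal \<kappa> \<xi>) (frame_map \<kappa> u) (frame_map \<kappa> w) =
      tp (axis 1 1 + frame_map \<kappa> \<xi>) (frame_map \<kappa> u) (frame_map \<kappa> w)"
    using \<xi>(1) by (simp add: frame_normal_def)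
  also have "\<dots> = (1 + \<kappa> * \<xi>$3) * (u$1 * w$2 - u$2 * w$1)
     + \<kappa> * \<xi>$1 * (u$2 * w$3 - u$3 * w$2) + \<kappa> * \<xi>$2 * (u$3 * w$1 - u$1 * w$3)"
    by (simp add: tp_def frame_map_def axis_def vector_3 algebra_simps)
  also have "\<dots> = k * ((1 + \<kappa> * \<xi>$3) * conormal_coeff \<kappa> \<xi> + \<kappa> * ((\<xi>$1)\<^sup>2 + (\<xi>$2)\<^sup>2))"
    unfolding c by (simp add: power2_eq_square algebra_simps)
  \<comment> \<open>With s = 1 + \<kappa> \<xi>_3 the conormal coefficient is \<kappa> s - \<xi>_3;
    eliminating \<xi>_1 and \<xi>_2 by the quadric leaves the factor - \<xi>_3.\<close>
  also have "(\<xi>$1)\<^sup>2 + (\<xi>$2)\<^sup>2 = (\<xi>$3)\<^sup>2 - (1 + \<kappa> * \<xi>$3)\<^sup>2" using \<xi>(2) by simp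
  also have "k * ((1 + \<kappa> * \<xi>$3) * conormal_coeff \<kappa> \<xi> + \<kappa> * ((\<xi>$3)\<^sup>2 - (1 + \<kappa> * \<xi>$3)\<^sup>2)) = \<xi>$3 * (- k)"
    by (simp add: conormal_coeff_def power2_eq_square algebra_simps)
  finally have T: "tp (frame_normal \<kappa> \<xi>) (frame_map \<kappa> u) (frame_map \<kappa> w) = - k"
    by (simp only: mult_left_cancel[OF \<xi>(1)])
  have "frame_metric \<kappa> u u * w$3 - frame_metric \<kappa> u w * u$3 =
      u$2 * (u$2 * w$3 - u$3 * w$2) - u$1 * (u$3 * w$1 - u$1 * w$3)"
    "frame_metric \<kappa> u w * w$3 - frame_metric \<kappa> w w * u$3 =
      w$2 * (u$2 * w$3 - u$3 * w$2) - w$1 * (u$3 * w$1 - u$1 * w$3)"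
    by (simp_all add: frame_metric_def algebra_simps)
  then show "tp (frame_normal \<kappa> \<xi>) (frame_map \<kappa> u) (frame_map \<kappa> w) * (\<xi>$1 * u$2 - \<xi>$2 * u$1) =
      - (frame_metric \<kappa> u u * w$3 - frame_metric \<kappa> u w * u$3)"
    "tp (frame_normal \<kappa> \<xi>) (frame_map \<kappa> u) (frame_map \<kappa> w) * (\<xi>$1 * w$2 - \<xi>$2 * w$1) =
      - (frame_metric \<kappa> u w * w$3 - frame_metric \<kappa> w w * u$3)"
    unfolding T c by (simp_all add: algebra_simps)
qed

text \<open>By Cayley-Hamilton a traceless S satisfies S^2 = - det S, and self-adjointness turns <S
  u, S v> into <S^2 u, v>. So S pulls the metric back to a multiple of itself.\<close>

lemma traceless_self_adjoint_gram:
  fixes \<alpha> \<beta> \<gamma> \<delta> E F G :: real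
  assumes tr: "\<alpha> + \<delta> = 0" and sym: "\<alpha> * F + \<gamma> * G = \<beta> * E + \<delta> * F"
  shows "\<alpha> * (\<alpha> * E + \<gamma> * F) + \<gamma> * (\<alpha> * F + \<gamma> * G) = - (\<alpha> * \<delta> - \<gamma> * \<beta>) * E"
    "\<alpha> * (\<beta> * E + \<delta> * F) + \<gamma> * (\<beta> * F + \<delta> * G) = - (\<alpha> * \<delta> - \<gamma> * \<beta>) * F"
    "\<beta> * (\<beta> * E + \<delta> * F) + \<delta> * (\<beta> * F + \<delta> * G) = - (\<alpha> * \<delta> - \<gamma> * \<beta>) * G"
proof -
  have d: "\<delta> = - \<alpha>" using tr by simp
  have s: "\<gamma> * G = \<beta> * E - 2 * \<alpha> * F" using sym by (simp add: d algebra_simps)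
  have "\<gamma> * (\<gamma> * G) = \<gamma> * (\<beta> * E - 2 * \<alpha> * F)" "\<alpha> * (\<gamma> * G) = \<alpha> * (\<beta> * E - 2 * \<alpha> * F)"
    "\<beta> * (\<gamma> * G) = \<beta> * (\<beta> * E - 2 * \<alpha> * F)"
    unfolding s by simp_all
  then show "\<alpha> * (\<alpha> * E + \<gamma> * F) + \<gamma> * (\<alpha> * F + \<gamma> * G) = - (\<alpha> * \<delta> - \<gamma> * \<beta>) * E"
    "\<alpha> * (\<beta> * E + \<delta> * F) + \<gamma> * (\<beta> * F + \<delta> * G) = - (\<alpha> * \<delta> - \<gamma> * \<beta>) * F"
    "\<beta> * (\<beta> * E + \<delta> * F) + \<delta> * (\<beta> * F + \<delta> * G) = - (\<alpha> * \<delta> - \<gamma> * \<beta>) * G"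
    by (simp_all add: d algebra_simps)
qed

text \<open>\<open>quadric\<close> is the normalisation of \<xi>: for \<kappa> = 0 it says <\<xi>,
  \<xi>> = -1, for \<kappa> = 1 it says <\<xi>, \<xi>> = 0 with the omitted first component
  \<open>\<xi> p$3 + 1\<close>. In both cases it makes \<xi>' a unit vector. \<open>tangent\<close>
  is <\<xi>, dx> = 0, and \<open>frame_metric\<close> is the ambient form on differentials.\<close>

locale minimal_model = atlas_surface A
  for A :: "'a::{t2_space,second_countable_topology} chart set" +
  fixes \<kappa> :: real and x \<xi> :: "'a \<Rightarrow> real^3"
  assumes smooth_x: "smooth_map A x" and smooth_xi: "smooth_map A \<xi>"
    and xi3: "\<And>p. \<xi> p$3 \<noteq> 0"
    and quadric: "\<And>p. (1 + \<kappa> * \<xi> p$3)\<^sup>2 + (\<xi> p$1)\<^sup>2 + (\<xi> p$2)\<^sup>2 = (\<xi> p$3)\<^sup>2"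
    and tangent: "\<And>c p v. c \<in> A \<Longrightarrow> p \<in> cdom c \<Longrightarrow>
      \<xi> p$1 * dmap c x p v$1 + \<xi> p$2 * dmap c x p v$2 + conormal_coeff \<kappa> (\<xi> p) * dmap c x p v$3 = 0"
    and posdef: "\<And>c p v. c \<in> A \<Longrightarrow> p \<in> cdom c \<Longrightarrow> v \<noteq> 0 \<Longrightarrow> frame_metric \<kappa> (dmap c x p v) (dmap c x p v) > 0"
    and nonzero: "nonzero_principal_curvatures A x \<xi>" and minimal: "minimal_surface A x \<xi>"
begin

definition contact :: "'a contact_map" where "contact p = frame_contact \<kappa> (x p) (\<xi> p)"

definition conj_form :: "'a chart \<Rightarrow> 'a \<Rightarrow> real^2 \<Rightarrow> real" where
  "conj_form c p v = \<xi> p$1 * dmap c x p v$2 - \<xi> p$2 * dmap c x p v$1"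

text \<open>If it vanished, the quadric would force \<kappa>^2 = 1, and then the last entry would be
  \<kappa> itself.\<close>

lemma conormal_nonzero: "vector [\<xi> p$1, \<xi> p$2, conormal_coeff \<kappa> (\<xi> p)] \<noteq> (0 :: real^3)"
proof
  assume "vector [\<xi> p$1, \<xi> p$2, conormal_coeff \<kappa> (\<xi> p)] = (0 :: real^3)"
  then have z: "\<xi> p$1 = 0" "\<xi> p$2 = 0" "conormal_coeff \<kappa> (\<xi> p) = 0"
    by (simp_all add: vec_eq_iff forall_3 vector_3)
  let ?c = "\<xi> p$3" and ?s = "1 + \<kappa> * \<xi> p$3"
  have 1: "?s\<^sup>2 = ?c\<^sup>2" using quadric[of p] z by simp
  have 2: "\<kappa> * ?s = ?c" using z(3) by (simp add: conormal_coeff_def power2_eq_square algebra_simps)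
  have s: "?s \<noteq> 0" using 1 xi3[of p] by auto
  have "\<kappa>\<^sup>2 * ?s\<^sup>2 = ?s\<^sup>2" using 1 2 by (metis power_mult_distrib)
  then have "\<kappa>\<^sup>2 = 1" using s by simp
  then show False using z(3) by (simp add: conormal_coeff_def)
qed

text \<open>Half the derivative of \<open>quadric\<close>. Thus d\<xi> takes values in the same
  plane as dx, on which the existence of the shape operator rests.\<close>

lemma conormal_xi:
  assumes c: "c \<in> A" "p \<in> cdom c"
  shows "\<xi> p$1 * dmap c \<xi> p v$1 + \<xi> p$2 * dmap c \<xi> p v$2 + conormal_coeff \<kappa> (\<xi> p) * dmap c \<xi> p v$3 = 0"
proof -
  let ?y = "snd c p"
  have y: "?y \<in> cimg c" using c by simp
  let ?X = "\<xi> \<circ> chart_inv c"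
  have D: "(?X has_derivative dmap c \<xi> p) (at ?y)" using smooth_map_has_derivative[OF smooth_xi c(1) y] c by simp
  have Di: "((\<lambda>y. ?X y$i) has_derivative (\<lambda>v. dmap c \<xi> p v$i)) (at ?y)" for i
    by (rule bounded_linear.has_derivative[OF bounded_linear_vec_nth D])
  have Q: "(1 + \<kappa> * ?X y$3) * (1 + \<kappa> * ?X y$3) + ?X y$1 * ?X y$1 + ?X y$2 * ?X y$2 - ?X y$3 * ?X y$3 = 0" for y
    using quadric[of "chart_inv c y"] by (simp add: power2_eq_square)
  have Dl: "((\<lambda>y. 1 + \<kappa> * ?X y$3) has_derivative (\<lambda>v. \<kappa> * dmap c \<xi> p v$3)) (at ?y)"
    using has_derivative_add[OF has_derivative_const has_derivative_mult_right[OF Di[of 3]], of 1 \<kappa>] by simp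
  note H = has_derivative_diff[OF has_derivative_add[OF has_derivative_add[OF has_derivative_mult[OF Dl Dl]
        has_derivative_mult[OF Di[of 1] Di[of 1]]] has_derivative_mult[OF Di[of 2] Di[of 2]]] has_derivative_mult[OF Di[of 3] Di[of 3]]]
  from fun_cong[OF has_derivative_unique[OF H[unfolded Q] has_derivative_const], of v]
  show ?thesis using c by (simp add: conormal_coeff_def power2_eq_square algebra_simps)
qed

text \<open>The operator exists since dx and d\<xi> share a tangent plane, and it is self-adjoint by
  differentiating \<open>tangent\<close>. Then \<open>eigenvalues_self_adjoint\<close> translates
  minimality and nonzero curvatures into trace zero and negative determinant.\<close>

lemma shape_operator:
  assumes c: "c \<in> A" "p \<in> cdom c"
  obtains S where "linear S" "\<And>v. dmap c \<xi> p v = - dmap c x p (S v)" "tr2 S = 0" "det2 S < 0"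
    "S ex1$1 * frame_metric \<kappa> (dmap c x p ex1) (dmap c x p ex2) + S ex1$2 * frame_metric \<kappa> (dmap c x p ex2) (dmap c x p ex2)
     = S ex2$1 * frame_metric \<kappa> (dmap c x p ex1) (dmap c x p ex1) + S ex2$2 * frame_metric \<kappa> (dmap c x p ex1) (dmap c x p ex2)"
proof -
  define L where "L = dmap c x p"
  have lin: "linear L" "linear (dmap c \<xi> p)" unfolding L_def using linear_dmap smooth_x smooth_xi c by blast+
  have pos: "frame_metric \<kappa> (L v) (L v) > 0" if "v \<noteq> 0" for v using posdef[OF c that] by (simp add: L_def)
  have inj: "inj L"
    unfolding linear_injective_0[OF lin(1)] using pos by (force simp: frame_metric_def)
  define m :: "real^3" where "m = vector [\<xi> p$1, \<xi> p$2, conormal_coeff \<kappa> (\<xi> p)]"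
  have "m \<noteq> 0" using conormal_nonzero by (simp add: m_def)
  moreover have "m \<bullet> L v = 0" "m \<bullet> dmap c \<xi> p v = 0" for v
    using tangent[OF c, of v] conormal_xi[OF c, of v] by (simp_all add: inner_3 m_def vector_3 L_def)
  ultimately obtain S where S: "linear S" "\<And>v. dmap c \<xi> p v = - L (S v)"
    using linear_factor_through_plane[OF lin inj] by blast
  have q: "neg_quotient c \<xi> x p = S"
    by (rule neg_quotient_unique) (use S inj in \<open>auto simp: L_def\<close>)
  let ?h = "frame_metric \<kappa>"
  have hs: "?h u w = ?h w u" for u w by (simp add: frame_metric_def mult.commute)
  have hl: "?h (u + v) w = ?h u w + ?h v w" "?h (k *\<^sub>R u) w = k * ?h u w" "?h (u - v) w = ?h u w - ?h v w" for u v w k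
    by (simp_all add: frame_metric_def algebra_simps)
  have hr: "?h w (u + v) = ?h w u + ?h w v" "?h w (k *\<^sub>R u) = k * ?h w u" "?h w (u - v) = ?h w u - ?h w v" for u v w k
    by (simp_all add: frame_metric_def algebra_simps)
  have LT: "L (S v) = S v$1 *\<^sub>R L ex1 + S v$2 *\<^sub>R L ex2" for v by (rule linear_real2[OF lin(1)])
  have symh: "?h (L (S v)) (L w) = ?h (L (S w)) (L v)" for v w
  proof -
    let ?y = "snd c p"
    have y: "?y \<in> cimg c" using c by simp
    define X where "X = x \<circ> chart_inv c"
    have smX: "smooth_on (cimg c) X" using smooth_map_smooth_on[OF smooth_x c(1)] by (simp add: X_def)
    have DX: "((\<lambda>z. dd X z v) has_derivative
       dd (\<lambda>z. dd X z v) ?y) (at ?y)" for v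
      by (rule smooth_on_has_derivative[OF smooth_on_derivative[OF smX] y])
    let ?X = "\<xi> \<circ> chart_inv c"
    have D: "(?X has_derivative dmap c \<xi> p) (at ?y)" using smooth_map_has_derivative[OF smooth_xi c(1) y] c by simp
    have Di: "((\<lambda>y. ?X y$i) has_derivative (\<lambda>v. dmap c \<xi> p v$i)) (at ?y)" for i
      by (rule bounded_linear.has_derivative[OF bounded_linear_vec_nth D])
    \<comment> \<open>The conormal field. It depends on \<xi> affinely, and its derivative paired
      with dx is the \<open>frame_metric\<close> of d\<xi> with dx.\<close>
    define N :: "real^2 \<Rightarrow> real^3" where "N = (\<lambda>y. ?X y$1 *\<^sub>R axis 1 1 + ?X y$2 *\<^sub>R axis 2 1 + (\<kappa> + (\<kappa>\<^sup>2 - 1) * ?X y$3) *\<^sub>R axis 3 1)"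
    define N' :: "real^2 \<Rightarrow> real^3" where "N' = (\<lambda>v. dmap c \<xi> p v$1 *\<^sub>R axis 1 1 + dmap c \<xi> p v$2 *\<^sub>R axis 2 1 + ((\<kappa>\<^sup>2 - 1) * dmap c \<xi> p v$3) *\<^sub>R axis 3 1)"
    have DN: "(N has_derivative N') (at ?y)"
    proof -
      have "((\<lambda>y. \<kappa> + (\<kappa>\<^sup>2 - 1) * ?X y$3) has_derivative (\<lambda>v. (\<kappa>\<^sup>2 - 1) * dmap c \<xi> p v$3)) (at ?y)"
        using has_derivative_add[OF has_derivative_const has_derivative_mult_right[OF Di[of 3]], of \<kappa> "\<kappa>\<^sup>2 - 1"] by simp
      then show ?thesis
        unfolding N_def N'_def
        by (intro has_derivative_add bounded_linear.has_derivative[OF bounded_linear_scaleR_left] Di)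
    qed
    have zero: "dd X z v \<bullet> N z = 0" if "z \<in> cimg c" for z v
      using tangent[OF c(1), of "chart_inv c z" v] c that
      by (simp add: dmap_def X_def N_def inner_3 axis_def conormal_coeff_def algebra_simps)
    have e: "dd (\<lambda>z. dd X z v) ?y w \<bullet> N ?y + L v \<bullet> N' w = 0" for v w
      using inner_const_derivative[OF DX DN open_img[OF c(1)] y, of v 0 w] zero c by (simp add: L_def dmap_def X_def)
    have N'h: "L v \<bullet> N' w = - ?h (L (S w)) (L v)" for v w
      unfolding N'_def S(2) by (simp add: inner_3 axis_def frame_metric_def algebra_simps)
    show ?thesis
      using e[of v w] e[of w v] smooth_on_symmetric_derivative[OF open_img[OF c(1)] smX y, of v w]
      unfolding N'h by simp
  qed
  have sym: "S ex1$1 * ?h (L ex1) (L ex2) + S ex1$2 * ?h (L ex2) (L ex2)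
     = S ex2$1 * ?h (L ex1) (L ex1) + S ex2$2 * ?h (L ex1) (L ex2)"
    using symh[of ex1 ex2] unfolding LT by (simp add: hl hs[of "L ex2" "L ex1"])
  have E: "?h (L ex1) (L ex1) > 0" by (rule pos) (simp add: axis_eq_0_iff)
  have EG: "?h (L ex1) (L ex1) * ?h (L ex2) (L ex2) - (?h (L ex1) (L ex2))\<^sup>2 > 0"
  proof -
    let ?E = "?h (L ex1) (L ex1)" and ?F = "?h (L ex1) (L ex2)" and ?G = "?h (L ex2) (L ex2)"
    \<comment> \<open>The Gram-Schmidt vector again, now for an ambient form that is positive
      definite only on the tangent plane.\<close>
    let ?v = "?F *\<^sub>R ex1 - ?E *\<^sub>R ex2"
    have "?v$2 \<noteq> 0" using E by (simp add: axis_def)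
    then have "?v \<noteq> 0" by (metis zero_index)
    then have "?h (L ?v) (L ?v) > 0" by (rule pos)
    also have "?h (L ?v) (L ?v) = ?E * (?E * ?G - ?F\<^sup>2)"
      by (simp add: linear_diff[OF lin(1)] linear_scale[OF lin(1)] hl hr hs[of "L ex2" "L ex1"] power2_eq_square algebra_simps)
    finally show ?thesis using E by (simp add: zero_less_mult_iff)
  qed
  note ev = eigenvalues_self_adjoint[OF S(1) E EG sym]
  let ?k = "principal_curvatures c x \<xi> p"
  have k: "fst ?k + snd ?k = 0" "fst ?k \<noteq> 0"
    using minimal nonzero c unfolding minimal_surface_def nonzero_principal_curvatures_def by blast+
  have "tr2 S = 0" using ev(2) k(1) by (simp add: principal_curvatures_def q)
  moreover have "det2 S < 0"
  proof -
    have "det2 S = fst ?k * snd ?k" using ev(3) by (simp add: principal_curvatures_def q)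
    also have "snd ?k = - fst ?k" using k(1) by simp
    also have "fst ?k * - fst ?k < 0"
    proof -
      have "0 < fst ?k * fst ?k" using k(2) by (meson not_real_square_gt_zero)
      then show ?thesis by simp
    qed
    finally show ?thesis .
  qed
  ultimately show thesis using that[OF S(1)] S(2) sym unfolding L_def by blast
qed

lemma smooth_contact: "smooth_map A (fst \<circ> contact)" "smooth_map A (snd \<circ> contact)"
proof -
  have "smooth_on (cimg c) (fst \<circ> contact \<circ> chart_inv c) \<and> smooth_on (cimg c) (snd \<circ> contact \<circ> chart_inv c)"
    if c: "c \<in> A" for c
  proof -
    note o = open_img[OF c]
    have sx: "smooth_on (cimg c) (\<lambda>y. x (chart_inv c y))" and s\<xi>: "smooth_on (cimg c) (\<lambda>y. \<xi> (chart_inv c y))"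
      using smooth_map_smooth_on[OF smooth_x c] smooth_map_smooth_on[OF smooth_xi c] by (simp_all add: o_def)
    note P = smooth_on_compose_linear[OF o bounded_linear_frame_map]
    have n: "smooth_on (cimg c) (\<lambda>y. frame_normal \<kappa> (\<xi> (chart_inv c y)))"
      unfolding frame_normal_def
      by (intro smooth_on_scaleR smooth_on_divide smooth_on_add smooth_on_const smooth_on_vec_nth o P s\<xi> xi3)
    have "smooth_on (cimg c) (\<lambda>y. frame_map \<kappa> (x (chart_inv c y)) - x (chart_inv c y)$3 *\<^sub>R frame_normal \<kappa> (\<xi> (chart_inv c y)))"
      by (intro smooth_on_diff smooth_on_scaleR smooth_on_vec_nth o P sx n)
    with n show ?thesis by (simp add: o_def contact_def frame_contact_def)
  qed
  then show "smooth_map A (fst \<circ> contact)" "smooth_map A (snd \<circ> contact)" by (auto simp: smooth_map_def)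
qed

text \<open>By \<open>contact_derivative\<close> this is dx' + x_3 dn, that is dx' + r dn with r =
  x_3.\<close>

definition sig :: "'a chart \<Rightarrow> 'a \<Rightarrow> real^2 \<Rightarrow> real^3" where
  "sig c p v = frame_map \<kappa> (dmap c x p v) - dmap c x p v$3 *\<^sub>R frame_normal \<kappa> (\<xi> p)"

text \<open>Obtained by differentiating the denominator-free identities \<xi>_3 n = e + P \<xi> and
  x' + x_3 n = P x.\<close>

lemma contact_derivative:
  assumes c: "c \<in> A" "p \<in> cdom c"
  shows "\<xi> p$3 *\<^sub>R dmap c (snd \<circ> contact) p v = frame_map \<kappa> (dmap c \<xi> p v) - dmap c \<xi> p v$3 *\<^sub>R frame_normal \<kappa> (\<xi> p)"
    "dmap c (fst \<circ> contact) p v = sig c p v - x p$3 *\<^sub>R dmap c (snd \<circ> contact) p v"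
proof -
  let ?y = "snd c p"
  have y: "?y \<in> cimg c" using c by simp
  have D: "((\<lambda>y. x (chart_inv c y)) has_derivative dmap c x p) (at ?y)" "((\<lambda>y. \<xi> (chart_inv c y)) has_derivative dmap c \<xi> p) (at ?y)"
    "((\<lambda>y. fst (contact (chart_inv c y))) has_derivative dmap c (fst \<circ> contact) p) (at ?y)"
    "((\<lambda>y. snd (contact (chart_inv c y))) has_derivative dmap c (snd \<circ> contact) p) (at ?y)"
    using smooth_map_has_derivative[OF smooth_x c(1) y] smooth_map_has_derivative[OF smooth_xi c(1) y]
      smooth_map_has_derivative[OF smooth_contact(1) c(1) y] smooth_map_has_derivative[OF smooth_contact(2) c(1) y] c
    by (simp_all add: o_def)
  note nth = bounded_linear.has_derivative[OF bounded_linear_vec_nth]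
    and P = bounded_linear.has_derivative[OF bounded_linear_frame_map]
  have e: "\<xi> q$3 *\<^sub>R snd (contact q) = axis 1 1 + frame_map \<kappa> (\<xi> q)"
    "fst (contact q) + x q$3 *\<^sub>R snd (contact q) = frame_map \<kappa> (x q)" for q
    using xi3[of q] by (simp_all add: contact_def frame_contact_def frame_normal_def)
  have n: "snd (contact p) = frame_normal \<kappa> (\<xi> p)" by (simp add: contact_def frame_contact_def)
  have 1: "((\<lambda>y. \<xi> (chart_inv c y)$3 *\<^sub>R snd (contact (chart_inv c y))) has_derivative
      (\<lambda>v. \<xi> p$3 *\<^sub>R dmap c (snd \<circ> contact) p v + dmap c \<xi> p v$3 *\<^sub>R frame_normal \<kappa> (\<xi> p))) (at ?y)"
    using has_derivative_scaleR[OF nth[OF D(2)] D(4), of 3] c by (simp add: n)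
  have 2: "((\<lambda>y. axis 1 1 + frame_map \<kappa> (\<xi> (chart_inv c y))) has_derivative (\<lambda>v. frame_map \<kappa> (dmap c \<xi> p v))) (at ?y)"
    using has_derivative_add[OF has_derivative_const P[OF D(2)]] by simp
  from fun_cong[OF has_derivative_unique[OF 1[unfolded e] 2], of v]
  show "\<xi> p$3 *\<^sub>R dmap c (snd \<circ> contact) p v = frame_map \<kappa> (dmap c \<xi> p v) - dmap c \<xi> p v$3 *\<^sub>R frame_normal \<kappa> (\<xi> p)"
    by (simp add: algebra_simps)
  have 3: "((\<lambda>y. fst (contact (chart_inv c y)) + x (chart_inv c y)$3 *\<^sub>R snd (contact (chart_inv c y))) has_derivative
      (\<lambda>v. dmap c (fst \<circ> contact) p v + (x p$3 *\<^sub>R dmap c (snd \<circ> contact) p v + dmap c x p v$3 *\<^sub>R frame_normal \<kappa> (\<xi> p)))) (at ?y)"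
    using has_derivative_add[OF D(3) has_derivative_scaleR[OF nth[OF D(1)] D(4), of 3]] c by (simp add: n)
  from fun_cong[OF has_derivative_unique[OF 3[unfolded e] P[OF D(1)]], of v]
  show "dmap c (fst \<circ> contact) p v = sig c p v - x p$3 *\<^sub>R dmap c (snd \<circ> contact) p v"
    by (simp add: sig_def algebra_simps)
qed

text \<open>The Euclidean product of two values of \<open>frame_map\<close> exceeds
  \<open>frame_metric\<close> by the product of the last coordinates, which is exactly what the
  normal components removed in \<open>sig\<close> contribute. So \<open>sig\<close> is isometric for
  the induced metric.\<close>

lemma sig_inner:
  assumes c: "c \<in> A" "p \<in> cdom c"
  shows "frame_normal \<kappa> (\<xi> p) \<bullet> sig c p v = 0" "sig c p v \<bullet> sig c p w = frame_metric \<kappa> (dmap c x p v) (dmap c x p w)"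
proof -
  note N = frame_normal_unit[OF xi3 quadric] and T = frame_normal_inner[OF xi3 tangent[OF c]]
  show "frame_normal \<kappa> (\<xi> p) \<bullet> sig c p v = 0" by (simp add: sig_def inner_diff_right N T)
  have PP: "frame_map \<kappa> u \<bullet> frame_map \<kappa> w = frame_metric \<kappa> u w + u$3 * w$3" for u w
    by (simp add: frame_map_def frame_metric_def inner_3 vector_3 power2_eq_square algebra_simps)
  show "sig c p v \<bullet> sig c p w = frame_metric \<kappa> (dmap c x p v) (dmap c x p w)"
    by (simp add: sig_def inner_diff_right inner_diff_left N T PP inner_commute[of "frame_map \<kappa> _" "frame_normal \<kappa> _"] algebra_simps)
qed

lemma linear_sig: "c \<in> A \<Longrightarrow> p \<in> cdom c \<Longrightarrow> linear (sig c p)"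
proof -
  assume c: "c \<in> A" "p \<in> cdom c"
  note L = linear_dmap[OF smooth_x c] and P = bounded_linear.linear[OF bounded_linear_frame_map]
  show ?thesis
    by (rule linearI) (simp_all add: sig_def linear_add[OF L] linear_scale[OF L] linear_add[OF P] linear_scale[OF P] algebra_simps)
qed

text \<open>Together with dx' = sig - x_3 dn this is the formula for R in terms of the inverse of
  S.\<close>

lemma contact_normal_derivative:
  assumes c: "c \<in> A" "p \<in> cdom c" and S: "\<And>v. dmap c \<xi> p v = - dmap c x p (S v)"
  shows "dmap c (snd \<circ> contact) p v = (- 1 / \<xi> p$3) *\<^sub>R sig c p (S v)"
proof -
  note P = bounded_linear.linear[OF bounded_linear_frame_map]
  have "\<xi> p$3 *\<^sub>R dmap c (snd \<circ> contact) p v = - sig c p (S v)"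
    unfolding contact_derivative(1)[OF c] S by (simp add: sig_def linear_neg[OF P])
  then have "(1 / \<xi> p$3) *\<^sub>R (\<xi> p$3 *\<^sub>R dmap c (snd \<circ> contact) p v) = (- 1 / \<xi> p$3) *\<^sub>R sig c p (S v)" by simp
  then show ?thesis using xi3[of p] by simp
qed

text \<open>The immersion property is where nonzero curvatures enter: dn(v) = 0 forces S v = 0
  because \<open>sig\<close> is isometric, and S is invertible by its negative determinant.\<close>

lemma laguerre_contact: "laguerre_surface A contact"
  unfolding laguerre_surface_def immersion_def
proof (intro conjI ballI allI smooth_contact)
  have snd: "snd (contact p) = frame_normal \<kappa> (\<xi> p)" for p by (simp add: contact_def frame_contact_def)
  show "norm (snd (contact p)) = 1" for p
    using frame_normal_unit[OF xi3 quadric, of p] by (simp add: snd norm_eq_1)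
  fix c p assume c: "c \<in> A" "p \<in> cdom c"
  obtain S where S: "linear S" "\<And>v. dmap c \<xi> p v = - dmap c x p (S v)" "det2 S < 0"
    using shape_operator[OF c] by metis
  note dN = contact_normal_derivative[OF c S(2)]
  show "dmap c (fst \<circ> contact) p v \<bullet> snd (contact p) = 0" for v
    unfolding contact_derivative(2)[OF c] dN snd using sig_inner(1)[OF c]
    by (simp add: inner_diff_left inner_diff_right inner_add_right inner_commute)
  have L: "linear (dmap c (snd \<circ> contact) p)" by (rule linear_dmap[OF smooth_contact(2) c])
  show "inj (dmap c (snd \<circ> contact) p)"
    unfolding linear_injective_0[OF L]
  proof (intro allI impI)
    fix v assume "dmap c (snd \<circ> contact) p v = 0"
    then have "sig c p (S v) = 0" unfolding dN using xi3[of p] by simp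
    then have "frame_metric \<kappa> (dmap c x p (S v)) (dmap c x p (S v)) = 0" using sig_inner(2)[OF c, of "S v" "S v"] by simp
    then have z: "S v = 0" using posdef[OF c, of "S v"] by force
    have 1: "v$1 * S ex1$i + v$2 * S ex2$i = 0" for i
      using linear_real2_nth[OF S(1), of v i] z by simp
    have "v$1 * det2 S = (v$1 * S ex1$1 + v$2 * S ex2$1) * S ex2$2 - (v$1 * S ex1$2 + v$2 * S ex2$2) * S ex2$1"
      "v$2 * det2 S = (v$1 * S ex1$2 + v$2 * S ex2$2) * S ex1$1 - (v$1 * S ex1$1 + v$2 * S ex2$1) * S ex1$2"
      by (simp_all add: det2_def algebra_simps)
    then have "v$1 * det2 S = 0" "v$2 * det2 S = 0" unfolding 1 by simp_all
    then show "v = 0" using S(3) by (simp add: vec_eq_iff forall_2)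
  qed
qed

text \<open>As S is traceless, dn \<bullet> dn is - det S / \<xi>_3^2 times the induced metric, so
  conjugacy to dx_3 can be tested in the induced metric, where it is \<open>frame_normal_tp\<close>.
  The trace condition also yields the mean radius x_3 and the value -2 \<Delta> of
  \<open>lag_M\<close>.\<close>

lemma contact_pointwise:
  assumes c: "c \<in> A" "p \<in> cdom c"
  shows "lag_M c contact p \<noteq> 0" "lag_B c contact p = - 2 * (x p$3) * lag_D c contact p"
    "lag_D c contact p * conj_form c p ex1 = (dmap c (snd \<circ> contact) p ex1 \<bullet> dmap c (snd \<circ> contact) p ex1) * dmap c x p ex2$3
      - (dmap c (snd \<circ> contact) p ex1 \<bullet> dmap c (snd \<circ> contact) p ex2) * dmap c x p ex1$3"
    "lag_D c contact p * conj_form c p ex2 = (dmap c (snd \<circ> contact) p ex1 \<bullet> dmap c (snd \<circ> contact) p ex2) * dmap c x p ex2$3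
      - (dmap c (snd \<circ> contact) p ex2 \<bullet> dmap c (snd \<circ> contact) p ex2) * dmap c x p ex1$3"
proof -
  obtain S where S: "linear S" "\<And>v. dmap c \<xi> p v = - dmap c x p (S v)" "tr2 S = 0" "det2 S < 0"
    "S ex1$1 * frame_metric \<kappa> (dmap c x p ex1) (dmap c x p ex2) + S ex1$2 * frame_metric \<kappa> (dmap c x p ex2) (dmap c x p ex2)
     = S ex2$1 * frame_metric \<kappa> (dmap c x p ex1) (dmap c x p ex1) + S ex2$2 * frame_metric \<kappa> (dmap c x p ex1) (dmap c x p ex2)"
    using shape_operator[OF c] by metis
  define n where "n = frame_normal \<kappa> (\<xi> p)"
  have snd: "snd (contact p) = n" by (simp add: contact_def frame_contact_def n_def)
  define s1 s2 where "s1 = sig c p ex1" and "s2 = sig c p ex2"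
  define \<alpha> \<gamma> \<beta> \<delta> where "\<alpha> = S ex1$1" and "\<gamma> = S ex1$2" and "\<beta> = S ex2$1" and "\<delta> = S ex2$2"
  define k where "k = - 1 / \<xi> p$3"
  have k: "k \<noteq> 0" using xi3[of p] by (simp add: k_def)
  define n1 n2 where "n1 = k *\<^sub>R (\<alpha> *\<^sub>R s1 + \<gamma> *\<^sub>R s2)" and "n2 = k *\<^sub>R (\<beta> *\<^sub>R s1 + \<delta> *\<^sub>R s2)"
  have sS: "sig c p (S v) = S v$1 *\<^sub>R s1 + S v$2 *\<^sub>R s2" for v
    unfolding s1_def s2_def by (rule linear_real2[OF linear_sig[OF c]])
  have dn: "dmap c (snd \<circ> contact) p ex1 = n1" "dmap c (snd \<circ> contact) p ex2 = n2"
    unfolding contact_normal_derivative[OF c S(2)] sS by (simp_all add: n1_def n2_def \<alpha>_def \<beta>_def \<gamma>_def \<delta>_def k_def)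
  have dx: "dmap c (fst \<circ> contact) p ex1 = s1 - x p$3 *\<^sub>R n1" "dmap c (fst \<circ> contact) p ex2 = s2 - x p$3 *\<^sub>R n2"
    unfolding contact_derivative(2)[OF c] dn by (simp_all add: s1_def s2_def)
  have tr: "\<alpha> + \<delta> = 0" using S(3) by (simp add: tr2_def \<alpha>_def \<delta>_def)
  have dt: "det2 S = \<alpha> * \<delta> - \<gamma> * \<beta>" by (simp add: det2_def \<alpha>_def \<beta>_def \<gamma>_def \<delta>_def)
  define \<Delta> where "\<Delta> = tp n s1 s2"
  have anti: "tp n s2 s1 = - \<Delta>" by (simp add: tp_def \<Delta>_def algebra_simps)
  have D: "lag_D c contact p = k * k * det2 S * \<Delta>"
    unfolding lag_D_def dn snd n1_def n2_def dt by (simp add: anti \<Delta>_def[symmetric] algebra_simps)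
  \<comment> \<open>The mixed term of dx' + x_3 dn with dn is a multiple of tr S, hence
    zero.\<close>
  have cross: "tp n s1 n2 + tp n n1 s2 = k * ((\<alpha> + \<delta>) * \<Delta>)"
    unfolding n1_def n2_def by (simp add: anti \<Delta>_def[symmetric] algebra_simps)
  show B: "lag_B c contact p = - 2 * (x p$3) * lag_D c contact p"
    using cross tr unfolding lag_B_def lag_D_def dn dx snd by (simp add: algebra_simps)
  have "lag_C c contact p = \<Delta> - x p$3 * (tp n s1 n2 + tp n n1 s2) + (x p$3)\<^sup>2 * lag_D c contact p"
    unfolding lag_C_def lag_D_def dn dx snd \<Delta>_def by (simp add: power2_eq_square algebra_simps)
  then have C: "lag_C c contact p = \<Delta> + (x p$3)\<^sup>2 * lag_D c contact p" using cross tr by simp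
  have D0: "lag_D c contact p \<noteq> 0" by (rule laguerre_density(1)[OF laguerre_contact c])
  have "lag_M c contact p = - 2 * \<Delta>"
    unfolding lag_M_def B C using D0 by (simp add: power2_eq_square field_simps)
  then show "lag_M c contact p \<noteq> 0" using D0 D by auto
  define u w where "u = dmap c x p ex1" and "w = dmap c x p ex2"
  define E F G where "E = frame_metric \<kappa> u u" and "F = frame_metric \<kappa> u w" and "G = frame_metric \<kappa> w w"
  have ss: "s1 \<bullet> s1 = E" "s1 \<bullet> s2 = F" "s2 \<bullet> s1 = F" "s2 \<bullet> s2 = G"
    unfolding s1_def s2_def E_def F_def G_def u_def w_def sig_inner(2)[OF c]
    by (simp_all add: frame_metric_def mult.commute)
  have sym: "\<alpha> * F + \<gamma> * G = \<beta> * E + \<delta> * F"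
    using S(5) by (simp add: \<alpha>_def \<beta>_def \<gamma>_def \<delta>_def E_def F_def G_def u_def w_def)
  note g = traceless_self_adjoint_gram[OF tr sym, folded dt]
  have nn: "n1 \<bullet> n1 = k * k * (- det2 S * E)" "n1 \<bullet> n2 = k * k * (- det2 S * F)" "n2 \<bullet> n2 = k * k * (- det2 S * G)"
    unfolding g[symmetric] n1_def n2_def by (simp_all add: inner_add_left inner_add_right ss algebra_simps)
  have \<Delta>: "\<Delta> = tp (frame_normal \<kappa> (\<xi> p)) (frame_map \<kappa> u) (frame_map \<kappa> w)"
    by (simp add: \<Delta>_def s1_def s2_def sig_def n_def u_def w_def)
  note tt = frame_normal_tp[OF xi3 quadric tangent[OF c, of ex1] tangent[OF c, of ex2] conormal_nonzero,
      folded u_def w_def, folded E_def F_def G_def, folded \<Delta>]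
  have "lag_D c contact p * conj_form c p ex1 = k * k * det2 S * (\<Delta> * (\<xi> p$1 * u$2 - \<xi> p$2 * u$1))"
    "lag_D c contact p * conj_form c p ex2 = k * k * det2 S * (\<Delta> * (\<xi> p$1 * w$2 - \<xi> p$2 * w$1))"
    by (simp_all add: D conj_form_def u_def w_def)
  then show "lag_D c contact p * conj_form c p ex1 = (dmap c (snd \<circ> contact) p ex1 \<bullet> dmap c (snd \<circ> contact) p ex1) * dmap c x p ex2$3
      - (dmap c (snd \<circ> contact) p ex1 \<bullet> dmap c (snd \<circ> contact) p ex2) * dmap c x p ex1$3"
    "lag_D c contact p * conj_form c p ex2 = (dmap c (snd \<circ> contact) p ex1 \<bullet> dmap c (snd \<circ> contact) p ex2) * dmap c x p ex2$3
      - (dmap c (snd \<circ> contact) p ex2 \<bullet> dmap c (snd \<circ> contact) p ex2) * dmap c x p ex1$3"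
    unfolding tt dn nn u_def[symmetric] w_def[symmetric] by (simp_all add: algebra_simps)
qed

lemma umbilical_free_contact: "umbilical_free A contact"
  unfolding umbilical_free_def
  using contact_pointwise(1) laguerre_density(2)[OF laguerre_contact] by fastforce

text \<open>The second derivatives of x cancel by symmetry. With d\<xi> = - dx \<circ> S the
  remaining difference is - tr S times \<open>u$1 * w$2 - u$2 * w$1\<close>.\<close>

lemma conj_form_closed:
  assumes c: "c \<in> A" and y: "y \<in> cimg c"
  shows "dd (\<lambda>y. conj_form c (chart_inv c y) ex2) y ex1 =
        dd (\<lambda>y. conj_form c (chart_inv c y) ex1) y ex2"
proof -
  define p where "p = chart_inv c y"
  have p: "p \<in> cdom c" using c y by (simp add: p_def)
  obtain S where S: "linear S" "\<And>v. dmap c \<xi> p v = - dmap c x p (S v)" "tr2 S = 0"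
    using shape_operator[OF c p] by metis
  define X where "X = x \<circ> chart_inv c"
  have smX: "smooth_on (cimg c) X" using smooth_map_smooth_on[OF smooth_x c] by (simp add: X_def)
  let ?XX = "\<lambda>v w. dd (\<lambda>z. dd X z v) y w"
  have e: "dd (\<lambda>y. conj_form c (chart_inv c y) v) y w =
     \<xi> p$1 * ?XX v w$2 + dmap c \<xi> p w$1 * dmap c x p v$2 - (\<xi> p$2 * ?XX v w$1 + dmap c \<xi> p w$2 * dmap c x p v$1)" for v w
  proof -
    have DX: "((\<lambda>z. dd X z v$i) has_derivative (\<lambda>w. ?XX v w$i)) (at y)" for i
      by (rule bounded_linear.has_derivative[OF bounded_linear_vec_nth
            smooth_on_has_derivative[OF smooth_on_derivative[OF smX] y]])
    have D\<xi>: "((\<lambda>y. \<xi> (chart_inv c y)$i) has_derivative (\<lambda>v. dmap c \<xi> p v$i)) (at y)" for i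
      using bounded_linear.has_derivative[OF bounded_linear_vec_nth smooth_map_has_derivative[OF smooth_xi c y]]
      by (simp add: o_def p_def)
    have "((\<lambda>y. conj_form c (chart_inv c y) v) has_derivative (\<lambda>w.
      (\<xi> (chart_inv c y)$1 * ?XX v w$2 + dmap c \<xi> p w$1 * dd X y v$2)
      - (\<xi> (chart_inv c y)$2 * ?XX v w$1 + dmap c \<xi> p w$2 * dd X y v$1))) (at y)"
      by (rule has_derivative_transform_within_open[OF has_derivative_diff[OF has_derivative_mult[OF D\<xi>[of 1] DX[of 2]]
              has_derivative_mult[OF D\<xi>[of 2] DX[of 1]]] open_img[OF c] y])
        (simp add: conj_form_def dmap_def X_def c)
    from frechet_derivative_at[OF this, symmetric] show ?thesis using c y by (simp add: p_def dmap_def X_def)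
  qed
  have sym: "?XX ex2 ex1 = ?XX ex1 ex2" by (rule smooth_on_symmetric_derivative[OF open_img[OF c] smX y])
  define u w where "u = dmap c x p ex1" and "w = dmap c x p ex2"
  have LS: "dmap c x p (S v) = S v$1 *\<^sub>R u + S v$2 *\<^sub>R w" for v
    unfolding u_def w_def by (rule linear_real2[OF linear_dmap[OF smooth_x c p]])
  have "S ex2$2 = - S ex1$1" using S(3) by (simp add: tr2_def)
  then show ?thesis
    unfolding e sym S(2) LS u_def[symmetric] w_def[symmetric] by (simp add: algebra_simps)
qed

lemma conjugate_radius_contact: "conjugate_radius contact (\<lambda>p. x p$3) conj_form"
  unfolding conjugate_radius_def
proof (intro conjI ballI allI)
  show "smooth_map A (\<lambda>p. x p$3)"
    unfolding smooth_map_def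
  proof
    fix c assume c: "c \<in> A"
    show "smooth_on (cimg c) ((\<lambda>p. x p$3) \<circ> chart_inv c)"
      using smooth_on_vec_nth[OF open_img[OF c] smooth_map_smooth_on[OF smooth_x c], of 3] by (simp add: o_def)
  qed
  fix c assume c: "c \<in> A"
  show "linear (conj_form c p)" if p: "p \<in> cdom c" for p
  proof -
    note L = linear_dmap[OF smooth_x c p]
    show ?thesis by (rule linearI) (simp_all add: conj_form_def linear_add[OF L] linear_scale[OF L] algebra_simps)
  qed
  show "conj_form c p v = conj_form d p (dmap c (snd d) p v)" if d: "d \<in> A" and p: "p \<in> cdom c \<inter> cdom d" for d p v
    using dmap_change_chart(1)[OF c d _ _ smooth_map_differentiable[OF smooth_x d], of p] p by (simp add: conj_form_def)
  show "smooth_on (cimg c) (\<lambda>y. conj_form c (chart_inv c y) v)" for v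
  proof -
    note o = open_img[OF c]
    have s\<xi>: "smooth_on (cimg c) (\<lambda>y. \<xi> (chart_inv c y))" using smooth_map_smooth_on[OF smooth_xi c] by (simp add: o_def)
    have "smooth_on (cimg c) (\<lambda>y. \<xi> (chart_inv c y)$1 * dd (x \<circ> chart_inv c) y v$2
        - \<xi> (chart_inv c y)$2 * dd (x \<circ> chart_inv c) y v$1)"
      by (intro smooth_on_diff smooth_on_mult smooth_on_vec_nth smooth_on_derivative o s\<xi> smooth_map_smooth_on[OF smooth_x c])
    then show ?thesis
      by (rule smooth_on_cong[OF o, rotated]) (simp add: conj_form_def dmap_def c)
  qed
  show "dd (\<lambda>y. conj_form c (chart_inv c y) ex2) y ex1 =
        dd (\<lambda>y. conj_form c (chart_inv c y) ex1) y ex2" if "y \<in> cimg c" for y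
    by (rule conj_form_closed[OF c that])
  fix p assume p: "p \<in> cdom c"
  have d: "dmap c (\<lambda>p. x p$3) p v = dmap c x p v$3" for v
  proof -
    have "((\<lambda>p. x p$3) \<circ> chart_inv c has_derivative (\<lambda>v. dmap c x p v$3)) (at (snd c p))"
      using bounded_linear.has_derivative[OF bounded_linear_vec_nth smooth_map_has_derivative[OF smooth_x c, of "snd c p"], of 3] c p
      by (simp add: o_def)
    from fun_cong[OF frechet_derivative_at[OF this], of v] show ?thesis by (simp add: dmap_def)
  qed
  show "lag_B c contact p = - 2 * (x p$3) * lag_D c contact p" by (rule contact_pointwise(2)[OF c p])
  show "lag_D c contact p * conj_form c p ex1 = (dmap c (snd \<circ> contact) p ex1 \<bullet> dmap c (snd \<circ> contact) p ex1) * dmap c (\<lambda>p. x p$3) p ex2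
          - (dmap c (snd \<circ> contact) p ex1 \<bullet> dmap c (snd \<circ> contact) p ex2) * dmap c (\<lambda>p. x p$3) p ex1"
    unfolding d by (rule contact_pointwise(3)[OF c p])
  show "lag_D c contact p * conj_form c p ex2 = (dmap c (snd \<circ> contact) p ex1 \<bullet> dmap c (snd \<circ> contact) p ex2) * dmap c (\<lambda>p. x p$3) p ex2
          - (dmap c (snd \<circ> contact) p ex2 \<bullet> dmap c (snd \<circ> contact) p ex2) * dmap c (\<lambda>p. x p$3) p ex1"
    unfolding d by (rule contact_pointwise(4)[OF c p])
qed

lemma laguerre_minimal_contact: "laguerre_minimal A contact"
  by (rule conjugate_radius_imp_laguerre_minimal[OF laguerre_contact umbilical_free_contact conjugate_radius_contact])

end

section \<open>The embeddings \<open>laguerre_sigma\<close> and \<open>laguerre_tau\<close> as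
  instances of the model\<close>

context atlas_surface begin

lemma sigma_laguerre_minimal:
  assumes or: "oriented_spacelike_31 A x \<xi>" and nz: "nonzero_principal_curvatures A x \<xi>" and min: "minimal_surface A x \<xi>"
  shows "laguerre_minimal A (\<lambda>p. laguerre_sigma (x p, \<xi> p))"
proof -
  have q: "lorentz3 (\<xi> p) (\<xi> p) = - 1" for p using or by (simp add: oriented_spacelike_31_def)
  have "minimal_model A 0 x \<xi>"
  proof (unfold_locales)
    show "smooth_map A x" "smooth_map A \<xi>"
      using or by (simp_all add: oriented_spacelike_31_def spacelike_def immersion_def)
    show qq: "(1 + 0 * \<xi> p$3)\<^sup>2 + (\<xi> p$1)\<^sup>2 + (\<xi> p$2)\<^sup>2 = (\<xi> p$3)\<^sup>2" for p
      using q[of p] by (simp add: lorentz3_def power2_eq_square)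
    show "\<xi> p$3 \<noteq> 0" for p
    proof
      assume "\<xi> p$3 = 0"
      then have "1 + (\<xi> p$1)\<^sup>2 + (\<xi> p$2)\<^sup>2 = 0" using qq[of p] by simp
      then show False by (smt (verit) zero_le_power2)
    qed
    fix c p v assume c: "c \<in> A" "p \<in> cdom c"
    have "lorentz3 (\<xi> p) (dmap c x p v) = 0" using or c by (simp add: oriented_spacelike_31_def)
    then show "\<xi> p$1 * dmap c x p v$1 + \<xi> p$2 * dmap c x p v$2 + conormal_coeff 0 (\<xi> p) * dmap c x p v$3 = 0"
      by (simp add: lorentz3_def conormal_coeff_def)
    assume "v \<noteq> 0"
    then have "lorentz3 (dmap c x p v) (dmap c x p v) > 0" using or c by (simp add: oriented_spacelike_31_def spacelike_def)
    then show "frame_metric 0 (dmap c x p v) (dmap c x p v) > 0" by (simp add: lorentz3_def frame_metric_def)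
  qed (use nz min in auto)
  then interpret minimal_model A 0 x \<xi> .
  have "contact = (\<lambda>p. laguerre_sigma (x p, \<xi> p))"
    by (simp add: fun_eq_iff contact_def frame_contact_def frame_normal_def frame_map_def laguerre_sigma_def
        vec_eq_iff forall_3 vector_3 axis_def)
  then show ?thesis using laguerre_minimal_contact by simp
qed

lemma tau_laguerre_minimal:
  assumes or: "oriented_spacelike_30 A x \<xi>" and nz: "nonzero_principal_curvatures A x \<xi>" and min: "minimal_surface A x \<xi>"
  shows "laguerre_minimal A (\<lambda>p. laguerre_tau (x p, \<xi> p))"
proof -
  \<comment> \<open>Forgets the first coordinate, which is determined by the fourth: x_1 = x_4 and
    \<xi>_1 = \<xi>_4 + 1.\<close>
  define R :: "real^4 \<Rightarrow> real^3" where "R = (\<lambda>u. vector [u$2, u$3, u$4])"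
  have R: "R u$1 = u$2" "R u$2 = u$3" "R u$3 = u$4" for u by (simp_all add: R_def vector_3)
  have bR: "bounded_linear R"
    unfolding R_def vector_3_eq by (intro bounded_linear_add bounded_linear_scaleR_const bounded_linear_vec_nth)
  have null: "null_vec$1 = 1" "null_vec$2 = 0" "null_vec$3 = 0" "null_vec$4 = 1"
    by (simp_all add: null_vec_def vector_def)
  have sx: "smooth_map A x" and s\<xi>: "smooth_map A \<xi>"
    using or by (simp_all add: oriented_spacelike_30_def spacelike_def immersion_def)
  have x14: "x p$1 = x p$4" and \<xi>14: "\<xi> p$1 = \<xi> p$4 + 1" for p
  proof -
    have "lorentz4 (x p) null_vec = 0" "lorentz4 (\<xi> p) null_vec = 1" using or by (simp_all add: oriented_spacelike_30_def)
    then show "x p$1 = x p$4" "\<xi> p$1 = \<xi> p$4 + 1" by (simp_all add: lorentz4_def null)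
  qed
  have dR: "dmap c (\<lambda>p. R (f p)) p v = R (dmap c f p v)" if "smooth_map A f" "c \<in> A" "p \<in> cdom c" for f c p v
  proof -
    have "((\<lambda>p. R (f p)) \<circ> chart_inv c has_derivative (\<lambda>v. R (dmap c f p v))) (at (snd c p))"
      using bounded_linear.has_derivative[OF bR smooth_map_has_derivative[OF that(1,2), of "snd c p"]] that
      by (simp add: o_def)
    from fun_cong[OF frechet_derivative_at[OF this], of v] show ?thesis by (simp add: dmap_def)
  qed
  \<comment> \<open>Applied with \<open>k\<close> = 0 to x and with \<open>k\<close> = 1 to \<xi>;
    the constant drops out of the differential.\<close>
  have d14: "dmap c f p v$1 = dmap c f p v$4"
    if "smooth_map A f" "\<And>p. f p$1 = f p$4 + k" "c \<in> A" "p \<in> cdom c" for f :: "'a \<Rightarrow> real^4" and k c p v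
  proof -
    have D: "((\<lambda>y. f (chart_inv c y)) has_derivative dmap c f p) (at (snd c p))"
      using smooth_map_has_derivative[OF that(1,3), of "snd c p"] that by (simp add: o_def)
    have 1: "((\<lambda>y. f (chart_inv c y)$4 + k) has_derivative (\<lambda>v. dmap c f p v$1)) (at (snd c p))"
      using bounded_linear.has_derivative[OF bounded_linear_vec_nth D, of 1] unfolding that(2) .
    have 2: "((\<lambda>y. f (chart_inv c y)$4 + k) has_derivative (\<lambda>v. dmap c f p v$4)) (at (snd c p))"
      using has_derivative_add[OF bounded_linear.has_derivative[OF bounded_linear_vec_nth D, of 4] has_derivative_const] by simp
    from fun_cong[OF has_derivative_unique[OF 1 2], of v] show ?thesis .
  qed
  \<comment> \<open>All differentials have equal first and fourth entries, so \<open>R\<close> loses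
    nothing on them and the equation defining the shape operator is the same before and
    after.\<close>
  have pc: "principal_curvatures c (\<lambda>p. R (x p)) (\<lambda>p. R (\<xi> p)) p = principal_curvatures c x \<xi> p"
    if c: "c \<in> A" "p \<in> cdom c" for c p
  proof -
    have "dmap c \<xi> p v = - dmap c x p w \<longleftrightarrow> R (dmap c \<xi> p v) = - R (dmap c x p w)" for v w
      using d14[OF sx _ c, of 0 w] d14[OF s\<xi> \<xi>14 c, of v] x14
      by (auto simp: vec_eq_iff forall_3 forall_4 R)
    then show ?thesis
      unfolding principal_curvatures_def neg_quotient_def dR[OF sx c] dR[OF s\<xi> c] by simp
  qed
  have smR: "smooth_map A (\<lambda>p. R (f p))" if "smooth_map A f" for f
    unfolding smooth_map_def
  proof
    fix c assume c: "c \<in> A"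
    show "smooth_on (cimg c) ((\<lambda>p. R (f p)) \<circ> chart_inv c)"
      using smooth_on_compose_linear[OF open_img[OF c] bR smooth_map_smooth_on[OF that c]] by (simp add: o_def)
  qed
  have q: "(1 + 1 * R (\<xi> p)$3)\<^sup>2 + (R (\<xi> p)$1)\<^sup>2 + (R (\<xi> p)$2)\<^sup>2 = (R (\<xi> p)$3)\<^sup>2" for p
  proof -
    have "lorentz4 (\<xi> p) (\<xi> p) = 0" using or by (simp add: oriented_spacelike_30_def)
    then show ?thesis by (simp add: lorentz4_def R \<xi>14 power2_eq_square algebra_simps)
  qed
  have "minimal_model A 1 (\<lambda>p. R (x p)) (\<lambda>p. R (\<xi> p))"
  proof (unfold_locales)
    show "smooth_map A (\<lambda>p. R (x p))" "smooth_map A (\<lambda>p. R (\<xi> p))" using smR sx s\<xi> by auto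
    show "(1 + 1 * R (\<xi> p)$3)\<^sup>2 + (R (\<xi> p)$1)\<^sup>2 + (R (\<xi> p)$2)\<^sup>2 = (R (\<xi> p)$3)\<^sup>2" for p by (rule q)
    show "R (\<xi> p)$3 \<noteq> 0" for p
    proof
      assume "R (\<xi> p)$3 = 0"
      then have "1 + (R (\<xi> p)$1)\<^sup>2 + (R (\<xi> p)$2)\<^sup>2 = 0" using q[of p] by simp
      then show False by (smt (verit) zero_le_power2)
    qed
    show "nonzero_principal_curvatures A (\<lambda>p. R (x p)) (\<lambda>p. R (\<xi> p))" "minimal_surface A (\<lambda>p. R (x p)) (\<lambda>p. R (\<xi> p))"
      using nz min unfolding nonzero_principal_curvatures_def minimal_surface_def by (metis pc)+
    fix c p v assume c: "c \<in> A" "p \<in> cdom c"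
    have e: "dmap c x p v$1 = dmap c x p v$4" by (rule d14[OF sx _ c, of 0]) (simp add: x14)
    have "lorentz4 (\<xi> p) (dmap c x p v) = 0" using or c by (simp add: oriented_spacelike_30_def)
    then show "R (\<xi> p)$1 * dmap c (\<lambda>p. R (x p)) p v$1 + R (\<xi> p)$2 * dmap c (\<lambda>p. R (x p)) p v$2
        + conormal_coeff 1 (R (\<xi> p)) * dmap c (\<lambda>p. R (x p)) p v$3 = 0"
      by (simp add: dR[OF sx c] R lorentz4_def conormal_coeff_def e \<xi>14 algebra_simps)
    assume "v \<noteq> 0"
    then have "lorentz4 (dmap c x p v) (dmap c x p v) > 0" using or c by (simp add: oriented_spacelike_30_def spacelike_def)
    then show "frame_metric 1 (dmap c (\<lambda>p. R (x p)) p v) (dmap c (\<lambda>p. R (x p)) p v) > 0"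
      by (simp add: dR[OF sx c] R lorentz4_def frame_metric_def e)
  qed
  then interpret minimal_model A 1 "\<lambda>p. R (x p)" "\<lambda>p. R (\<xi> p)" .
  \<comment> \<open>The first entry of P x - x_4 \<xi>' is x_4 - x_4 (1 + 1 / \<xi>_4) = - x_4 /
    \<xi>_4, as in \<open>laguerre_tau\<close>.\<close>
  have "contact p = laguerre_tau (x p, \<xi> p)" for p
    using xi3[of p]
    by (simp add: contact_def frame_contact_def frame_normal_def frame_map_def laguerre_tau_def
        vec_eq_iff forall_3 vector_3 axis_def R field_simps)
  then have "contact = (\<lambda>p. laguerre_tau (x p, \<xi> p))" by (rule ext)
  then show ?thesis using laguerre_minimal_contact by simp
qed

end

theorem mainTheorem3:
  fixes A :: "'a::{t2_space,second_countable_topology} chart set"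
  assumes "smooth_2_atlas A"
  shows "(\<forall>x \<xi> :: 'a \<Rightarrow> real^3.
            oriented_spacelike_31 A x \<xi> \<and> nonzero_principal_curvatures A x \<xi> \<and>
            minimal_surface A x \<xi> \<longrightarrow>
            laguerre_minimal A (\<lambda>p. laguerre_sigma (x p, \<xi> p))) \<and>
         (\<forall>x \<xi> :: 'a \<Rightarrow> real^4.
            oriented_spacelike_30 A x \<xi> \<and> nonzero_principal_curvatures A x \<xi> \<and>
            minimal_surface A x \<xi> \<longrightarrow>
            laguerre_minimal A (\<lambda>p. laguerre_tau (x p, \<xi> p)))"
proof -
  interpret atlas_surface A using assms by unfold_locales
  show ?thesis using sigma_laguerre_minimal tau_laguerre_minimal by blast
qed

end
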